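(* Let $n\ge 2$ and let $\mathcal{A}_n(a,c)$ be a spherical antiprism in $\mathbb{S}^3$ with $2n$ vertices given by its edge lengths $a,c$. Then the volume $V=\mathrm{vol}(\mathcal{A}_n(a,c))$ is given by the formula $$ V=n \int_{c_0}^c \frac{a\,G+t\,H}{(1+\cos a-2\cos^2 t)\sqrt{R}}\,dt, $$ where \begin{align*} G&=-2\left(\cos t-\cos\frac{\pi}{n}\right)\sin a\,\sin t,\\ H&=(1-\cos a)\left(1+\cos a+2\cos^2 t-4\cos t\,\cos\frac{\pi}{n}\right),\\ R&=(1+\cos a)^2-4\left(\cos^2 t+\sin^2 t\,\cos^2\frac{\pi}{n}-(1-\cos a)\cos t\,\cos\frac{\pi}{n}\right), \end{align*} and $c_0\in[0,\pi]$ is the root of the equation $2\cos c_0\left(1+\cos\frac{\pi}{n}\right)=1+\cos a+2\cos\frac{\pi}{n}$.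
   Context: $\mathbb{S}^3$ is the three-dimensional spherical space of constant curvature $1$ (the unit sphere in $\mathbb{R}^4$ with its intrinsic metric and volume). A spherical antiprism $\mathcal{A}_n$ is a (non-degenerate) convex polyhedron in $\mathbb{S}^3$ with $2n$ vertices, having two equal regular $n$-gons as the top and bottom faces and $2n$ equal (isosceles) triangles as lateral faces. It has the symmetry group $S_{2n}$ generated by a mirror-rotational symmetry of order $2n$: the composition of the rotation by angle $\pi/n$ about the axis passing through the centres of the top and bottom faces and the reflection in a plane (great 2-sphere) perpendicular to this axis. $\mathcal{A}_n(a,c)$ denotes the antiprism in which the edges of the top and bottom $n$-gons have length $a$ and the lateral edges have length $c$. For $n=2$ the top and bottom $n$-gons degenerate to two skew edges of length $a$, and $\mathcal{A}_2(a,c)$ is a tetrahedron with two opposite edges of length $a$ and four edges of length $c$. *)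

theory Defs
  imports "HOL-Analysis.Analysis"
begin

text \<open>
  The space \<open>S\<^sup>3\<close> is \<open>sphere 0 1\<close> in \<open>real ^ 4\<close>.  A convex subset \<open>P\<close> of \<open>S\<^sup>3\<close> is studied
  through the cone \<open>conic hull P\<close> over it: great spheres, hemispheres and faces of \<open>P\<close> are the
  traces on \<open>S\<^sup>3\<close> of hyperplanes and half-spaces through the origin and of faces of that cone.
\<close>

definition sph_dist :: "real ^ 4 \<Rightarrow> real ^ 4 \<Rightarrow> real" where
  "sph_dist x y = arccos (x \<bullet> y)"

text \<open>
  Integration in polar coordinates gives a region \<open>P\<close> of \<open>S\<^sup>3\<close> of volume \<open>V\<close> a solid cone
  of Lebesgue measure \<open>V\<close> times the integral of \<open>r\<^sup>3\<close> over \<open>[0, 1]\<close>, that is \<open>V / 4\<close>.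
  In particular \<open>S\<^sup>3\<close> itself has volume \<open>2 * pi\<^sup>2\<close>.
\<close>

definition sph_volume :: "(real ^ 4) set \<Rightarrow> real" where
  "sph_volume P = 4 * measure lebesgue {r *\<^sub>R x | r x. 0 \<le> r \<and> r \<le> 1 \<and> x \<in> P}"

definition sph_hull :: "(real ^ 4) set \<Rightarrow> (real ^ 4) set" where
  "sph_hull S = sphere 0 1 \<inter> (convex_cone hull S)"

text \<open>
  A non-degenerate convex polyhedron in \<open>S\<^sup>3\<close>: a finite intersection of closed hemispheres
  with interior points and without antipodal points.
\<close>

definition convex_sph_polyhedron :: "(real ^ 4) set \<Rightarrow> bool" where
  "convex_sph_polyhedron P \<longleftrightarrow>
     P \<subseteq> sphere 0 1 \<and> polyhedron (conic hull P) \<and> interior (conic hull P) \<noteq> {} \<and>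
     (\<forall>x\<in>P. - x \<notin> P)"

definition sph_vertices :: "(real ^ 4) set \<Rightarrow> (real ^ 4) set" where
  "sph_vertices P = {x \<in> P. (conic hull {x}) face_of (conic hull P)}"

definition sph_facets :: "(real ^ 4) set \<Rightarrow> (real ^ 4) set set" where
  "sph_facets P = {sphere 0 1 \<inter> F | F. F facet_of (conic hull P)}"

text \<open>
  Rotation by \<open>\<theta>\<close> about the great circle through the orthonormal vectors \<open>p\<close>, \<open>q\<close>;
  \<open>e1\<close>, \<open>e2\<close> is an orthonormal basis of the orthogonal complement of their plane.
\<close>

definition rotation_about ::
  "real ^ 4 \<Rightarrow> real ^ 4 \<Rightarrow> real \<Rightarrow> (real ^ 4 \<Rightarrow> real ^ 4) \<Rightarrow> bool" where
  "rotation_about p q \<theta> \<rho> \<longleftrightarrow> linear \<rho> \<and>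
     (\<exists>e1 e2. norm p = 1 \<and> norm q = 1 \<and> norm e1 = 1 \<and> norm e2 = 1 \<and>
        p \<bullet> q = 0 \<and> p \<bullet> e1 = 0 \<and> p \<bullet> e2 = 0 \<and> q \<bullet> e1 = 0 \<and> q \<bullet> e2 = 0 \<and> e1 \<bullet> e2 = 0 \<and>
        \<rho> p = p \<and> \<rho> q = q \<and>
        \<rho> e1 = cos \<theta> *\<^sub>R e1 + sin \<theta> *\<^sub>R e2 \<and>
        \<rho> e2 = - sin \<theta> *\<^sub>R e1 + cos \<theta> *\<^sub>R e2)"

definition reflection :: "real ^ 4 \<Rightarrow> real ^ 4 \<Rightarrow> real ^ 4" where
  "reflection q x = x - (2 * (x \<bullet> q)) *\<^sub>R q"

text \<open>
  The great sphere orthogonal to \<open>q\<close> is perpendicular to the axis precisely because \<open>q\<close> lies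
  in the plane of the axis.
\<close>

definition mirror_rotation :: "real \<Rightarrow> (real ^ 4 \<Rightarrow> real ^ 4) \<Rightarrow> bool" where
  "mirror_rotation \<theta> f \<longleftrightarrow> (\<exists>p q \<rho>. rotation_about p q \<theta> \<rho> \<and> f = reflection q \<circ> \<rho>)"

text \<open>
  The vertices are \<open>v 0, \<dots>, v (2 * n - 1)\<close>, with the top vertices at even and the bottom vertices
  at odd indices; as a mirror rotation by \<open>pi / n\<close> has order \<open>2 * n\<close>, the sequence \<open>v\<close> is
  periodic with period \<open>2 * n\<close>, so that the conditions on all \<open>k\<close> are cyclic.
  Since \<open>f \<circ> f\<close> is the rotation by \<open>2 * pi / n\<close> and sends \<open>v k\<close> to \<open>v (k + 2)\<close>, the top
  and bottom polygons are regular, their sides joining \<open>v k\<close> to \<open>v (k + 2)\<close>; \<open>f\<close> maps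
  one onto the other.  For \<open>n = 2\<close> they degenerate to edges, so only the lateral triangles are facets.
\<close>

definition spherical_antiprism :: "nat \<Rightarrow> real \<Rightarrow> real \<Rightarrow> (real ^ 4) set \<Rightarrow> bool" where
  "spherical_antiprism n a c P \<longleftrightarrow>
     convex_sph_polyhedron P \<and>
     (\<exists>v f. mirror_rotation (pi / real n) f \<and> f ` P = P \<and>
        bij_betw v {..<2 * n} (sph_vertices P) \<and>
        (\<forall>k. f (v k) = v (k + 1)) \<and>
        sph_facets P =
          {sph_hull {v k, v (k + 1), v (k + 2)} | k. k < 2 * n} \<union>
          (if n \<ge> 3 then {sph_hull {v k | k. k < 2 * n \<and> even k},
                           sph_hull {v k | k. k < 2 * n \<and> odd k}}
           else {}) \<and>
        (\<forall>k. sph_dist (v k) (v (k + 2)) = a) \<and>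
        (\<forall>k. sph_dist (v k) (v (k + 1)) = c))"

end

theory Submission
  imports Defs
begin

text \<open>
  Seen from its axis, the cone over the antiprism splits, up to null sets, into \<open>2 * n\<close> congruent
  sectors, one for each vertex.  Let the vertices be at distance \<open>r\<close> from the plane of the axis and
  have coordinates \<open>\<plusminus>h\<close>, \<open>w\<close> in that plane.  After division of the coordinates by \<open>r\<close>, \<open>r\<close>, \<open>h\<close>,
  \<open>w\<close> the antiprism no longer depends on its shape, so that the volume of a sector becomes an
  integral over a fixed region.  All but the integration along the axis can be carried out, which
  leaves the integral of an explicit function \<open>J b z\<close> over \<open>z \<in> [-1, 1]\<close>, where
  \<open>h = \<sigma> * sin b\<close>, \<open>w = \<sigma> * cos b\<close> and \<open>\<sigma>\<close> is determined by the edge length \<open>a\<close>.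

  The derivative of \<open>J\<close> with respect to \<open>b\<close> is the sum of an exact \<open>z\<close>-derivative, whose boundary
  value contributes the edge \<open>a\<close>, of a constant divided by the squared length of the point at height
  \<open>z\<close> of a lateral edge, whose integral contributes the edge \<open>t\<close>, and of an odd function of \<open>z\<close>.
  This replaces Schlaefli's formula.  It remains to integrate from the flat antiprism \<open>b = 0\<close>,
  where \<open>t = c0\<close>, and to substitute \<open>t\<close> for \<open>b\<close>.
\<close>

section \<open>The volume of a sector as a function of the shape\<close>

text \<open>With \<open>\<rho>\<close> and \<open>\<sigma>\<close> fixed the base edge
  \<open>a\<close> is fixed too, so the path from the flat antiprism moves only the lateral edge. In
  the chart the shape \<open>b\<close> enters the region only through the radial bound and the
  density only through a constant factor. Once the radial variable is integrated out,
  differentiation under the integral sign meets no moving boundary and needs no dihedral angle. The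
  obstacle at the other end is that the integrand of the theorem has \<open>R = 0\<close> at
  \<open>c0\<close>. In the variable \<open>b\<close>, \<open>R\<close> is the square of
  \<open>4 * S * h b * w b\<close>, and the derivative of \<open>t\<close> carries the same factor
  \<open>h b * w b\<close>; hence the substitution removes the singularity. Integrability in
  \<open>t\<close> still has to be established before the substitution is allowed. A further gap is
  geometric: the polyhedron is given by its facets and its symmetry, whereas the decomposition into
  sectors needs the cone as the hull of explicit vertices.\<close>

text \<open>
  Here \<open>c = (1 + cos (pi / n)) / 2\<close> and \<open>S = sin (pi / n)\<close>.  In the normalised chart, the sector of a
  vertex at height \<open>z = -1\<close> has at height \<open>z\<close> an isosceles triangle with apex on the axis, altitude
  \<open>d z\<close> and half base \<open>l z\<close>; \<open>m\<close> and \<open>k\<close> are the squared norms of the apex and of the foot of the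
  altitude, in the original coordinates.
\<close>


locale antiprism_profile =
  fixes c S \<rho> \<sigma> :: real
  assumes c_ge: "1 / 2 \<le> c" and c_less_1: "c < 1" and S_pos: "0 < S"
    and S_eq: "S\<^sup>2 = 4 * c * (1 - c)" and rho_pos: "0 < \<rho>" and sigma_pos: "0 < \<sigma>"
    and unit: "\<rho>\<^sup>2 + \<sigma>\<^sup>2 = 1"
begin

definition h :: "real \<Rightarrow> real" where "h b = \<sigma> * sin b"
definition w :: "real \<Rightarrow> real" where "w b = \<sigma> * cos b"
definition d :: "real \<Rightarrow> real" where "d z = c + (c - 1) * z"
definition m :: "real \<Rightarrow> real \<Rightarrow> real" where "m b z = (h b)\<^sup>2 * z\<^sup>2 + (w b)\<^sup>2"
definition k :: "real \<Rightarrow> real \<Rightarrow> real" where "k b z = m b z + \<rho>\<^sup>2 * (d z)\<^sup>2"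
definition l :: "real \<Rightarrow> real" where "l z = S * (1 + z) / 2"
text \<open>Four times the density in \<open>z\<close> that the three inner integrations of the
  measure of a sector leave. The arctan is half the angle under which the base of the triangle at
  height \<open>z\<close> is seen from the origin.\<close>

definition J :: "real \<Rightarrow> real \<Rightarrow> real" where
  "J b z = \<rho> * (h b * w b * d z / (m b z * sqrt (k b z))) * arctan (\<rho> * l z / sqrt (k b z))"

lemma m_pos: "w b \<noteq> 0 \<Longrightarrow> 0 < m b z"
  unfolding m_def by (intro add_nonneg_pos) auto

lemma k_pos: "w b \<noteq> 0 \<Longrightarrow> 0 < k b z"
  unfolding k_def using m_pos[of b z] by (intro add_pos_nonneg) auto

text \<open>The split is into a multiple of the arctan and a rational remainder. Up to
  \<open>\<rho>\<close> the factor of the arctan is the \<open>z\<close>-derivative of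
  \<open>E b\<close>, so an exact derivative can remove the arctan.\<close>

definition J' :: "real \<Rightarrow> real \<Rightarrow> real" where
  "J' b z = \<rho> * (((w b)\<^sup>2 - (h b)\<^sup>2) * d z / (m b z * sqrt (k b z))
      - h b * w b * d z * (2 * h b * w b * (z\<^sup>2 - 1)) * (1 / ((m b z)\<^sup>2 * sqrt (k b z)) + 1 / (2 * m b z * k b z * sqrt (k b z))))
      * arctan (\<rho> * l z / sqrt (k b z))
    - \<rho>\<^sup>2 * (h b * w b)\<^sup>2 * d z * l z * (z\<^sup>2 - 1) / (m b z * k b z * (k b z + \<rho>\<^sup>2 * (l z)\<^sup>2))"

lemma h_deriv: "(h has_real_derivative w b) (at b within U)"
  unfolding h_def w_def by (auto intro!: derivative_eq_intros)
lemma w_deriv: "(w has_real_derivative - h b) (at b within U)"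
  unfolding h_def w_def by (auto intro!: derivative_eq_intros)

lemma m_deriv: "((\<lambda>b. m b z) has_real_derivative 2 * h b * w b * (z\<^sup>2 - 1)) (at b within U)"
  unfolding m_def by (rule derivative_eq_intros h_deriv w_deriv refl)+ (simp add: algebra_simps)
lemma k_deriv: "((\<lambda>b. k b z) has_real_derivative 2 * h b * w b * (z\<^sup>2 - 1)) (at b within U)"
  unfolding k_def by (rule derivative_eq_intros m_deriv refl)+ simp

lemma arctan_sqrt_deriv:
  fixes f g :: "real \<Rightarrow> real"
  assumes f: "(f has_real_derivative f') (at x within U)" and g: "(g has_real_derivative g') (at x within U)"
    and pos: "0 < g x"
  shows "((\<lambda>x. arctan (f x / sqrt (g x))) has_real_derivative
     (f' * g x - f x * g' / 2) / (sqrt (g x) * (g x + (f x)\<^sup>2))) (at x within U)"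
proof -
  have "((\<lambda>x. arctan (f x / sqrt (g x))) has_real_derivative
     inverse (1 + (f x / sqrt (g x))\<^sup>2) * ((f' * sqrt (g x) - f x * (g' * inverse (sqrt (g x)) / 2)) / (sqrt (g x) * sqrt (g x)))) (at x within U)"
    using pos by (auto intro!: derivative_eq_intros f g simp: field_simps)
  moreover have "inverse (1 + (f x / sqrt (g x))\<^sup>2) * ((f' * sqrt (g x) - f x * (g' * inverse (sqrt (g x)) / 2)) / (sqrt (g x) * sqrt (g x)))
     = (f' * g x - f x * g' / 2) / (sqrt (g x) * (g x + (f x)\<^sup>2))"
  proof -
    define s where "s = sqrt (g x)"
    have s: "s > 0" "g x = s\<^sup>2" using pos by (auto simp: s_def)
    have "s\<^sup>2 + (f x)\<^sup>2 > 0" using s by (intro add_pos_nonneg) auto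
    then have "inverse (1 + (f x / s)\<^sup>2) = s\<^sup>2 / (s\<^sup>2 + (f x)\<^sup>2)" using s(1)
      by (simp add: field_simps)
    then show ?thesis unfolding s_def[symmetric] s(2) using s(1)
      by (simp add: divide_simps) (simp add: power2_eq_square algebra_simps)
  qed
  ultimately show ?thesis by metis
qed

lemma J_deriv:
  assumes "w b \<noteq> 0"
  shows "((\<lambda>b. J b z) has_real_derivative J' b z) (at b within U)"
proof -
  have m: "0 < m b z" and k: "0 < k b z" using assms m_pos k_pos by auto
  define s where "s = sqrt (k b z)"
  have s: "s > 0" "k b z = s\<^sup>2" using k by (auto simp: s_def)
  define p where "p = 2 * h b * w b * (z\<^sup>2 - 1)"
  let ?A = "((w b * w b + (- h b) * h b) * d z * (m b z * s) - h b * w b * d z * (p * s + m b z * (p * inverse s / 2))) / ((m b z * s) * (m b z * s))"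
  have 1: "((\<lambda>b. h b * w b * d z / (m b z * sqrt (k b z))) has_real_derivative ?A) (at b within U)"
    using m k unfolding s_def p_def
    by (auto intro!: derivative_eq_intros h_deriv w_deriv m_deriv k_deriv simp: field_simps)
  have 2: "((\<lambda>b. arctan (\<rho> * l z / sqrt (k b z))) has_real_derivative
      (0 * k b z - \<rho> * l z * p / 2) / (sqrt (k b z) * (k b z + (\<rho> * l z)\<^sup>2))) (at b within U)"
    by (rule arctan_sqrt_deriv) (use k in \<open>auto simp: p_def intro: k_deriv\<close>)
  have dJ: "((\<lambda>b. J b z) has_real_derivative \<rho> * ?A * arctan (\<rho> * l z / sqrt (k b z)) + \<rho> * (h b * w b * d z / (m b z * sqrt (k b z))) * ((0 * k b z - \<rho> * l z * p / 2) / (sqrt (k b z) * (k b z + (\<rho> * l z)\<^sup>2)))) (at b within U)"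
    unfolding J_def using DERIV_mult[OF DERIV_cmult[OF 1, of \<rho>] 2] by (simp add: algebra_simps)
  have 3: "?A = ((w b)\<^sup>2 - (h b)\<^sup>2) * d z / (m b z * s) - h b * w b * d z * p * (1 / ((m b z)\<^sup>2 * s) + 1 / (2 * m b z * s\<^sup>2 * s))"
    using m s(1) by (simp add: divide_simps) (simp add: power2_eq_square algebra_simps)
  have 4: "\<rho> * (h b * w b * d z / (m b z * s)) * ((0 * s\<^sup>2 - \<rho> * l z * p / 2) / (s * (s\<^sup>2 + (\<rho> * l z)\<^sup>2)))
     = - \<rho>\<^sup>2 * (h b * w b)\<^sup>2 * d z * l z * (z\<^sup>2 - 1) / (m b z * s\<^sup>2 * (s\<^sup>2 + \<rho>\<^sup>2 * (l z)\<^sup>2))"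
  proof -
    have "s\<^sup>2 + \<rho>\<^sup>2 * (l z)\<^sup>2 > 0" using s by (intro add_pos_nonneg) auto
    then show ?thesis
    using m s(1) unfolding p_def power_mult_distrib by (simp add: divide_simps) (simp add: power2_eq_square algebra_simps)
  qed
  have r: "sqrt (s\<^sup>2) = s" using s by simp
  have "\<rho> * ?A * arctan (\<rho> * l z / s) + \<rho> * (h b * w b * d z / (m b z * s)) * ((0 * s\<^sup>2 - \<rho> * l z * p / 2) / (s * (s\<^sup>2 + (\<rho> * l z)\<^sup>2))) = J' b z"
    unfolding J'_def p_def[symmetric] s(2) r 3 4 by simp
  from dJ[unfolded s(2) r this] show ?thesis .
qed


text \<open>In the antiprism this is \<open>cos (pi / n)\<close>.\<close>

definition C where "C = 2 * c - 1"
text \<open>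
  \<open>E\<close> comes from the divergence theorem: the first summand is the flux through the slice at height
  \<open>z\<close> of the velocity of the deformation, and \<open>q0\<close>, \<open>q1\<close> are such that the second one is a primitive
  of the coefficient \<open>((h b)\<^sup>2 * c - (c - 1) * (w b)\<^sup>2 * z) / k powr (3 / 2)\<close> in the flux through the
  lateral face.  \<open>L\<close> is the squared norm of the point at height \<open>z\<close> of a lateral edge.
\<close>

definition k0 where "k0 b = (w b)\<^sup>2 + \<rho>\<^sup>2 * c\<^sup>2"
definition k1 where "k1 = \<rho>\<^sup>2 * c * (c - 1)"
definition k2 where "k2 b = (h b)\<^sup>2 + \<rho>\<^sup>2 * (c - 1)\<^sup>2"
text \<open>Minus a quarter of the discriminant of \<open>k b\<close> as a quadratic in
  \<open>z\<close>, and by \<open>denominator_eq\<close> an eighth of the first factor in the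
  denominator of the theorem.\<close>

definition D where "D b = k0 b * k2 b - k1\<^sup>2"
definition q0 where "q0 b = (c - 1) * ((w b)\<^sup>2 * k0 b + \<rho>\<^sup>2 * c\<^sup>2 * (h b)\<^sup>2)"
definition q1 where "q1 b = c * ((h b)\<^sup>2 * k2 b + \<rho>\<^sup>2 * (c - 1)\<^sup>2 * (w b)\<^sup>2)"
definition E where "E b z = (z * \<sigma>\<^sup>2 * d z / m b z + (q0 b + q1 b * z) / D b) / sqrt (k b z)"
text \<open>Inner products of unit vertices joined by a lateral edge and by a base edge, with
  \<open>w\<close> eliminated. That \<open>base_cos\<close> is free of \<open>b\<close> means that
  the deformation preserves \<open>a\<close>.\<close>

definition lat_cos where "lat_cos b = 1 - \<rho>\<^sup>2 * (1 - C) - 2 * (h b)\<^sup>2"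
definition base_cos where "base_cos = 1 - 2 * \<rho>\<^sup>2 * S\<^sup>2"
definition L where "L b z = k b z + \<rho>\<^sup>2 * (l z)\<^sup>2"

section \<open>Polynomial identities behind the exact primitive\<close>

lemma h_w_sq: "(h b)\<^sup>2 + (w b)\<^sup>2 = \<sigma>\<^sup>2"
  unfolding h_def w_def power_mult_distrib by (simp flip: distrib_left)

lemma w_sq: "(w b)\<^sup>2 = 1 - \<rho>\<^sup>2 - (h b)\<^sup>2" using h_w_sq[of b] unit by simp

lemma k_quad: "k b z = k0 b + 2 * k1 * z + k2 b * z\<^sup>2"
  unfolding k_def m_def d_def k0_def k1_def k2_def by algebra

lemma D_pos: assumes "w b \<noteq> 0" shows "0 < D b"
proof -
  have "D b = (w b)\<^sup>2 * (h b)\<^sup>2 + (w b)\<^sup>2 * (\<rho>\<^sup>2 * (c - 1)\<^sup>2) + (h b)\<^sup>2 * (\<rho>\<^sup>2 * c\<^sup>2)"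
    unfolding D_def k0_def k1_def k2_def by algebra
  moreover have "(w b)\<^sup>2 * (\<rho>\<^sup>2 * (c - 1)\<^sup>2) > 0" using assms c_less_1 rho_pos by simp
  ultimately show ?thesis by (smt (verit) zero_le_power2 mult_nonneg_nonneg)
qed

text \<open>This and the next two identities translate the shape into edge lengths.
  \<open>E_numerator\<close> is the value of \<open>E\<close> at \<open>z = 1\<close> and yields
  \<open>G\<close>; \<open>kappa_eq\<close> is the coefficient of \<open>1 / L\<close> and yields
  \<open>H\<close>. All three are polynomial identities once squares of \<open>S\<close> and
  \<open>w\<close> are eliminated.\<close>

lemma denominator_eq: "1 + base_cos - 2 * (lat_cos b)\<^sup>2 = 8 * D b"
  unfolding base_cos_def lat_cos_def D_def k0_def k1_def k2_def S_eq C_def w_sq by algebra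

lemma E_numerator: "C * D b + q0 b + q1 b = - (lat_cos b - C) * (1 + base_cos) / 4"
proof -
  have "4 * (C * D b + q0 b + q1 b) = - (lat_cos b - C) * (1 + base_cos)"
    unfolding base_cos_def lat_cos_def D_def q0_def q1_def k0_def k1_def k2_def S_eq C_def w_sq by algebra
  then show ?thesis by simp
qed

lemma kappa_eq: "8 * (q1 b - q0 b) = 1 + base_cos + 2 * (lat_cos b)\<^sup>2 - 4 * lat_cos b * C"
  unfolding base_cos_def lat_cos_def q0_def q1_def k0_def k1_def k2_def S_eq C_def w_sq by algebra

text \<open>Since \<open>k1 + k2 b * z\<close> is half the derivative of \<open>k b\<close>, the
  left side is the numerator in the derivative of \<open>(q0 b + q1 b * z) / sqrt (k b z)\<close>.
  Its quadratic terms cancel; the remaining two coefficients give a linear system for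
  \<open>q0\<close> and \<open>q1\<close> with determinant \<open>D b\<close> up to sign.\<close>

lemma q_identity: "q1 b * k b z - (q0 b + q1 b * z) * (k1 + k2 b * z) = D b * ((h b)\<^sup>2 * c - (c - 1) * (w b)\<^sup>2 * z)"
proof -
  have 1: "q1 b * k0 b - q0 b * k1 = D b * ((h b)\<^sup>2 * c)"
    unfolding D_def q0_def q1_def k0_def k1_def k2_def by algebra
  have 2: "q1 b * k1 - q0 b * k2 b = - (D b * ((c - 1) * (w b)\<^sup>2))"
    unfolding D_def q0_def q1_def k0_def k1_def k2_def by algebra
  show ?thesis using 1 2 unfolding k_quad by algebra
qed

text \<open>Up to a constant, \<open>j\<close> is the numerator in the \<open>z\<close>-derivative
  of the arctan. The right side has the factor \<open>k b z\<close>, which cancels against the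
  denominator, so that only \<open>L\<close> and an odd term survive in
  \<open>primitive_deriv\<close>.\<close>

lemma rem_identity:
  fixes b z
  defines "j \<equiv> k b z - (1 + z) * (k1 + k2 b * z)"
  shows "D b * ((1 + z) * d z * (h b)\<^sup>2 * (w b)\<^sup>2 * (z\<^sup>2 - 1) + z * \<sigma>\<^sup>2 * (d z * j - k b z)) + (q0 b + q1 b * z) * j * m b z
    = (q0 b - q1 b) * k b z * m b z"
proof -
  have 1: "(q0 b + q1 b * z) * j = k b z * (q0 b - q1 b) + (1 + z) * (D b * ((h b)\<^sup>2 * c - (c - 1) * (w b)\<^sup>2 * z))"
    using q_identity[of b z] unfolding j_def by algebra
  have 2: "(1 + z) * d z * (h b)\<^sup>2 * (w b)\<^sup>2 * (z\<^sup>2 - 1) + z * \<sigma>\<^sup>2 * (d z * j - k b z)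
      + (1 + z) * ((h b)\<^sup>2 * c - (c - 1) * (w b)\<^sup>2 * z) * m b z = 0"
  proof -
    have "d z * j - k b z = (1 + z) * ((c - 1) * k b z - d z * (k1 + k2 b * z))"
      unfolding j_def d_def by algebra
    also have "(c - 1) * k b z - d z * (k1 + k2 b * z) = (c - 1) * m b z - d z * (h b)\<^sup>2 * z"
      unfolding k1_def k2_def k_def d_def by algebra
    finally have "d z * j - k b z = (1 + z) * ((c - 1) * m b z - d z * (h b)\<^sup>2 * z)" .
    then show ?thesis unfolding h_w_sq[symmetric, of b] m_def d_def by algebra
  qed
  from 1 2 show ?thesis by algebra
qed

text \<open>This is the formula of \<open>E_deriv\<close> multiplied by \<open>m\<close> squared and
  \<open>k powr (3 / 2)\<close>, the contribution of \<open>q0\<close> and \<open>q1\<close> being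
  already replaced by means of \<open>q_identity\<close>.\<close>

lemma main_identity:
  "((w b)\<^sup>2 - (h b)\<^sup>2) * d z * m b z * k b z - (h b)\<^sup>2 * (w b)\<^sup>2 * d z * (z\<^sup>2 - 1) * (2 * k b z + m b z)
   = \<sigma>\<^sup>2 * (((d z + z * (c - 1)) * m b z - 2 * z\<^sup>2 * d z * (h b)\<^sup>2) * k b z - z * d z * m b z * (k1 + k2 b * z))
     + ((h b)\<^sup>2 * c - (c - 1) * (w b)\<^sup>2 * z) * (m b z)\<^sup>2"
proof -
  have kk: "k1 + k2 b * z = (h b)\<^sup>2 * z + \<rho>\<^sup>2 * d z * (c - 1)" unfolding k1_def k2_def d_def by algebra
  show ?thesis unfolding kk unfolding h_w_sq[symmetric, of b] k_def m_def d_def by algebra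
qed

text \<open>Both ends of a lateral edge are unit vectors, so the squared norm along it is even about
  the midpoint \<open>z = 0\<close>. Evenness later kills the odd term.\<close>

lemma L_quad: "L b z = ((w b)\<^sup>2 + \<rho>\<^sup>2 * c) + ((h b)\<^sup>2 + \<rho>\<^sup>2 * (1 - c)) * z\<^sup>2"
proof -
  have "(l z)\<^sup>2 = c * (1 - c) * (1 + z)\<^sup>2" unfolding l_def power_divide power_mult_distrib S_eq by (simp add: field_simps)
  then show ?thesis
  unfolding L_def k_def m_def d_def by algebra
qed


lemma E_deriv:
  assumes "w b \<noteq> 0"
  shows "(E b has_real_derivative (((w b)\<^sup>2 - (h b)\<^sup>2) * d z / (m b z * sqrt (k b z))
      - h b * w b * d z * (2 * h b * w b * (z\<^sup>2 - 1)) * (1 / ((m b z)\<^sup>2 * sqrt (k b z)) + 1 / (2 * m b z * k b z * sqrt (k b z))))) (at z within U)"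
proof -
  have m: "0 < m b z" and k: "0 < k b z" and D: "0 < D b" using assms m_pos k_pos D_pos by auto
  define s where "s = sqrt (k b z)"
  have s: "s > 0" "k b z = s\<^sup>2" using k by (auto simp: s_def)
  define e where "e z = z * \<sigma>\<^sup>2 * d z / m b z + (q0 b + q1 b * z) / D b" for z
  define kz where "kz = k1 + k2 b * z"
  define e' where "e' = \<sigma>\<^sup>2 * ((d z + z * (c - 1)) * m b z - 2 * z\<^sup>2 * d z * (h b)\<^sup>2) / (m b z)\<^sup>2 + q1 b / D b"
  have dm: "(m b has_real_derivative 2 * (h b)\<^sup>2 * z) (at z within U)" for U
    unfolding m_def by (auto intro!: derivative_eq_intros)
  have dd: "(d has_real_derivative c - 1) (at z within U)" for U
    unfolding d_def by (auto intro!: derivative_eq_intros)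
  have dk: "(k b has_real_derivative 2 * kz) (at z within U)" for U
    unfolding k_quad kz_def by (auto intro!: derivative_eq_intros simp: algebra_simps)
  have "((\<lambda>z. z * \<sigma>\<^sup>2 * d z / m b z) has_real_derivative
      \<sigma>\<^sup>2 * ((d z + z * (c - 1)) * m b z - 2 * z\<^sup>2 * d z * (h b)\<^sup>2) / (m b z)\<^sup>2) (at z within U)"
    using m by (auto intro!: derivative_eq_intros dm dd simp: power2_eq_square algebra_simps)
  moreover have "((\<lambda>z. (q0 b + q1 b * z) / D b) has_real_derivative q1 b / D b) (at z within U)"
    using D by (auto intro!: derivative_eq_intros)
  ultimately have de: "(e has_real_derivative e') (at z within U)"
    unfolding e_def e'_def by (rule DERIV_add)
  have dE: "(E b has_real_derivative (e' * s - e z * (2 * kz * inverse s / 2)) / (s * s)) (at z within U)"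
    unfolding E_def e_def[symmetric] using s k unfolding s_def
    by (auto intro!: derivative_eq_intros de dk simp: field_simps)
  have 1: "(e' * s - e z * (2 * kz * inverse s / 2)) / (s * s) = (e' * s\<^sup>2 - e z * kz) / (s\<^sup>2 * s)"
    using s(1) by (simp add: divide_simps) (simp add: power2_eq_square algebra_simps)
  have "(e' * s\<^sup>2 - e z * kz) * (m b z)\<^sup>2
    = \<sigma>\<^sup>2 * (((d z + z * (c - 1)) * m b z - 2 * z\<^sup>2 * d z * (h b)\<^sup>2) * s\<^sup>2 - z * d z * m b z * kz)
      + (q1 b * s\<^sup>2 - (q0 b + q1 b * z) * kz) / D b * (m b z)\<^sup>2"
    unfolding e'_def e_def using m D by (simp add: divide_simps) (simp add: power2_eq_square algebra_simps)
  also have "(q1 b * s\<^sup>2 - (q0 b + q1 b * z) * kz) / D b = (h b)\<^sup>2 * c - (c - 1) * (w b)\<^sup>2 * z"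
    using q_identity[of b z] D unfolding s(2) kz_def by simp
  finally have 2: "(e' * s\<^sup>2 - e z * kz) * (m b z)\<^sup>2 =
      ((w b)\<^sup>2 - (h b)\<^sup>2) * d z * m b z * s\<^sup>2 - (h b)\<^sup>2 * (w b)\<^sup>2 * d z * (z\<^sup>2 - 1) * (2 * s\<^sup>2 + m b z)"
    using main_identity[of b z] unfolding s(2) kz_def by simp
  have "(e' * s\<^sup>2 - e z * kz) / (s\<^sup>2 * s) = (((w b)\<^sup>2 - (h b)\<^sup>2) * d z * m b z * s\<^sup>2 - (h b)\<^sup>2 * (w b)\<^sup>2 * d z * (z\<^sup>2 - 1) * (2 * s\<^sup>2 + m b z)) / ((m b z)\<^sup>2 * (s\<^sup>2 * s))"
    unfolding 2[symmetric] using m by simp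
  also have "\<dots> = ((w b)\<^sup>2 - (h b)\<^sup>2) * d z / (m b z * s)
      - h b * w b * d z * (2 * h b * w b * (z\<^sup>2 - 1)) * (1 / ((m b z)\<^sup>2 * s) + 1 / (2 * m b z * s\<^sup>2 * s))"
    using m s(1) by (simp add: divide_simps) (simp add: power2_eq_square algebra_simps)
  finally show ?thesis by (intro DERIV_cong[OF dE]) (simp only: 1 s_def[symmetric] flip: s(2))
qed

text \<open>In the product rule, the derivative of \<open>E\<close> times the arctan is the arctan
  part of \<open>J'\<close>. The other summand is rational and is compared with the rational part of
  \<open>J'\<close>.\<close>

lemma primitive_deriv:
  assumes "w b \<noteq> 0"
  shows "((\<lambda>z. \<rho> * E b z * arctan (\<rho> * l z / sqrt (k b z))) has_real_derivative
    J' b z - \<rho>\<^sup>2 * S / 2 * ((q1 b - q0 b) / D b - z * \<sigma>\<^sup>2 / m b z) / L b z) (at z within U)"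
proof -
  have m: "0 < m b z" and k: "0 < k b z" and D: "0 < D b" using assms m_pos k_pos D_pos by auto
  define s where "s = sqrt (k b z)"
  have s: "s > 0" "k b z = s\<^sup>2" using k by (auto simp: s_def)
  have r: "sqrt (s\<^sup>2) = s" using s by simp
  define kz where "kz = k1 + k2 b * z"
  define j where "j = s\<^sup>2 - (1 + z) * kz"
  define e where "e = z * \<sigma>\<^sup>2 * d z / m b z + (q0 b + q1 b * z) / D b"
  have L: "L b z = s\<^sup>2 + \<rho>\<^sup>2 * (l z)\<^sup>2" "L b z > 0" unfolding L_def using s(2) k by (auto intro: add_pos_nonneg)
  have dk: "(k b has_real_derivative 2 * kz) (at z within U)"
    unfolding k_quad kz_def by (auto intro!: derivative_eq_intros simp: algebra_simps)
  have dl: "((\<lambda>z. \<rho> * l z) has_real_derivative \<rho> * S / 2) (at z within U)"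
    unfolding l_def by (auto intro!: derivative_eq_intros)
  note da = arctan_sqrt_deriv[OF dl dk k]
  have ez: "E b z = e / s" unfolding E_def e_def s_def ..
  let ?EZ = "((w b)\<^sup>2 - (h b)\<^sup>2) * d z / (m b z * sqrt (k b z))
      - h b * w b * d z * (2 * h b * w b * (z\<^sup>2 - 1)) * (1 / ((m b z)\<^sup>2 * sqrt (k b z)) + 1 / (2 * m b z * k b z * sqrt (k b z)))"
  have dP: "((\<lambda>z. \<rho> * E b z * arctan (\<rho> * l z / sqrt (k b z))) has_real_derivative
     \<rho> * ?EZ * arctan (\<rho> * l z / sqrt (k b z)) + (\<rho> * S / 2 * k b z - \<rho> * l z * (2 * kz) / 2) / (sqrt (k b z) * (k b z + (\<rho> * l z)\<^sup>2)) * (\<rho> * E b z)) (at z within U)"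
    by (intro DERIV_mult DERIV_cmult E_deriv da assms)
  have rem: "(\<rho> * S / 2 * k b z - \<rho> * l z * (2 * kz) / 2) / (sqrt (k b z) * (k b z + (\<rho> * l z)\<^sup>2)) * (\<rho> * E b z)
     = - \<rho>\<^sup>2 * (h b * w b)\<^sup>2 * d z * l z * (z\<^sup>2 - 1) / (m b z * k b z * (k b z + \<rho>\<^sup>2 * (l z)\<^sup>2))
      - \<rho>\<^sup>2 * S / 2 * ((q1 b - q0 b) / D b - z * \<sigma>\<^sup>2 / m b z) / L b z"
  proof -
    have "D b * ((1 + z) * d z * (h b)\<^sup>2 * (w b)\<^sup>2 * (z\<^sup>2 - 1) + z * \<sigma>\<^sup>2 * (d z * j - s\<^sup>2)) + (q0 b + q1 b * z) * j * m b z
      = (q0 b - q1 b) * s\<^sup>2 * m b z"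
      using rem_identity[of b z] unfolding j_def kz_def s(2) .
    \<comment> \<open>The first term is the rational part of \<open>J'\<close>; the second carries
      the factor \<open>s\<^sup>2\<close>, which cancels the one in the denominator and leaves
      \<open>L\<close> alone.\<close>
    then have e_j: "e * j = - (1 + z) * d z * (h b)\<^sup>2 * (w b)\<^sup>2 * (z\<^sup>2 - 1) / m b z + s\<^sup>2 * ((q0 b - q1 b) / D b + z * \<sigma>\<^sup>2 / m b z)"
      unfolding e_def using m D by (simp add: divide_simps) algebra
    then have ej: "\<rho>\<^sup>2 * S / 2 * (e * j) / (s\<^sup>2 * L b z) = - (\<rho>\<^sup>2 * S / 2) * (1 + z) * d z * (h b)\<^sup>2 * (w b)\<^sup>2 * (z\<^sup>2 - 1) / (m b z * s\<^sup>2 * L b z)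
       - \<rho>\<^sup>2 * S / 2 * ((q1 b - q0 b) / D b - z * \<sigma>\<^sup>2 / m b z) / L b z"
      unfolding e_j using m D s(1) L(2) by (simp add: divide_simps) (simp add: power2_eq_square algebra_simps)
    have "(\<rho> * S / 2 * s\<^sup>2 - \<rho> * l z * (2 * kz) / 2) / (s * L b z) * (\<rho> * (e / s)) = \<rho>\<^sup>2 * S / 2 * (e * j) / (s\<^sup>2 * L b z)"
      unfolding j_def l_def using s(1) L(2) by (simp add: divide_simps) (simp add: power2_eq_square algebra_simps)
    then have "(\<rho> * S / 2 * k b z - \<rho> * l z * (2 * kz) / 2) / (sqrt (k b z) * (k b z + (\<rho> * l z)\<^sup>2)) * (\<rho> * E b z)
       = \<rho>\<^sup>2 * S / 2 * (e * j) / (s\<^sup>2 * L b z)"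
      unfolding ez s(2) r L(1) power_mult_distrib .
    also note ej
    also have "- (\<rho>\<^sup>2 * S / 2) * (1 + z) * d z * (h b)\<^sup>2 * (w b)\<^sup>2 * (z\<^sup>2 - 1) / (m b z * s\<^sup>2 * L b z)
      = - \<rho>\<^sup>2 * (h b * w b)\<^sup>2 * d z * l z * (z\<^sup>2 - 1) / (m b z * k b z * (k b z + \<rho>\<^sup>2 * (l z)\<^sup>2))"
      unfolding l_def[of z, symmetric] L_def s(2)[symmetric] unfolding l_def by (simp add: power_mult_distrib)
    finally show ?thesis .
  qed
  show ?thesis
    by (rule DERIV_cong[OF dP], unfold rem J'_def) linarith
qed


section \<open>Edge lengths and the integral of the derivative over the height\<close>

definition base_angle where "base_angle = arccos base_cos"
definition lat_angle where "lat_angle b = arccos (lat_cos b)"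

lemma base_cos_bounds: "-1 < base_cos" "base_cos < 1"
proof -
  have S1: "S\<^sup>2 \<le> 1" unfolding S_eq using zero_le_power2[of "2 * c - 1"] by (simp add: power2_eq_square algebra_simps)
  have "\<rho>\<^sup>2 < 1" using unit sigma_pos by (smt (verit) zero_less_power)
  then have "\<rho>\<^sup>2 * S\<^sup>2 < 1" using S1 by (smt (verit) mult_left_le zero_le_power2)
  then show "-1 < base_cos" unfolding base_cos_def by simp
  show "base_cos < 1" unfolding base_cos_def using rho_pos S_pos by simp
qed

text \<open>At \<open>z = 1\<close> the foot of the altitude is the midpoint of a base edge, whose
  norm is \<open>cos (a / 2)\<close> for every shape.\<close>

lemma k_1: "k b 1 = (1 + base_cos) / 2"
proof -
  have "k b 1 = \<sigma>\<^sup>2 + \<rho>\<^sup>2 * C\<^sup>2" unfolding k_def m_def d_def C_def h_w_sq[symmetric, of b] by simp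
  also have "\<dots> = (1 + base_cos) / 2" unfolding base_cos_def S_eq C_def using unit by (simp add: field_simps) algebra
  finally show ?thesis .
qed

text \<open>The midpoint of a base edge and half of that edge span a right triangle with hypotenuse
  1 and legs \<open>cos (a / 2)\<close> and \<open>sin (a / 2)\<close>. Through its angle at the
  origin the factor \<open>a\<close> enters the formula.\<close>

lemma base_angle_half: "arctan (\<rho> * l 1 / sqrt (k b 1)) = base_angle / 2"
  "sqrt (k b 1) = cos (base_angle / 2)" "\<rho> * S = sin (base_angle / 2)" "0 < base_angle" "base_angle < pi" "cos base_angle = base_cos"
proof -
  show b: "0 < base_angle" "base_angle < pi" unfolding base_angle_def using base_cos_bounds arccos_lt_bounded by auto
  show base_cos: "cos base_angle = base_cos" unfolding base_angle_def using base_cos_bounds by simp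
  have cp: "cos (base_angle / 2) > 0" using b by (intro cos_gt_zero) auto
  have "(cos (base_angle / 2))\<^sup>2 = (1 + base_cos) / 2" using cos_double_cos[of "base_angle / 2"] base_cos by simp
  then show c1: "sqrt (k b 1) = cos (base_angle / 2)" unfolding k_1 using cp by (intro real_sqrt_unique) auto
  have sp: "sin (base_angle / 2) > 0" using b by (intro sin_gt_zero) auto
  have "(sin (base_angle / 2))\<^sup>2 = (\<rho> * S)\<^sup>2" using cos_double_sin[of "base_angle / 2"] base_cos unfolding base_cos_def by (simp add: power_mult_distrib)
  then show s1: "\<rho> * S = sin (base_angle / 2)" using sp rho_pos S_pos by (metis less_imp_le mult_pos_pos power2_eq_iff_nonneg)
  have "\<rho> * l 1 / sqrt (k b 1) = tan (base_angle / 2)" unfolding c1 l_def tan_def using s1 by simp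
  then show "arctan (\<rho> * l 1 / sqrt (k b 1)) = base_angle / 2" using b by (simp add: arctan_tan)
qed

lemma lat_cos_half: "(1 + lat_cos b) / 2 = (w b)\<^sup>2 + \<rho>\<^sup>2 * c" "(1 - lat_cos b) / 2 = (h b)\<^sup>2 + \<rho>\<^sup>2 * (1 - c)"
  unfolding lat_cos_def C_def w_sq by (auto simp: field_simps)

lemma lat_cos_bounds: assumes "w b \<noteq> 0" shows "-1 < lat_cos b" "lat_cos b < 1"
proof -
  have "0 < (w b)\<^sup>2" using assms by simp
  moreover have "0 < \<rho>\<^sup>2 * c" "0 < \<rho>\<^sup>2 * (1 - c)" using rho_pos c_ge c_less_1 by auto
  ultimately have "0 < (1 + lat_cos b) / 2" "0 < (1 - lat_cos b) / 2"
    unfolding lat_cos_half using zero_le_power2[of "h b"] by linarith+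
  then show "-1 < lat_cos b" "lat_cos b < 1" by auto
qed

text \<open>By \<open>L_quad\<close> and \<open>lat_cos_half\<close>, the coefficients of
  \<open>L\<close> are the squared cosine and sine of half the edge, so the primitive is an arctan
  whose boundary values are half the lateral edge. Here the factor \<open>t\<close> enters.\<close>

lemma L_integral:
  assumes "w b \<noteq> 0"
  shows "((\<lambda>z. 1 / L b z) has_integral 2 * lat_angle b / sin (lat_angle b)) {-1..1}"
proof -
  define t where "t = lat_angle b"
  have t: "0 < t" "t < pi" "cos t = lat_cos b" unfolding t_def lat_angle_def using lat_cos_bounds[OF assms] arccos_lt_bounded by auto
  have cp: "cos (t / 2) > 0" using t by (intro cos_gt_zero) auto
  have sp: "sin (t / 2) > 0" using t by (intro sin_gt_zero) auto
  have L: "L b z = (cos (t / 2))\<^sup>2 + (sin (t / 2))\<^sup>2 * z\<^sup>2" for z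
    unfolding L_quad lat_cos_half[symmetric] t(3)[symmetric] using cos_double_cos[of "t / 2"] cos_double_sin[of "t / 2"] by simp
  define F where "F z = arctan (sin (t / 2) * z / cos (t / 2)) / (sin (t / 2) * cos (t / 2))" for z
  have "(F has_real_derivative 1 / L b z) (at z within {-1..1})" for z
  proof -
    have "((cos (t / 2))\<^sup>2 + (sin (t / 2))\<^sup>2 * z\<^sup>2) > 0" using cp by (intro add_pos_nonneg) auto
    then have "inverse (1 + (sin (t / 2) * z / cos (t / 2))\<^sup>2) = (cos (t / 2))\<^sup>2 / L b z"
      unfolding L using cp by (simp add: field_simps)
    moreover have "(F has_real_derivative inverse (1 + (sin (t / 2) * z / cos (t / 2))\<^sup>2) * (sin (t / 2) / cos (t / 2)) / (sin (t / 2) * cos (t / 2))) (at z within {-1..1})"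
      unfolding F_def using cp sp by (auto intro!: derivative_eq_intros)
    ultimately show ?thesis using cp sp by (simp add: power2_eq_square)
  qed
  then have "((\<lambda>z. 1 / L b z) has_integral F 1 - F (-1)) {-1..1}"
    by (intro fundamental_theorem_of_calculus) (auto simp: has_real_derivative_iff_has_vector_derivative)
  moreover have "F 1 - F (-1) = 2 * t / sin t"
  proof -
    have "arctan (sin (t / 2) / cos (t / 2)) = t / 2" using arctan_tan[of "t / 2"] t unfolding tan_def by simp
    then have "F 1 - F (-1) = t / (sin (t / 2) * cos (t / 2))" unfolding F_def by (simp add: arctan_minus field_simps)
    also have "\<dots> = 2 * t / sin t" using sin_double[of "t / 2"] by simp
    finally show ?thesis .
  qed
  ultimately show ?thesis by (simp add: t_def)
qed

lemma odd_integral: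
  assumes "w b \<noteq> 0"
  shows "((\<lambda>z. z * \<sigma>\<^sup>2 / m b z / L b z) has_integral 0) {-1..1}"
proof -
  let ?f = "\<lambda>z. z * \<sigma>\<^sup>2 / m b z / L b z"
  have Lp: "L b z > 0" for z unfolding L_def using k_pos[OF assms, of z] by (intro add_pos_nonneg) auto
  have "continuous_on {-1..1} ?f"
    using Lp m_pos[OF assms] unfolding L_quad m_def
    by (intro continuous_intros) (auto simp: less_imp_neq[THEN not_sym])
  then obtain I where I: "(?f has_integral I) {-1..1}" using integrable_continuous_interval by blast
  have "((\<lambda>z. ?f (- z)) has_integral I) {-1..1}"
    using I has_integral_reflect_real[of ?f I 1 "-1"] by simp
  moreover have "(\<lambda>z. ?f (- z)) = (\<lambda>z. - ?f z)" unfolding m_def L_quad by simp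
  ultimately have "((\<lambda>z. - ?f z) has_integral I) {-1..1}" by simp
  then have "I = - I" using has_integral_neg[OF I] has_integral_unique by blast
  then show ?thesis using I by simp
qed

lemma J'_integral:
  assumes "w b \<noteq> 0"
  shows "(J' b has_integral
    ((base_angle * (- 2 * (lat_cos b - C) * sin base_angle * sin (lat_angle b)) + lat_angle b * ((1 - base_cos) * (1 + base_cos + 2 * (lat_cos b)\<^sup>2 - 4 * lat_cos b * C)))
      / (2 * (1 + base_cos - 2 * (lat_cos b)\<^sup>2) * S * sin (lat_angle b)))) {-1..1}"
proof -
  define P where "P z = \<rho> * E b z * arctan (\<rho> * l z / sqrt (k b z))" for z
  define K where "K = \<rho>\<^sup>2 * S / 2"
  have "((\<lambda>z. J' b z - K * ((q1 b - q0 b) / D b - z * \<sigma>\<^sup>2 / m b z) / L b z) has_integral P 1 - P (-1)) {-1..1}"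
    unfolding P_def K_def
    by (intro fundamental_theorem_of_calculus primitive_deriv[OF assms, unfolded has_real_derivative_iff_has_vector_derivative]) simp
  \<comment> \<open>The terms subtracted in \<open>primitive_deriv\<close> are added back: a
    multiple of the integral of \<open>1 / L\<close>, and the odd term, which contributes
    zero.\<close>
  from has_integral_add[OF this has_integral_diff[OF has_integral_mult_right[OF L_integral[OF assms], of "K * ((q1 b - q0 b) / D b)"]
     has_integral_mult_right[OF odd_integral[OF assms], of K]]]
  have *: "(J' b has_integral P 1 - P (-1) + K * ((q1 b - q0 b) / D b) * (2 * lat_angle b / sin (lat_angle b))) {-1..1}"
    by (rule has_integral_eq_rhs[OF has_integral_cong[THEN iffD1, rotated]])
      (auto simp: field_simps diff_divide_distrib add_divide_distrib)
  have t: "0 < lat_angle b" "lat_angle b < pi" "cos (lat_angle b) = lat_cos b" unfolding lat_angle_def using lat_cos_bounds[OF assms] arccos_lt_bounded by auto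
  have st: "0 < sin (lat_angle b)" using t by (intro sin_gt_zero) auto
  have D: "D b > 0" using D_pos assms by blast
  \<comment> \<open>At height -1 the triangle degenerates to a segment ending in the vertex, so
    \<open>l\<close> vanishes and only the boundary value at the base edge remains.\<close>
  have "P (-1) = 0" unfolding P_def l_def by simp
  have "E b 1 = (C + (q0 b + q1 b) / D b) / cos (base_angle / 2)"
  proof -
    have "m b 1 = \<sigma>\<^sup>2" unfolding m_def using h_w_sq by simp
    then show ?thesis unfolding E_def base_angle_half d_def C_def using sigma_pos by simp
  qed
  also have "C + (q0 b + q1 b) / D b = (C * D b + q0 b + q1 b) / D b" using D by (simp add: field_simps)
  also have "\<dots> = - (lat_cos b - C) * (cos (base_angle / 2))\<^sup>2 / (2 * D b)"
    unfolding E_numerator using cos_double_cos[of "base_angle / 2"] base_angle_half(6) by simp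
  finally have E1: "E b 1 = - (lat_cos b - C) * cos (base_angle / 2) / (2 * D b)"
    using base_cos_bounds k_1[of b] base_angle_half(2)[of b] by (simp add: power2_eq_square)
  \<comment> \<open>The double-angle formula turns the factor
    \<open>\<rho> * cos (base_angle / 2)\<close> of \<open>P 1\<close> into
    \<open>sin base_angle / (2 * S)\<close>, as required by \<open>G\<close>.\<close>
  have sa: "sin base_angle = 2 * (\<rho> * S) * cos (base_angle / 2)"
    unfolding base_angle_half(3) using sin_double[of "base_angle / 2"] by simp
  have P1: "P 1 = - (lat_cos b - C) * sin base_angle / (4 * S * D b) * (base_angle / 2)"
    unfolding P_def base_angle_half(1) E1 sa using S_pos D by (simp add: field_simps)
  have K: "K = (1 - base_cos) / (4 * S)" unfolding K_def base_cos_def using S_pos by (simp add: field_simps power2_eq_square)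
  have "P 1 - P (-1) + K * ((q1 b - q0 b) / D b) * (2 * lat_angle b / sin (lat_angle b)) =
    ((base_angle * (- 2 * (lat_cos b - C) * sin base_angle * sin (lat_angle b)) + lat_angle b * ((1 - base_cos) * (8 * (q1 b - q0 b))))
      / (2 * (8 * D b) * S * sin (lat_angle b)))"
    unfolding P1 \<open>P (-1) = 0\<close> K using D S_pos st by (simp add: field_simps)
  then show ?thesis using * unfolding denominator_eq kappa_eq by simp
qed


section \<open>Substitution of the lateral edge for the shape\<close>

definition V where "V b = integral {-1..1} (J b)"

text \<open>With \<open>base_angle\<close> in the role of \<open>a\<close>, this and
  \<open>radicand\<close> are the numerator and the function \<open>R\<close> of the
  theorem.\<close>

definition integrand_num :: "real \<Rightarrow> real" where
  "integrand_num t = base_angle * (- 2 * (cos t - C) * sin base_angle * sin t)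
     + t * ((1 - base_cos) * (1 + base_cos + 2 * (cos t)\<^sup>2 - 4 * cos t * C))"

definition radicand :: "real \<Rightarrow> real" where
  "radicand t = (1 + base_cos)\<^sup>2 - 4 * ((cos t)\<^sup>2 + (sin t)\<^sup>2 * C\<^sup>2 - (1 - base_cos) * cos t * C)"

definition integrand where "integrand t = integrand_num t / ((1 + base_cos - 2 * (cos t)\<^sup>2) * sqrt (radicand t))"

text \<open>\<open>B\<close> is the shape of the given antiprism; as it stays below
  \<open>pi / 2\<close>, \<open>w\<close> is positive on the whole path from the flat shape.\<close>

context
  fixes B :: real
  assumes B: "0 < B" "B < pi / 2"
begin

lemma w_pos: "b \<in> {0..B} \<Longrightarrow> 0 < w b"
  unfolding w_def using B sigma_pos by (intro mult_pos_pos cos_gt_zero_pi) auto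

lemma h_nonneg: "b \<in> {0..B} \<Longrightarrow> 0 \<le> h b" "b \<in> {0<..B} \<Longrightarrow> 0 < h b"
  unfolding h_def using B sigma_pos by (auto intro!: mult_nonneg_nonneg mult_pos_pos sin_ge_zero sin_gt_zero)

lemma J'_continuous: "continuous_on ({0..B} \<times> cbox (-1) 1) (\<lambda>(b, z). J' b z)"
proof -
  have m: "m (fst p) (snd p) \<noteq> 0" "k (fst p) (snd p) \<noteq> 0" "0 < k (fst p) (snd p)" "k (fst p) (snd p) + \<rho>\<^sup>2 * (l (snd p))\<^sup>2 \<noteq> 0"
    if "p \<in> {0..B} \<times> cbox (-1) 1" for p
  proof -
    have "w (fst p) \<noteq> 0" using that w_pos[of "fst p"] by auto
    from m_pos[OF this, of "snd p"] k_pos[OF this, of "snd p"]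
    show "m (fst p) (snd p) \<noteq> 0" "k (fst p) (snd p) \<noteq> 0" "0 < k (fst p) (snd p)" by auto
    then have "k (fst p) (snd p) + \<rho>\<^sup>2 * (l (snd p))\<^sup>2 > 0" by (intro add_pos_nonneg) auto
    then show "k (fst p) (snd p) + \<rho>\<^sup>2 * (l (snd p))\<^sup>2 \<noteq> 0" by simp
  qed
  have ch: "continuous_on U (\<lambda>p. h (fst p))" "continuous_on U (\<lambda>p. w (fst p))"
       "continuous_on U (\<lambda>p. d (snd p))" "continuous_on U (\<lambda>p. l (snd p))" for U :: "(real \<times> real) set"
    unfolding h_def w_def d_def l_def by (intro continuous_intros; simp)+
  have cm: "continuous_on U (\<lambda>p. m (fst p) (snd p))" for U :: "(real \<times> real) set"
    unfolding m_def by (intro continuous_intros ch)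
  have ck: "continuous_on U (\<lambda>p. k (fst p) (snd p))" for U :: "(real \<times> real) set"
    unfolding k_def by (intro continuous_intros ch cm)
  show ?thesis unfolding split_beta J'_def
    by (intro continuous_intros ch cm ck ballI) (use m in auto)
qed

lemma J_continuous:
  assumes "b \<in> {0..B}"
  shows "continuous_on U (J b)"
proof -
  have "w b \<noteq> 0" using w_pos[OF assms] by simp
  from m_pos[OF this] k_pos[OF this]
  have m: "m b z \<noteq> 0" "k b z \<noteq> 0" for z by (metis less_irrefl)+
  have cm: "continuous_on U (m b)" unfolding m_def by (intro continuous_intros)
  have ck: "continuous_on U (k b)" unfolding k_def d_def by (intro continuous_intros cm)
  show ?thesis unfolding J_def d_def l_def by (intro continuous_intros cm ck) (use m in auto)
qed

lemma V_deriv: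
  assumes "b \<in> {0..B}"
  shows "(V has_real_derivative integral {-1..1} (J' b)) (at b within {0..B})"
proof -
  have "((\<lambda>b. integral (cbox (-1) 1) (J b)) has_real_derivative integral (cbox (-1) 1) (J' b)) (at b within {0..B})"
  proof (rule leibniz_rule_field_derivative[OF _ _ J'_continuous])
    show "((\<lambda>b. J b z) has_real_derivative J' b z) (at b within {0..B})" if "b \<in> {0..B}" for b z
      using w_pos[OF that] by (intro J_deriv) simp
    show "J b integrable_on cbox (-1) 1" if "b \<in> {0..B}" for b
      by (intro integrable_continuous J_continuous that)
  qed (use assms in auto)
  then show ?thesis unfolding V_def by simp
qed

lemma lat_angle_facts:
  assumes "b \<in> {0..B}"
  shows "0 < lat_angle b" "lat_angle b < pi" "cos (lat_angle b) = lat_cos b" "0 < sin (lat_angle b)"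
proof -
  have "w b \<noteq> 0" using w_pos[OF assms] by simp
  from lat_cos_bounds[OF this] show t: "0 < lat_angle b" "lat_angle b < pi" "cos (lat_angle b) = lat_cos b"
    unfolding lat_angle_def using arccos_lt_bounded by auto
  then show "0 < sin (lat_angle b)" by (intro sin_gt_zero) auto
qed

lemma lat_angle_deriv:
  assumes "b \<in> {0..B}"
  shows "(lat_angle has_real_derivative 4 * h b * w b / sin (lat_angle b)) (at b within U)"
proof -
  have "w b \<noteq> 0" using w_pos[OF assms] by simp
  note xb = lat_cos_bounds[OF this]
  have dx: "(lat_cos has_real_derivative - 4 * h b * w b) (at b within U)"
    unfolding lat_cos_def by (auto intro!: derivative_eq_intros h_deriv)
  have "(lat_angle has_real_derivative inverse (- sqrt (1 - (lat_cos b)\<^sup>2)) * (- 4 * h b * w b)) (at b within U)"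
    unfolding lat_angle_def by (rule DERIV_chain2[OF DERIV_arccos dx]) (use xb in auto)
  moreover have "sqrt (1 - (lat_cos b)\<^sup>2) = sin (lat_angle b)"
    unfolding lat_angle_def using sin_arccos[of "lat_cos b"] xb by simp
  ultimately show ?thesis by (simp add: field_simps)
qed

text \<open>On the path \<open>R\<close> is a perfect square that vanishes only with
  \<open>h\<close>, that is, at the flat shape. Its root contains the factor
  \<open>h b * w b\<close> of \<open>lat_angle_deriv\<close>, which is what makes the substitution
  regular.\<close>

lemma radicand_lat_angle: assumes "b \<in> {0..B}" shows "radicand (lat_angle b) = (4 * S * h b * w b)\<^sup>2"
proof -
  have s: "(sin (lat_angle b))\<^sup>2 = 1 - (lat_cos b)\<^sup>2" using lat_angle_facts(3)[OF assms] sin_squared_eq by metis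
  show ?thesis unfolding radicand_def s lat_angle_facts(3)[OF assms] power_mult_distrib S_eq base_cos_def lat_cos_def C_def w_sq
    by algebra
qed

lemma sqrt_radicand_lat_angle: assumes "b \<in> {0..B}" shows "sqrt (radicand (lat_angle b)) = 4 * S * h b * w b"
  unfolding radicand_lat_angle[OF assms] using S_pos h_nonneg(1)[OF assms] w_pos[OF assms] by simp

lemma J'_integral_eq:
  assumes "b \<in> {0..B}"
  shows "integral {-1..1} (J' b) = integrand_num (lat_angle b) / (2 * (1 + base_cos - 2 * (cos (lat_angle b))\<^sup>2) * S * sin (lat_angle b))"
proof -
  have "w b \<noteq> 0" using w_pos[OF assms] by simp
  from J'_integral[OF this] show ?thesis unfolding integrand_num_def lat_angle_facts(3)[OF assms] by (simp add: integral_unique)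
qed

lemma lat_angle_mono: assumes "b \<in> {0..B}" "b' \<in> {0..B}" "b < b'" shows "lat_angle b < lat_angle b'"
proof -
  have "sin b < sin b'" using assms B by (intro sin_monotone_2pi) auto
  moreover have "0 \<le> sin b" using assms B by (intro sin_ge_zero) auto
  ultimately have "(sin b)\<^sup>2 < (sin b')\<^sup>2" by (intro power_strict_mono) auto
  then have "lat_cos b' < lat_cos b" unfolding lat_cos_def h_def power_mult_distrib using sigma_pos by simp
  then show ?thesis using lat_cos_bounds[of b] lat_cos_bounds[of b'] w_pos assms unfolding lat_angle_def
    by (smt (verit) arccos_less_arccos)
qed

lemma lat_angle_continuous: "continuous_on {0..B} lat_angle"
  by (rule DERIV_continuous_on[OF lat_angle_deriv])

lemma lat_angle_surj: assumes "t \<in> {lat_angle 0..lat_angle B}" shows "\<exists>b\<in>{0..B}. lat_angle b = t"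
  using IVT'[of lat_angle 0 t B] assms B lat_angle_continuous by auto

lemma denominator_pos: assumes "t \<in> {lat_angle 0..lat_angle B}" shows "0 < 1 + base_cos - 2 * (cos t)\<^sup>2"
proof -
  obtain b where b: "b \<in> {0..B}" "lat_angle b = t" using lat_angle_surj[OF assms] by auto
  then show ?thesis using D_pos[of b] w_pos[of b] denominator_eq[of b] lat_angle_facts(3)[of b] by auto
qed

lemma radicand_pos: assumes "t \<in> {lat_angle 0<..lat_angle B}" shows "0 < radicand t"
proof -
  obtain b where b: "b \<in> {0..B}" "lat_angle b = t" using lat_angle_surj[of t] assms by auto
  then have "b \<noteq> 0" using assms by auto
  then show ?thesis using radicand_lat_angle[of b] b h_nonneg(2)[of b] w_pos[of b] S_pos by (auto intro!: zero_less_power)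
qed

text \<open>The radicand is zero at the lower limit, so continuity does not give integrability. It
  is obtained by comparison with a simpler function having the same singularity; the substitution
  then turns the integral into one of a continuous function of \<open>b\<close>.\<close>

lemma volume_integral:
  "set_integrable lborel (einterval (ereal (lat_angle 0)) (ereal (lat_angle B))) integrand"
  "(LBINT t=ereal (lat_angle 0)..ereal (lat_angle B). integrand t) = 2 * V B"
  "lat_angle 0 < lat_angle B"
proof -
  define g' where "g' b = 4 * h b * w b / sin (lat_angle b)" for b
  \<comment> \<open>The comparison function: its substituted form
    \<open>f0 (lat_angle b) * g' b\<close> is the constant \<open>1 / S\<close>, and being
    nonnegative it admits the substitution theorem that also delivers integrability.\<close>
  define f0 where "f0 t = sin t / sqrt (radicand t)" for t
  have B0: "0 \<in> {0..B}" "B \<in> {0..B}" using B by auto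
  show lt: "lat_angle 0 < lat_angle B" using lat_angle_mono[OF B0] B by auto
  have cs: "continuous_on {0..B} (\<lambda>b. sin (lat_angle b))" by (intro continuous_intros lat_angle_continuous)
  have ch: "continuous_on {0..B} h" "continuous_on {0..B} w" unfolding h_def w_def by (intro continuous_intros)+
  have cg: "continuous_on {0..B} g'" unfolding g'_def
    by (intro continuous_intros cs ch) (use lat_angle_facts(4) in force)
  have open_sub: "{0<..<B} \<subseteq> {0..B}" by auto
  have isg': "isCont g' b" if "ereal 0 < ereal b" "ereal b < ereal B" for b
    using that continuous_on_subset[OF cg open_sub] by (simp add: continuous_on_eq_continuous_at)
  have cRR: "isCont radicand t" for t unfolding radicand_def by (intro continuous_intros)
  have lat_angle_in: "lat_angle b \<in> {lat_angle 0<..lat_angle B}" if "0 < b" "b < B" for b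
    using lat_angle_mono[of 0 b] lat_angle_mono[of b B] that B by auto
  have isf0: "isCont f0 t" if "t \<in> {lat_angle 0<..lat_angle B}" for t
    unfolding f0_def using radicand_pos[OF that] by (intro continuous_intros cRR) auto
  have isff: "isCont integrand t" if "t \<in> {lat_angle 0<..lat_angle B}" for t
    unfolding integrand_def integrand_num_def using radicand_pos[OF that] denominator_pos[of t] that by (intro continuous_intros cRR) auto
  have "((\<lambda>b. lat_angle b) \<longlongrightarrow> lat_angle b) (at b within U)" if "b \<in> {0..B}" for b U
    using DERIV_continuous[OF lat_angle_deriv[OF that]] unfolding continuous_within .
  then have tend: "((ereal \<circ> lat_angle \<circ> real_of_ereal) \<longlongrightarrow> ereal (lat_angle 0)) (at_right (ereal 0))"
     "((ereal \<circ> lat_angle \<circ> real_of_ereal) \<longlongrightarrow> ereal (lat_angle B)) (at_left (ereal B))"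
    unfolding ereal_tendsto_simps using B0 by simp_all
  have g'_nn: "0 \<le> g' b" if "ereal 0 \<le> ereal b" "ereal b \<le> ereal B" for b
    unfolding g'_def using h_nonneg(1)[of b] w_pos[of b] lat_angle_facts(4)[of b] that by simp
  have g'f0: "f0 (lat_angle b) * g' b = 1 / S" if "0 < b" "b < B" for b
  proof -
    have b: "b \<in> {0..B}" using that by auto
    have "h b > 0" using h_nonneg(2)[of b] that by auto
    then show ?thesis unfolding f0_def sqrt_radicand_lat_angle[OF b] g'_def using lat_angle_facts(4)[OF b] w_pos[OF b] S_pos by simp
  qed
  have int0: "set_integrable lborel (einterval (ereal (lat_angle 0)) (ereal (lat_angle B))) f0"
  proof (rule interval_integral_substitution_nonneg(1)[where g = lat_angle and g' = g' and a = "ereal 0" and b = "ereal B"])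
    show "set_integrable lborel (einterval (ereal 0) (ereal B)) (\<lambda>x. f0 (lat_angle x) * g' x)"
    proof (subst set_integrable_cong[OF refl])
      show "f0 (lat_angle b) * g' b = 1 / S" if "b \<in> einterval (ereal 0) (ereal B)" for b
        using that g'f0 by simp
      show "set_integrable lborel (einterval (ereal 0) (ereal B)) (\<lambda>b. 1 / S)"
        by (rule set_integrable_subset[of _ "{0..B}"]) (auto intro!: borel_integrable_atLeastAtMost')
    qed simp
    show "0 \<le> f0 (lat_angle b)" if "ereal 0 < ereal b" "ereal b < ereal B" for b
      unfolding f0_def using that lat_angle_facts(4)[of b] radicand_pos[OF lat_angle_in, of b] by auto
  qed (use B tend isg' g'_nn lat_angle_deriv[folded g'_def] isf0[OF lat_angle_in] in auto)
  \<comment> \<open>The quotient of \<open>integrand\<close> by \<open>f0\<close>. It has no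
    radical, is continuous up to the endpoint and hence is bounded on the compact interval.\<close>
  define gg where "gg t = integrand_num t / ((1 + base_cos - 2 * (cos t)\<^sup>2) * sin t)" for t
  have sin_pos: "0 < sin t" if "t \<in> {lat_angle 0..lat_angle B}" for t
    using lat_angle_surj[OF that] lat_angle_facts(4) by auto
  have "continuous_on {lat_angle 0..lat_angle B} gg"
    unfolding gg_def integrand_num_def by (intro continuous_intros) (use denominator_pos sin_pos in force)
  then have "bounded (gg ` {lat_angle 0..lat_angle B})" by (intro compact_imp_bounded compact_continuous_image) auto
  then obtain M where "\<forall>t\<in>{lat_angle 0..lat_angle B}. norm (gg t) \<le> M"
    unfolding bounded_iff by auto
  then have M: "norm (gg t) \<le> M" if "t \<in> {lat_angle 0..lat_angle B}" for t using that by blast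
  show int: "set_integrable lborel (einterval (ereal (lat_angle 0)) (ereal (lat_angle B))) integrand"
  proof (rule set_integrable_bound)
    show "set_integrable lborel (einterval (ereal (lat_angle 0)) (ereal (lat_angle B))) (\<lambda>t. M * f0 t)"
      using int0 by (intro set_integrable_mult_right)
    have cff: "continuous_on (einterval (ereal (lat_angle 0)) (ereal (lat_angle B))) integrand"
      by (auto intro!: continuous_at_imp_continuous_on isff)
    show "set_borel_measurable lborel (einterval (ereal (lat_angle 0)) (ereal (lat_angle B))) integrand"
      unfolding set_borel_measurable_def
      using borel_measurable_continuous_on_indicator[OF _ cff] by simp
    have "norm (integrand t) \<le> norm (M * f0 t)" if "t \<in> {lat_angle 0<..lat_angle B}" for t
    proof -
      have s: "0 < sin t" and R: "0 < radicand t" using sin_pos[of t] radicand_pos[OF that] that by auto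
      have "integrand t = gg t * f0 t" unfolding integrand_def gg_def f0_def using s by simp
      moreover have "0 \<le> f0 t" unfolding f0_def using s R by simp
      moreover from this have "\<bar>gg t\<bar> * f0 t \<le> M * f0 t" using M[of t] that by (intro mult_right_mono) auto
      ultimately show ?thesis by (simp add: abs_mult) (metis abs_ge_self abs_mult abs_of_nonneg order_trans)
    qed
    then show "AE t in lborel. t \<in> einterval (ereal (lat_angle 0)) (ereal (lat_angle B)) \<longrightarrow> norm (integrand t) \<le> norm (M * f0 t)"
      by (intro AE_I2) auto
  qed
  \<comment> \<open>The factor \<open>4 * h b * w b\<close> cancels against the square root. The
    remaining 2 accounts for \<open>2 * V B\<close>, and finally for \<open>n\<close> rather than
    \<open>2 * n\<close> in front of the integral.\<close>
  have g'ff: "g' b * integrand (lat_angle b) = 2 * integral {-1..1} (J' b)" if "0 < b" "b < B" for b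
  proof -
    have b: "b \<in> {0..B}" using that by auto
    have "h b > 0" using h_nonneg(2)[of b] that by auto
    then have "4 * h b * w b / sin (lat_angle b) * (integrand_num (lat_angle b) / (e * (4 * S * h b * w b))) = 2 * (integrand_num (lat_angle b) / (2 * e * S * sin (lat_angle b)))" for e
      using lat_angle_facts(4)[OF b] w_pos[OF b] S_pos by simp
    then show ?thesis unfolding integrand_def sqrt_radicand_lat_angle[OF b] g'_def J'_integral_eq[OF b] .
  qed
  have cDJ: "continuous_on {0..B} (\<lambda>b. 2 * integral {-1..1} (J' b))"
  proof -
    have "continuous_on {0..B} (\<lambda>b. integral (cbox (-1) 1) (J' b))"
      by (rule integral_continuous_on_param[OF J'_continuous])
    from continuous_on_mult_left[OF this[unfolded cbox_interval]] show ?thesis .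
  qed
  have "(LBINT t=ereal (lat_angle 0)..ereal (lat_angle B). integrand t) = (LBINT b=ereal 0..ereal B. g' b *\<^sub>R integrand (lat_angle b))"
  proof (rule interval_integral_substitution_integrable)
    show "set_integrable lborel (einterval (ereal 0) (ereal B)) (\<lambda>x. g' x *\<^sub>R integrand (lat_angle x))"
    proof (subst set_integrable_cong[OF refl])
      show "g' b *\<^sub>R integrand (lat_angle b) = 2 * integral {-1..1} (J' b)" if "b \<in> einterval (ereal 0) (ereal B)" for b
        using that g'ff by simp
      show "set_integrable lborel (einterval (ereal 0) (ereal B)) (\<lambda>b. 2 * integral {-1..1} (J' b))"
        by (rule set_integrable_subset[OF borel_integrable_atLeastAtMost'[OF cDJ]]) auto
    qed simp
  qed (use B tend isg' g'_nn lat_angle_deriv[folded g'_def] isff[OF lat_angle_in] int in auto)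
  also have "\<dots> = (LBINT b=ereal 0..ereal B. 2 * integral {-1..1} (J' b))"
    by (rule interval_integral_cong) (use g'ff B in auto)
  also have "\<dots> = 2 * V B - 2 * V 0"
  proof (rule interval_integral_FTC_finite)
    show "continuous_on {min 0 B..max 0 B} (\<lambda>b. 2 * integral {-1..1} (J' b))" using cDJ B by simp
    show "((\<lambda>b. 2 * V b) has_vector_derivative 2 * integral {-1..1} (J' b)) (at b within {min 0 B..max 0 B})"
      if "min 0 B \<le> b" "b \<le> max 0 B" for b
      using V_deriv[of b] that B unfolding has_real_derivative_iff_has_vector_derivative[symmetric]
      by (auto intro!: derivative_eq_intros)
  qed
  \<comment> \<open>For the flat antiprism \<open>h 0 = 0\<close>, so all vertices lie on one great
    sphere and the volume is zero.\<close>
  also have "V 0 = 0" unfolding V_def J_def h_def by simp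
  finally show "(LBINT t=ereal (lat_angle 0)..ereal (lat_angle B). integrand t) = 2 * V B" by simp
qed

end

end


section \<open>Measure of a sector\<close>

text \<open>Interchanging the integrals requires measurability over iterated products of the
  one-dimensional sigma-algebras, so membership is restated in this form.\<close>

abbreviation borel4 :: "(real \<times> real \<times> real \<times> real) measure" where
  "borel4 \<equiv> borel \<Otimes>\<^sub>M (borel \<Otimes>\<^sub>M (borel \<Otimes>\<^sub>M borel))"

lemma nn_integral_lborel_prod:
  fixes f :: "'a::euclidean_space \<times> 'b::euclidean_space \<Rightarrow> ennreal"
  assumes "f \<in> borel_measurable borel"
  shows "integral\<^sup>N lborel f = (\<integral>\<^sup>+p. \<integral>\<^sup>+r. f (p, r) \<partial>lborel \<partial>lborel)"
proof -
  have "f \<in> borel_measurable (lborel \<Otimes>\<^sub>M lborel)" using assms by (simp add: lborel_prod)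
  from lborel.nn_integral_fst[OF this] show ?thesis by (simp add: lborel_prod)
qed

lemma nn_integral_lborel4:
  fixes f :: "real \<times> real \<times> real \<times> real \<Rightarrow> ennreal"
  assumes "f \<in> borel_measurable borel"
  shows "integral\<^sup>N lborel f = (\<integral>\<^sup>+p. \<integral>\<^sup>+q. \<integral>\<^sup>+x. \<integral>\<^sup>+y. f (p, q, x, y) \<partial>lborel \<partial>lborel \<partial>lborel \<partial>lborel)"
proof -
  have 1: "(\<lambda>r. f (p, r)) \<in> borel_measurable borel" for p
    by (rule measurable_compose[OF _ assms]) (intro borel_measurable_continuous_onI continuous_intros)
  have 2: "(\<lambda>r. f (p, q, r)) \<in> borel_measurable borel" for p q
    by (rule measurable_compose[OF _ 1]) (intro borel_measurable_continuous_onI continuous_intros)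
  show ?thesis by (simp only: nn_integral_lborel_prod[OF assms] nn_integral_lborel_prod[OF 1] nn_integral_lborel_prod[OF 2])
qed

lemma has_integral_Ioo_iff_Icc:
  fixes f :: "real \<Rightarrow> real"
  shows "(f has_integral y) {a<..<b} \<longleftrightarrow> (f has_integral y) {a..b}"
  using has_integral_open_interval[of f y a b] by (simp add: box_real)

context antiprism_profile
begin

text \<open>
  The components of \<open>(p, q, x, y)\<close> are the coordinates along the pole, along the rest of the axis
  plane, towards the vertex, and across.
\<close>

definition sector :: "real \<Rightarrow> (real \<times> real \<times> real \<times> real) set" where
  "sector b = {(p, q, x, y). 0 < p \<and> 0 < x \<and> \<bar>q\<bar> / h b < p / w b \<and>
     x / \<rho> \<le> c * (p / w b) + (c - 1) * (q / h b) \<and>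
     \<bar>y\<bar> * (c * (p / w b) + (c - 1) * (q / h b)) < x * (S * (p / w b + q / h b) / 2) \<and>
     p\<^sup>2 + q\<^sup>2 + x\<^sup>2 + y\<^sup>2 \<le> 1}"

lemma sector_measurable [measurable]: "sector b \<in> sets borel"
proof -
  have "sector b = {r. 0 < fst r} \<inter> {r. 0 < fst (snd (snd r))} \<inter> {r. \<bar>fst (snd r)\<bar> / h b < fst r / w b}
     \<inter> {r. fst (snd (snd r)) / \<rho> \<le> c * (fst r / w b) + (c - 1) * (fst (snd r) / h b)}
     \<inter> {r. \<bar>snd (snd (snd r))\<bar> * (c * (fst r / w b) + (c - 1) * (fst (snd r) / h b)) < fst (snd (snd r)) * (S * (fst r / w b + fst (snd r) / h b) / 2)}
     \<inter> {r. (fst r)\<^sup>2 + (fst (snd r))\<^sup>2 + (fst (snd (snd r)))\<^sup>2 + (snd (snd (snd r)))\<^sup>2 \<le> 1}"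
    unfolding sector_def by auto
  also have "\<dots> \<in> sets borel"
    unfolding divide_inverse
    by (intro sets.Int borel_open[OF open_Collect_less] borel_closed[OF closed_Collect_le] continuous_intros)
  finally show ?thesis .
qed

text \<open>The sector after \<open>p = w b * s\<close>, \<open>q = h b * s * z\<close>, with
  position \<open>\<rho> * s * x\<close> along the altitude and slope \<open>u\<close> across it.
  Only the last condition, the bound on the radial variable \<open>s\<close>, involves the
  shape.\<close>

definition chart_region :: "real \<Rightarrow> (real \<times> real \<times> real \<times> real) set" where
  "chart_region b = {(s, z, x, u). 0 < s \<and> 0 < x \<and> \<bar>z\<bar> < 1 \<and> x \<le> d z \<and> \<bar>u\<bar> * d z < l z \<and>
     s\<^sup>2 * (m b z + \<rho>\<^sup>2 * x\<^sup>2 * (1 + u\<^sup>2)) \<le> 1}"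

lemma chart_region_measurable [measurable]: "chart_region b \<in> sets borel"
proof -
  have "chart_region b = {r. 0 < fst r} \<inter> {r. 0 < fst (snd (snd r))} \<inter> {r. \<bar>fst (snd r)\<bar> < 1}
     \<inter> {r. fst (snd (snd r)) \<le> d (fst (snd r))}
     \<inter> {r. \<bar>snd (snd (snd r))\<bar> * d (fst (snd r)) < l (fst (snd r))}
     \<inter> {r. (fst r)\<^sup>2 * (m b (fst (snd r)) + \<rho>\<^sup>2 * (fst (snd (snd r)))\<^sup>2 * (1 + (snd (snd (snd r)))\<^sup>2)) \<le> 1}"
    unfolding chart_region_def by auto
  also have "\<dots> \<in> sets borel"
    unfolding divide_inverse m_def d_def l_def
    by (intro sets.Int borel_open[OF open_Collect_less] borel_closed[OF closed_Collect_le] continuous_intros)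
  finally show ?thesis .
qed

lemma sector_measurable' [measurable]: "sector b \<in> sets borel4"
  and chart_region_measurable' [measurable]: "chart_region b \<in> sets borel4"
proof -
  have "borel4 = borel" by (simp only: borel_prod)
  then show "sector b \<in> sets borel4" "chart_region b \<in> sets borel4"
    using sector_measurable chart_region_measurable by metis+
qed

lemma sector_chart:
  fixes s z x u :: real
  assumes h: "0 < h b" and w: "0 < w b" and s: "0 < s"
  shows "(w b * s, h b * s * z, \<rho> * s * x, \<rho> * s * x * u) \<in> sector b \<longleftrightarrow> (s, z, x, u) \<in> chart_region b"
proof (cases "0 < x")
  case True
  have 1: "c * (w b * s / w b) + (c - 1) * (h b * s * z / h b) = s * d z" unfolding d_def using h w by (simp add: field_simps)
  have 2: "S * (w b * s / w b + h b * s * z / h b) / 2 = s * l z" unfolding l_def using h w by (simp add: field_simps)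
  have 3: "\<bar>h b * s * z\<bar> / h b < w b * s / w b \<longleftrightarrow> \<bar>z\<bar> < 1" using h w s by (simp add: abs_mult)
  have 4: "\<rho> * s * x / \<rho> \<le> s * d z \<longleftrightarrow> x \<le> d z" using rho_pos s by simp
  have 5: "\<bar>\<rho> * s * x * u\<bar> * (s * d z) < \<rho> * s * x * (s * l z) \<longleftrightarrow> \<bar>u\<bar> * d z < l z"
  proof -
    have "\<bar>\<rho> * s * x * u\<bar> * (s * d z) = (\<rho> * s * x * s) * (\<bar>u\<bar> * d z)" "\<rho> * s * x * (s * l z) = (\<rho> * s * x * s) * l z"
      using True rho_pos s by (simp_all add: abs_mult)
    moreover have "0 < \<rho> * s * x * s" using True rho_pos s by simp
    ultimately show ?thesis by (metis mult_less_cancel_left_pos)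
  qed
  have 6: "(w b * s)\<^sup>2 + (h b * s * z)\<^sup>2 + (\<rho> * s * x)\<^sup>2 + (\<rho> * s * x * u)\<^sup>2 = s\<^sup>2 * (m b z + \<rho>\<^sup>2 * x\<^sup>2 * (1 + u\<^sup>2))"
    unfolding m_def by algebra
  show ?thesis unfolding sector_def chart_region_def mem_Collect_eq prod.case 1 2 3 4 5 6 using h w s rho_pos True by simp
next
  case False
  then have "\<not> 0 < \<rho> * s * x" using rho_pos s by (simp add: mult_nonneg_nonpos not_less)
  with False show ?thesis unfolding sector_def chart_region_def by simp
qed

text \<open>The substitution is triangular, each coordinate being rescaled by a factor that depends
  on the earlier ones. So one-dimensional scalings suffice, and their factors multiply to the
  density.\<close>

lemma emeasure_sector_chart:
  assumes h: "0 < h b" and w: "0 < w b"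
  shows "emeasure lborel (sector b) =
    (\<integral>\<^sup>+z. \<integral>\<^sup>+u. \<integral>\<^sup>+x. \<integral>\<^sup>+s. ennreal (h b * w b * \<rho>\<^sup>2 * x * s ^ 3) * indicator (chart_region b) (s, z, x, u) \<partial>lborel \<partial>lborel \<partial>lborel \<partial>lborel)"
proof -
  let ?I = "indicator (sector b) :: _ \<Rightarrow> ennreal" and ?R = "indicator (chart_region b) :: _ \<Rightarrow> ennreal"
  have "emeasure lborel (sector b) = (\<integral>\<^sup>+p. ?I p \<partial>lborel)"
    by (subst nn_integral_indicator) auto
  also have "\<dots> = (\<integral>\<^sup>+p. \<integral>\<^sup>+q. \<integral>\<^sup>+x. \<integral>\<^sup>+y. ?I (p, q, x, y) \<partial>lborel \<partial>lborel \<partial>lborel \<partial>lborel)"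
    by (intro nn_integral_lborel4 borel_measurable_indicator) auto
  also have "\<dots> = w b * (\<integral>\<^sup>+s. \<integral>\<^sup>+q. \<integral>\<^sup>+x. \<integral>\<^sup>+y. ?I (w b * s, q, x, y) \<partial>lborel \<partial>lborel \<partial>lborel \<partial>lborel)"
    by (subst nn_integral_real_affine[where c = "w b" and t = 0]) (use w in simp_all)
  also have "\<dots> = (\<integral>\<^sup>+s. w b * (\<integral>\<^sup>+q. \<integral>\<^sup>+x. \<integral>\<^sup>+y. ?I (w b * s, q, x, y) \<partial>lborel \<partial>lborel \<partial>lborel) \<partial>lborel)"
    by (subst nn_integral_cmult) simp_all
  also have "\<dots> = (\<integral>\<^sup>+s. \<integral>\<^sup>+z. \<integral>\<^sup>+x. \<integral>\<^sup>+u. ennreal (h b * w b * \<rho>\<^sup>2 * x * s ^ 3) * ?R (s, z, x, u) \<partial>lborel \<partial>lborel \<partial>lborel \<partial>lborel)"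
  proof (rule nn_integral_cong)
    fix s :: real
    show "w b * (\<integral>\<^sup>+q. \<integral>\<^sup>+x. \<integral>\<^sup>+y. ?I (w b * s, q, x, y) \<partial>lborel \<partial>lborel \<partial>lborel)
      = (\<integral>\<^sup>+z. \<integral>\<^sup>+x. \<integral>\<^sup>+u. ennreal (h b * w b * \<rho>\<^sup>2 * x * s ^ 3) * ?R (s, z, x, u) \<partial>lborel \<partial>lborel \<partial>lborel)"
    proof (cases "0 < s")
      \<comment> \<open>For \<open>s \<le> 0\<close> the next scaling factor is not positive, but
        both integrands vanish there. The case \<open>x \<le> 0\<close> below is treated
        alike.\<close>
      case False
      then have "\<not> 0 < w b * s" using w by (auto simp: zero_less_mult_iff)
      then have "?I (w b * s, q, x, y) = 0" "?R (s, z, x, u) = 0" for q x y z u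
        using False unfolding sector_def chart_region_def by auto
      then show ?thesis by simp
    next
      case s: True
      have "(\<integral>\<^sup>+q. \<integral>\<^sup>+x. \<integral>\<^sup>+y. ?I (w b * s, q, x, y) \<partial>lborel \<partial>lborel \<partial>lborel)
        = h b * s * (\<integral>\<^sup>+z. \<integral>\<^sup>+x. \<integral>\<^sup>+y. ?I (w b * s, h b * s * z, x, y) \<partial>lborel \<partial>lborel \<partial>lborel)"
        by (subst nn_integral_real_affine[where c = "h b * s" and t = 0]) (use h s in simp_all)
      also have "\<dots> = (\<integral>\<^sup>+z. h b * s * (\<integral>\<^sup>+x. \<integral>\<^sup>+y. ?I (w b * s, h b * s * z, x, y) \<partial>lborel \<partial>lborel) \<partial>lborel)"
        by (subst nn_integral_cmult) simp_all
      finally have 1: "w b * (\<integral>\<^sup>+q. \<integral>\<^sup>+x. \<integral>\<^sup>+y. ?I (w b * s, q, x, y) \<partial>lborel \<partial>lborel \<partial>lborel)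
        = (\<integral>\<^sup>+z. w b * (h b * s * (\<integral>\<^sup>+x. \<integral>\<^sup>+y. ?I (w b * s, h b * s * z, x, y) \<partial>lborel \<partial>lborel)) \<partial>lborel)"
        by (simp add: nn_integral_cmult)
      show ?thesis unfolding 1
      proof (rule nn_integral_cong)
        fix z :: real
        have "(\<integral>\<^sup>+x. \<integral>\<^sup>+y. ?I (w b * s, h b * s * z, x, y) \<partial>lborel \<partial>lborel)
          = \<rho> * s * (\<integral>\<^sup>+x. \<integral>\<^sup>+y. ?I (w b * s, h b * s * z, \<rho> * s * x, y) \<partial>lborel \<partial>lborel)"
          by (subst nn_integral_real_affine[where c = "\<rho> * s" and t = 0]) (use rho_pos s in simp_all)
        then have 2: "w b * (h b * s * (\<integral>\<^sup>+x. \<integral>\<^sup>+y. ?I (w b * s, h b * s * z, x, y) \<partial>lborel \<partial>lborel))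
          = (\<integral>\<^sup>+x. w b * (h b * s * (\<rho> * s * (\<integral>\<^sup>+y. ?I (w b * s, h b * s * z, \<rho> * s * x, y) \<partial>lborel))) \<partial>lborel)"
          by (simp add: nn_integral_cmult)
        show "w b * (h b * s * (\<integral>\<^sup>+x. \<integral>\<^sup>+y. ?I (w b * s, h b * s * z, x, y) \<partial>lborel \<partial>lborel))
          = (\<integral>\<^sup>+x. \<integral>\<^sup>+u. ennreal (h b * w b * \<rho>\<^sup>2 * x * s ^ 3) * ?R (s, z, x, u) \<partial>lborel \<partial>lborel)"
          unfolding 2
        proof (rule nn_integral_cong)
          fix x :: real
          show "w b * (h b * s * (\<rho> * s * (\<integral>\<^sup>+y. ?I (w b * s, h b * s * z, \<rho> * s * x, y) \<partial>lborel)))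
            = (\<integral>\<^sup>+u. ennreal (h b * w b * \<rho>\<^sup>2 * x * s ^ 3) * ?R (s, z, x, u) \<partial>lborel)"
          proof (cases "0 < x")
            case False
            then have "\<not> 0 < \<rho> * s * x" using s rho_pos by (simp add: mult_nonneg_nonpos not_less)
            then have "?I (w b * s, h b * s * z, \<rho> * s * x, y) = 0" "?R (s, z, x, u) = 0" for y u
              using False unfolding sector_def chart_region_def by auto
            then show ?thesis by simp
          next
            case x: True
            have "(\<integral>\<^sup>+y. ?I (w b * s, h b * s * z, \<rho> * s * x, y) \<partial>lborel)
              = \<rho> * s * x * (\<integral>\<^sup>+u. ?I (w b * s, h b * s * z, \<rho> * s * x, \<rho> * s * x * u) \<partial>lborel)"
              by (subst nn_integral_real_affine[where c = "\<rho> * s * x" and t = 0]) (use rho_pos s x in simp_all)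
            also have "(\<integral>\<^sup>+u. ?I (w b * s, h b * s * z, \<rho> * s * x, \<rho> * s * x * u) \<partial>lborel) = (\<integral>\<^sup>+u. ?R (s, z, x, u) \<partial>lborel)"
              by (intro nn_integral_cong) (simp add: indicator_def sector_chart[OF h w s])
            finally have 3: "(\<integral>\<^sup>+y. ?I (w b * s, h b * s * z, \<rho> * s * x, y) \<partial>lborel) = ennreal (\<rho> * s * x) * (\<integral>\<^sup>+u. ?R (s, z, x, u) \<partial>lborel)" .
            have 4: "ennreal (w b) * (ennreal (h b * s) * (ennreal (\<rho> * s) * (ennreal (\<rho> * s * x) * y))) = ennreal (h b * w b * \<rho>\<^sup>2 * x * s ^ 3) * y" for y
              unfolding mult.assoc[symmetric] using h w s x rho_pos
              by (simp add: ennreal_mult[symmetric]) (simp add: power2_eq_square power3_eq_cube algebra_simps)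
            show ?thesis unfolding 3 4 by (subst nn_integral_cmult) simp_all
          qed
        qed
      qed
    qed
  qed
  \<comment> \<open>Four interchanges move \<open>s\<close> to the innermost place and leave
    \<open>z\<close> outermost, so that the elementary integrations in \<open>s\<close>,
    \<open>x\<close>, \<open>u\<close> come first.\<close>
  also have "\<dots> = (\<integral>\<^sup>+s. \<integral>\<^sup>+z. \<integral>\<^sup>+u. \<integral>\<^sup>+x. ennreal (h b * w b * \<rho>\<^sup>2 * x * s ^ 3) * ?R (s, z, x, u) \<partial>lborel \<partial>lborel \<partial>lborel \<partial>lborel)"
    by (intro nn_integral_cong lborel_pair.Fubini') measurable
  also have "\<dots> = (\<integral>\<^sup>+z. \<integral>\<^sup>+s. \<integral>\<^sup>+u. \<integral>\<^sup>+x. ennreal (h b * w b * \<rho>\<^sup>2 * x * s ^ 3) * ?R (s, z, x, u) \<partial>lborel \<partial>lborel \<partial>lborel \<partial>lborel)"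
    by (intro lborel_pair.Fubini') measurable
  also have "\<dots> = (\<integral>\<^sup>+z. \<integral>\<^sup>+u. \<integral>\<^sup>+s. \<integral>\<^sup>+x. ennreal (h b * w b * \<rho>\<^sup>2 * x * s ^ 3) * ?R (s, z, x, u) \<partial>lborel \<partial>lborel \<partial>lborel \<partial>lborel)"
    by (intro nn_integral_cong lborel_pair.Fubini') measurable
  also have "\<dots> = (\<integral>\<^sup>+z. \<integral>\<^sup>+u. \<integral>\<^sup>+x. \<integral>\<^sup>+s. ennreal (h b * w b * \<rho>\<^sup>2 * x * s ^ 3) * ?R (s, z, x, u) \<partial>lborel \<partial>lborel \<partial>lborel \<partial>lborel)"
    by (intro nn_integral_cong lborel_pair.Fubini') measurable
  finally show ?thesis .
qed


section \<open>The three elementary integrations\<close>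

lemma chart_integral_s:
  fixes x z u :: real
  assumes w: "0 < w b" and h: "0 < h b" and x: "0 < x"
  defines "Q \<equiv> m b z + \<rho>\<^sup>2 * x\<^sup>2 * (1 + u\<^sup>2)"
  shows "(\<integral>\<^sup>+s. ennreal (h b * w b * \<rho>\<^sup>2 * x * s ^ 3) * indicator {s. 0 < s \<and> s\<^sup>2 * Q \<le> 1} s \<partial>lborel)
    = ennreal (h b * w b * \<rho>\<^sup>2 * x / (4 * Q\<^sup>2))"
proof -
  have Q: "0 < Q" unfolding Q_def using m_pos[of b z] w by (intro add_pos_nonneg) auto
  define K where "K = h b * w b * \<rho>\<^sup>2 * x"
  have K: "0 < K" unfolding K_def using w h x rho_pos by simp
  define r where "r = 1 / sqrt Q"
  have r: "0 < r" "r\<^sup>2 = 1 / Q" unfolding r_def using Q by (auto simp: power_divide)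
  have eq: "{s. 0 < s \<and> s\<^sup>2 * Q \<le> 1} = {s. 0 < s \<and> s \<le> r}"
  proof -
    have "s\<^sup>2 * Q \<le> 1 \<longleftrightarrow> s \<le> r" if "0 < s" for s
    proof -
      have "s\<^sup>2 * Q \<le> 1 \<longleftrightarrow> s\<^sup>2 \<le> r\<^sup>2" unfolding r(2) using Q by (simp add: field_simps)
      then show ?thesis using that r(1) by (simp add: power_mono_iff)
    qed
    then show ?thesis by auto
  qed
  have "(\<integral>\<^sup>+s. ennreal (K * s ^ 3) * indicator {s. 0 < s \<and> s\<^sup>2 * Q \<le> 1} s \<partial>lborel)
     = (\<integral>\<^sup>+s. ennreal (K * s ^ 3) * indicator {0..r} s \<partial>lborel)"
    unfolding eq by (intro nn_integral_cong) (auto simp: indicator_def)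
  also have "\<dots> = ennreal (K * r ^ 4 / 4)"
  proof (rule nn_integral_has_integral_lebesgue')
    show "((\<lambda>s. K * s ^ 3) has_integral K * r ^ 4 / 4) {0..r}"
    proof -
      have "((\<lambda>s. K * s ^ 4 / 4) has_vector_derivative K * s ^ 3) (at s within {0..r})" for s
        unfolding has_real_derivative_iff_has_vector_derivative[symmetric] by (auto intro!: derivative_eq_intros)
      then have "((\<lambda>s. K * s ^ 3) has_integral K * r ^ 4 / 4 - K * 0 ^ 4 / 4) {0..r}"
        using r by (intro fundamental_theorem_of_calculus) auto
      then show ?thesis by simp
    qed
  qed (use K in auto)
  also have "K * r ^ 4 / 4 = K / (4 * Q\<^sup>2)"
  proof -
    have "r ^ 4 = (r\<^sup>2)\<^sup>2" by (simp flip: power_mult)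
    then show ?thesis unfolding r(2) by (simp add: power_divide)
  qed
  finally show ?thesis unfolding K_def .
qed

lemma chart_integral_x:
  assumes w: "0 < w b" and h: "0 < h b" and d: "0 < d z"
  shows "(\<integral>\<^sup>+x. ennreal (h b * w b * \<rho>\<^sup>2 * x / (4 * (m b z + \<rho>\<^sup>2 * x\<^sup>2 * (1 + u\<^sup>2))\<^sup>2)) * indicator {x. 0 < x \<and> x \<le> d z} x \<partial>lborel)
    = ennreal (h b * w b * \<rho>\<^sup>2 * (d z)\<^sup>2 / (8 * m b z) * (1 / (k b z + (\<rho> * d z * u)\<^sup>2)))"
proof -
  define N where "N = m b z"
  define v where "v = \<rho>\<^sup>2 * (1 + u\<^sup>2)"
  have N: "0 < N" unfolding N_def using m_pos w by simp
  have "0 < 1 + u\<^sup>2" by (intro add_pos_nonneg) auto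
  then have v: "0 < v" unfolding v_def using rho_pos by simp
  have Q: "0 < N + v * x\<^sup>2" for x using N v by (intro add_pos_nonneg) auto
  have Qe: "m b z + \<rho>\<^sup>2 * x\<^sup>2 * (1 + u\<^sup>2) = N + v * x\<^sup>2" for x unfolding N_def v_def by simp
  define K where "K = h b * w b * \<rho>\<^sup>2"
  have K: "0 < K" unfolding K_def using w h rho_pos by simp
  have "(\<integral>\<^sup>+x. ennreal (K * x / (4 * (N + v * x\<^sup>2)\<^sup>2)) * indicator {x. 0 < x \<and> x \<le> d z} x \<partial>lborel)
     = (\<integral>\<^sup>+x. ennreal (K * x / (4 * (N + v * x\<^sup>2)\<^sup>2)) * indicator {0..d z} x \<partial>lborel)"
    by (intro nn_integral_cong) (auto simp: indicator_def)
  also have "\<dots> = ennreal (- K / (8 * v * (N + v * (d z)\<^sup>2)) - (- K / (8 * v * (N + v * 0\<^sup>2))))"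
  proof (rule nn_integral_has_integral_lebesgue')
    show "((\<lambda>x. K * x / (4 * (N + v * x\<^sup>2)\<^sup>2)) has_integral - K / (8 * v * (N + v * (d z)\<^sup>2)) - (- K / (8 * v * (N + v * 0\<^sup>2)))) {0..d z}"
    proof (rule fundamental_theorem_of_calculus)
      show "((\<lambda>x. - K / (8 * v * (N + v * x\<^sup>2))) has_vector_derivative K * x / (4 * (N + v * x\<^sup>2)\<^sup>2)) (at x within {0..d z})" for x
      proof -
        define P where "P x = N + v * x\<^sup>2" for x
        have dP: "(P has_real_derivative 2 * v * x) (at x within {0..d z})"
          unfolding P_def by (auto intro!: derivative_eq_intros)
        have "P x \<noteq> 0" using Q[of x] unfolding P_def by simp
        then have "((\<lambda>x. - K / (8 * v * P x)) has_real_derivative K * x / (4 * (P x)\<^sup>2)) (at x within {0..d z})"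
          using v by (auto intro!: derivative_eq_intros dP simp: field_simps power2_eq_square)
        then show ?thesis unfolding P_def has_real_derivative_iff_has_vector_derivative .
      qed
    qed (use d in auto)
  qed (use K in auto)
  also have "- K / (8 * v * (N + v * (d z)\<^sup>2)) - (- K / (8 * v * (N + v * 0\<^sup>2))) = K * (d z)\<^sup>2 / (8 * N) * (1 / (N + v * (d z)\<^sup>2))"
    using Q[of "d z"] v N by (simp add: divide_simps) (simp add: algebra_simps)
  also have "N + v * (d z)\<^sup>2 = k b z + (\<rho> * d z * u)\<^sup>2" unfolding N_def v_def k_def by algebra
  finally show ?thesis unfolding K_def N_def v_def by (simp add: mult_ac)
qed

lemma chart_integral_u:
  assumes w: "0 < w b" and h: "0 < h b" and d: "0 < d z" and z: "\<bar>z\<bar> \<le> 1"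
  shows "(\<integral>\<^sup>+u. ennreal (h b * w b * \<rho>\<^sup>2 * (d z)\<^sup>2 / (8 * m b z) * (1 / (k b z + (\<rho> * d z * u)\<^sup>2))) * indicator {u. \<bar>u\<bar> * d z < l z} u \<partial>lborel)
    = ennreal (J b z / 4)"
proof -
  define s where "s = sqrt (k b z)"
  have s: "0 < s" "k b z = s\<^sup>2" unfolding s_def using k_pos[of b z] w by auto
  define K where "K = h b * w b * \<rho>\<^sup>2 * (d z)\<^sup>2 / (8 * m b z)"
  have m: "0 < m b z" using m_pos w by simp
  have K: "0 < K" unfolding K_def using w h rho_pos m d by simp
  define y where "y = l z / d z"
  have y: "0 \<le> y" unfolding y_def l_def using z S_pos d by simp
  have P: "0 < s\<^sup>2 + (\<rho> * d z * u)\<^sup>2" for u using s by (intro add_pos_nonneg) auto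
  define F where "F u = K * (arctan (\<rho> * d z * u / s) / (\<rho> * d z * s))" for u
  have "\<bar>u\<bar> * d z < l z \<longleftrightarrow> - y < u \<and> u < y" for u
    unfolding y_def pos_less_divide_eq[OF d, symmetric] abs_less_iff by auto
  then have "{u. \<bar>u\<bar> * d z < l z} = {-y<..<y}"
    by (intro set_eqI) (simp only: mem_Collect_eq greaterThanLessThan_iff)
  then have "(\<integral>\<^sup>+u. ennreal (K * (1 / (k b z + (\<rho> * d z * u)\<^sup>2))) * indicator {u. \<bar>u\<bar> * d z < l z} u \<partial>lborel)
    = (\<integral>\<^sup>+u. ennreal (K * (1 / (k b z + (\<rho> * d z * u)\<^sup>2))) * indicator {-y<..<y} u \<partial>lborel)" by simp
  also have "\<dots> = ennreal (F y - F (- y))"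
  proof (rule nn_integral_has_integral_lebesgue')
    have "((\<lambda>u. K * (1 / (k b z + (\<rho> * d z * u)\<^sup>2))) has_integral F y - F (- y)) {-y..y}"
    proof (rule fundamental_theorem_of_calculus)
      fix u
      have "inverse (1 + (\<rho> * d z * u / s)\<^sup>2) = s\<^sup>2 / (s\<^sup>2 + (\<rho> * d z * u)\<^sup>2)"
        using P[of u] s(1) by (simp add: field_simps)
      moreover have "(F has_real_derivative K * (inverse (1 + (\<rho> * d z * u / s)\<^sup>2) * (\<rho> * d z / s) / (\<rho> * d z * s))) (at u within {-y..y})"
        unfolding F_def using s(1) rho_pos d by (auto intro!: derivative_eq_intros)
      moreover have "s\<^sup>2 / q * (\<rho> * d z / s) / (\<rho> * d z * s) = 1 / q" for q
        using s(1) rho_pos d by (simp add: field_simps power2_eq_square)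
      ultimately show "(F has_vector_derivative K * (1 / (k b z + (\<rho> * d z * u)\<^sup>2))) (at u within {-y..y})"
        unfolding has_real_derivative_iff_has_vector_derivative[symmetric] s(2) by simp
    qed (use y in auto)
    then show "((\<lambda>u. K * (1 / (k b z + (\<rho> * d z * u)\<^sup>2))) has_integral F y - F (- y)) {-y<..<y}"
      by (simp only: has_integral_Ioo_iff_Icc)
  qed (use K P s(2) in \<open>auto simp: less_imp_le\<close>)
  also have "F y - F (- y) = 2 * K * arctan (\<rho> * l z / s) / (\<rho> * d z * s)"
    unfolding F_def y_def using d by (simp add: arctan_minus mult_ac)
  also have "\<dots> = J b z / 4"
    unfolding J_def K_def s_def[symmetric] using s(1) rho_pos d m by (simp add: field_simps power2_eq_square)
  finally show ?thesis unfolding K_def .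
qed

lemma J_nonneg: assumes "0 < w b" "0 < h b" "\<bar>z\<bar> \<le> 1" shows "0 \<le> J b z"
proof -
  have "(1 - c) * z \<le> 1 - c" using assms c_less_1 by (simp add: mult_left_le)
  then have "0 \<le> d z" unfolding d_def using c_ge by (simp add: algebra_simps)
  moreover have "0 \<le> l z" unfolding l_def using S_pos assms by simp
  ultimately show ?thesis unfolding J_def using assms m_pos[of b z] k_pos[of b z] rho_pos
    by (simp add: zero_le_arctan_iff)
qed

lemma emeasure_sector:
  assumes h: "0 < h b" and w: "0 < w b" and b: "0 < b" "b < pi / 2"
  shows "emeasure lborel (sector b) = ennreal (V b / 4)"
proof -
  have eq: "(\<integral>\<^sup>+u. \<integral>\<^sup>+x. \<integral>\<^sup>+s. ennreal (h b * w b * \<rho>\<^sup>2 * x * s ^ 3) * indicator (chart_region b) (s, z, x, u) \<partial>lborel \<partial>lborel \<partial>lborel)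
    = ennreal (J b z / 4) * indicator {-1<..<1} z" for z
  proof (cases "\<bar>z\<bar> < 1 \<and> 0 < d z")
    case False
    then have "indicator (chart_region b) (s, z, x, u) = (0 :: ennreal)" for s x u
      unfolding chart_region_def by auto
    moreover have "J b z = 0" if "\<bar>z\<bar> < 1"
    proof -
      have "(1 - c) * z \<le> 1 - c" using that c_less_1 by (simp add: mult_left_le)
      then have "0 \<le> d z" unfolding d_def using c_ge by (simp add: algebra_simps)
      then show ?thesis using that False unfolding J_def by auto
    qed
    then have "ennreal (J b z / 4) * indicator {-1<..<1} z = 0" by (auto simp: indicator_def)
    ultimately show ?thesis by simp
  next
    case True
    then have z: "\<bar>z\<bar> < 1" and d: "0 < d z" by auto
    have "(\<integral>\<^sup>+s. ennreal (h b * w b * \<rho>\<^sup>2 * x * s ^ 3) * indicator (chart_region b) (s, z, x, u) \<partial>lborel)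
      = ennreal (h b * w b * \<rho>\<^sup>2 * x / (4 * (m b z + \<rho>\<^sup>2 * x\<^sup>2 * (1 + u\<^sup>2))\<^sup>2)) * indicator {x. 0 < x \<and> x \<le> d z} x * indicator {u. \<bar>u\<bar> * d z < l z} u" for x u
    proof (cases "0 < x \<and> x \<le> d z \<and> \<bar>u\<bar> * d z < l z")
      case True
      then have x: "0 < x" by simp
      have "indicator (chart_region b) (s, z, x, u) = (indicator {s. 0 < s \<and> s\<^sup>2 * (m b z + \<rho>\<^sup>2 * x\<^sup>2 * (1 + u\<^sup>2)) \<le> 1} s :: ennreal)" for s
        unfolding chart_region_def using True z by (auto simp: indicator_def)
      then show ?thesis using chart_integral_s[OF w h x, of z u] True by (simp add: indicator_def)
    next
      case False
      then have "indicator (chart_region b) (s, z, x, u) = (0 :: ennreal)" for s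
        unfolding chart_region_def by auto
      then show ?thesis using False by (auto simp: indicator_def)
    qed
    then have "(\<integral>\<^sup>+x. \<integral>\<^sup>+s. ennreal (h b * w b * \<rho>\<^sup>2 * x * s ^ 3) * indicator (chart_region b) (s, z, x, u) \<partial>lborel \<partial>lborel)
      = ennreal (h b * w b * \<rho>\<^sup>2 * (d z)\<^sup>2 / (8 * m b z) * (1 / (k b z + (\<rho> * d z * u)\<^sup>2))) * indicator {u. \<bar>u\<bar> * d z < l z} u" for u
      by (simp only: chart_integral_x[OF w h d, symmetric] nn_integral_multc[symmetric]) (subst nn_integral_multc; measurable)
    then show ?thesis using chart_integral_u[OF w h d less_imp_le[OF z]] z by (simp add: indicator_def abs_less_iff)
  qed
  have "(J b has_integral V b) {-1..1}"
    unfolding V_def using J_continuous[OF b, of b "{-1..1}"] b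
    by (intro integrable_integral integrable_continuous_interval) auto
  then have "((\<lambda>z. J b z / 4) has_integral V b / 4) {-1..1}" by (rule has_integral_divide)
  then have "((\<lambda>z. J b z / 4) has_integral V b / 4) {-1<..<1}"
    by (simp only: has_integral_Ioo_iff_Icc)
  then show ?thesis unfolding emeasure_sector_chart[OF h w] eq
    by (intro nn_integral_has_integral_lebesgue') (use J_nonneg[OF w h] in \<open>auto simp: abs_le_iff less_imp_le\<close>)
qed


text \<open>The walls between neighbouring sectors, which the strict inequality in
  \<open>sector\<close> leaves out.\<close>

definition sector_wall :: "real \<Rightarrow> (real \<times> real \<times> real \<times> real) set" where
  "sector_wall b = {(p, q, x, y). 0 < c * (p / w b) + (c - 1) * (q / h b) \<and>
     \<bar>y\<bar> * (c * (p / w b) + (c - 1) * (q / h b)) = x * (S * (p / w b + q / h b) / 2)}"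

lemma sector_wall_measurable: "sector_wall b \<in> sets borel"
proof -
  have "sector_wall b = {r. 0 < c * (fst r / w b) + (c - 1) * (fst (snd r) / h b)}
     \<inter> {r. \<bar>snd (snd (snd r))\<bar> * (c * (fst r / w b) + (c - 1) * (fst (snd r) / h b)) = fst (snd (snd r)) * (S * (fst r / w b + fst (snd r) / h b) / 2)}"
    unfolding sector_wall_def by auto
  also have "\<dots> \<in> sets borel"
    unfolding divide_inverse
    by (intro sets.Int borel_open[OF open_Collect_less] borel_closed[OF closed_Collect_eq] continuous_intros)
  finally show ?thesis .
qed

text \<open>For fixed \<open>p\<close>, \<open>q\<close>, \<open>x\<close> at most two values of
  \<open>y\<close> remain, so the innermost integral is already zero.\<close>

lemma sector_wall_null: "emeasure lborel (sector_wall b) = 0"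
proof -
  have "emeasure lborel (sector_wall b) = integral\<^sup>N lborel (indicator (sector_wall b))"
    using sector_wall_measurable by (subst nn_integral_indicator) auto
  also have "\<dots> = (\<integral>\<^sup>+p. \<integral>\<^sup>+q. \<integral>\<^sup>+x. \<integral>\<^sup>+y. indicator (sector_wall b) (p, q, x, y) \<partial>lborel \<partial>lborel \<partial>lborel \<partial>lborel)"
    using sector_wall_measurable by (intro nn_integral_lborel4) auto
  also have "\<dots> = (\<integral>\<^sup>+p. \<integral>\<^sup>+q. \<integral>\<^sup>+x. (0 :: ennreal) \<partial>(lborel :: real measure) \<partial>(lborel :: real measure) \<partial>(lborel :: real measure))"
  proof (intro nn_integral_cong)
    fix p q x :: real
    define g where "g = c * (p / w b) + (c - 1) * (q / h b)"
    define t where "t = x * (S * (p / w b + q / h b) / 2)"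
    have "y = t / g \<or> y = - t / g" if "(p, q, x, y) \<in> sector_wall b" for y
    proof -
      have "0 < g" "\<bar>y\<bar> * g = t" using that unfolding sector_wall_def g_def t_def by auto
      then have "\<bar>y\<bar> = t / g" by (simp add: field_simps)
      then show ?thesis by (auto simp: abs_if split: if_splits)
    qed
    then have "(\<integral>\<^sup>+y. indicator (sector_wall b) (p, q, x, y) \<partial>lborel) \<le> (\<integral>\<^sup>+y. indicator {t / g, - t / g} y \<partial>lborel)"
      by (intro nn_integral_mono) (auto simp: indicator_def)
    also have "\<dots> = 0" by (subst nn_integral_indicator) (auto simp: emeasure_lborel_countable)
    finally show "(\<integral>\<^sup>+y. indicator (sector_wall b) (p, q, x, y) \<partial>lborel) = 0" by simp
  qed
  finally show ?thesis by simp
qed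

end


section \<open>Orthonormal coordinates\<close>

text \<open>The permutation passes from the order of integration, pole first, to the order of the
  frame vectors, pole last.\<close>

definition to_vec :: "real \<times> real \<times> real \<times> real \<Rightarrow> real ^ 4" where
  "to_vec r = (case r of (p, q, x, y) \<Rightarrow> (\<chi> i. if i = 1 then x else if i = 2 then y else if i = 3 then q else p))"

lemma to_vec_nth [simp]:
  "to_vec (p, q, x, y) $ 1 = x" "to_vec (p, q, x, y) $ 2 = y"
  "to_vec (p, q, x, y) $ 3 = q" "to_vec (p, q, x, y) $ 4 = p"
  unfolding to_vec_def by simp_all

lemma prod_Basis_cart: "(\<Prod>b\<in>Basis. f b) = (\<Prod>i\<in>(UNIV :: 'n::finite set). f (axis i (1::real)))"
proof -
  have 1: "Basis = range (\<lambda>i::'n. axis i (1::real))" by (auto simp: Basis_vec_def)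
  have 2: "inj (\<lambda>i::'n. axis i (1::real))" by (auto simp: inj_on_def axis_eq_axis)
  show ?thesis unfolding 1 by (subst prod.reindex[OF 2]) simp
qed

lemma prod_4: "prod f (UNIV :: 4 set) = f 1 * f 2 * f 3 * (f 4 :: 'a :: comm_monoid_mult)"
  unfolding UNIV_4 by (simp add: ac_simps)

lemma emeasure_lborel_Times:
  fixes A :: "'a::euclidean_space set" and B :: "'b::euclidean_space set"
  assumes "A \<in> sets borel" "B \<in> sets borel"
  shows "emeasure lborel (A \<times> B) = emeasure lborel A * emeasure lborel B"
  using lborel.emeasure_pair_measure_Times[of A lborel B] assms by (simp add: lborel_prod)

lemma to_vec_measurable: "to_vec \<in> borel_measurable borel"
proof -
  have "continuous_on UNIV to_vec"
  proof -
    have eq: "to_vec = (\<lambda>r. \<chi> i. if i = 1 then fst (snd (snd r)) else if i = 2 then snd (snd (snd r)) else if i = 3 then fst (snd r) else fst r)"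
      unfolding to_vec_def by (auto simp: fun_eq_iff)
    have "continuous_on UNIV (\<lambda>r. if i = 1 then fst (snd (snd r)) else if i = 2 then snd (snd (snd r)) else if i = 3 then fst (snd r) else (fst r :: real))" for i :: 4
      by (cases "i = 1"; cases "i = 2"; cases "i = 3") (simp_all add: continuous_intros)
    then show ?thesis unfolding eq by (intro continuous_on_vec_lambda)
  qed
  then show ?thesis by (rule borel_measurable_continuous_onI)
qed

lemma to_vec_bij: "bij to_vec"
proof (rule bijI')
  show "to_vec r = to_vec r' \<longleftrightarrow> r = r'" for r r'
  proof
    assume eq: "to_vec r = to_vec r'"
    obtain p q x y p' q' x' y' where "r = (p, q, x, y)" "r' = (p', q', x', y')" by (metis surj_pair)
    with arg_cong[OF eq, of "\<lambda>v. v $ 1"] arg_cong[OF eq, of "\<lambda>v. v $ 2"] arg_cong[OF eq, of "\<lambda>v. v $ 3"] arg_cong[OF eq, of "\<lambda>v. v $ 4"]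
    show "r = r'" by simp
  qed simp
  show "\<exists>r. v = to_vec r" for v
    by (intro exI[of _ "(v $ 4, v $ 3, v $ 1, v $ 2)"]) (simp add: vec_eq_iff forall_4)
qed

text \<open>Lebesgue measure is determined by its values on boxes, and permuting coordinates takes
  boxes to boxes with the same side lengths.\<close>

lemma lborel_eq_distr_to_vec: "lborel = distr lborel borel to_vec"
proof (rule lborel_eqI)
  fix l u :: "real ^ 4"
  assume "\<And>b. b \<in> Basis \<Longrightarrow> l \<bullet> b \<le> u \<bullet> b"
  then have le: "l $ i \<le> u $ i" for i by (metis axis_in_Basis_iff inner_axis inner_real_def mult.right_neutral Basis_real_def insertI1)
  have "to_vec -` box l u = {l $ 4<..<u $ 4} \<times> {l $ 3<..<u $ 3} \<times> {l $ 1<..<u $ 1} \<times> {l $ 2<..<u $ 2}"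
    by (auto simp: mem_box_cart forall_4)
  then have "emeasure (distr lborel borel to_vec) (box l u)
    = emeasure lborel ({l $ 4<..<u $ 4} \<times> {l $ 3<..<u $ 3} \<times> {l $ 1<..<u $ 1} \<times> {l $ 2<..<u $ 2})"
    using to_vec_measurable by (subst emeasure_distr) auto
  also have "\<dots> = ennreal (u $ 4 - l $ 4) * (ennreal (u $ 3 - l $ 3) * (ennreal (u $ 1 - l $ 1) * ennreal (u $ 2 - l $ 2)))"
    by (simp add: emeasure_lborel_Times borel_Times le)
  also have "\<dots> = (\<Prod>b\<in>Basis. (u - l) \<bullet> b)"
    unfolding prod_Basis_cart prod_4 inner_axis using le by (simp add: ennreal_mult[symmetric] mult_ac)
  finally show "emeasure (distr lborel borel to_vec) (box l u) = (\<Prod>b\<in>Basis. (u - l) \<bullet> b)" .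
qed simp

lemma emeasure_to_vec_image:
  assumes "A \<in> sets borel"
  shows "to_vec ` A \<in> sets borel" "emeasure lborel (to_vec ` A) = emeasure lborel A"
proof -
  have "to_vec ` A = (\<lambda>v. (v $ 4, v $ 3, v $ 1, v $ 2)) -` A"
  proof -
    have "to_vec (v $ 4, v $ 3, v $ 1, v $ 2) = v" for v by (simp add: vec_eq_iff forall_4)
    moreover have "(to_vec r $ 4, to_vec r $ 3, to_vec r $ 1, to_vec r $ 2) = r" for r
      by (cases r) simp
    ultimately show ?thesis by (intro set_eqI iffI) (auto intro: rev_image_eqI)
  qed
  moreover have "(\<lambda>v::real^4. (v $ 4, v $ 3, v $ 1, v $ 2)) \<in> borel_measurable borel"
    by (intro borel_measurable_continuous_onI continuous_intros)
  from measurable_sets[OF this assms] have "(\<lambda>v::real^4. (v $ 4, v $ 3, v $ 1, v $ 2)) -` A \<in> sets borel" by simp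
  ultimately show m: "to_vec ` A \<in> sets borel" by simp
  have "emeasure lborel (to_vec ` A) = emeasure lborel (to_vec -` (to_vec ` A))"
    by (subst lborel_eq_distr_to_vec, subst emeasure_distr) (use m to_vec_measurable in auto)
  also have "to_vec -` (to_vec ` A) = A" using to_vec_bij by (simp add: bij_def inj_vimage_image_eq)
  finally show "emeasure lborel (to_vec ` A) = emeasure lborel A" .
qed

lemma measure_orthogonal_image4:
  fixes f :: "real ^ 4 \<Rightarrow> real ^ 4"
  assumes "orthogonal_transformation f" "S \<in> lmeasurable"
  shows "f ` S \<in> lmeasurable" "measure lebesgue (f ` S) = measure lebesgue S"
  using measurable_orthogonal_image[OF assms] measure_orthogonal_image[OF assms] by auto


locale orthonormal_frame =
  fixes U1 U2 U3 U4 :: "real ^ 4"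
  assumes orthonormal:
    "U1 \<bullet> U1 = 1" "U2 \<bullet> U2 = 1" "U3 \<bullet> U3 = 1" "U4 \<bullet> U4 = 1"
    "U1 \<bullet> U2 = 0" "U1 \<bullet> U3 = 0" "U1 \<bullet> U4 = 0" "U2 \<bullet> U3 = 0" "U2 \<bullet> U4 = 0" "U3 \<bullet> U4 = 0"
begin

lemma orthonormal_sym:
  "U2 \<bullet> U1 = 0" "U3 \<bullet> U1 = 0" "U4 \<bullet> U1 = 0" "U3 \<bullet> U2 = 0" "U4 \<bullet> U2 = 0" "U4 \<bullet> U3 = 0"
  using orthonormal by (simp_all add: inner_commute)

definition frame_map :: "real ^ 4 \<Rightarrow> real ^ 4" where
  "frame_map v = v $ 1 *\<^sub>R U1 + v $ 2 *\<^sub>R U2 + v $ 3 *\<^sub>R U3 + v $ 4 *\<^sub>R U4"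

lemma frame_map_inner [simp]:
  "frame_map v \<bullet> U1 = v $ 1" "frame_map v \<bullet> U2 = v $ 2" "frame_map v \<bullet> U3 = v $ 3" "frame_map v \<bullet> U4 = v $ 4"
  unfolding frame_map_def by (simp_all add: inner_add_left orthonormal orthonormal_sym)

lemma frame_map_orthogonal: "orthogonal_transformation frame_map"
proof -
  have "linear frame_map"
    unfolding frame_map_def by (intro linearI) (simp_all add: algebra_simps scaleR_add_left)
  moreover have "frame_map v \<bullet> frame_map w = v \<bullet> w" for v w
  proof -
    have "frame_map v \<bullet> frame_map w = frame_map v \<bullet> (w $ 1 *\<^sub>R U1 + w $ 2 *\<^sub>R U2 + w $ 3 *\<^sub>R U3 + w $ 4 *\<^sub>R U4)"
      unfolding frame_map_def[of w] ..
    also have "\<dots> = v $ 1 * w $ 1 + v $ 2 * w $ 2 + v $ 3 * w $ 3 + v $ 4 * w $ 4"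
      by (simp add: inner_add_right mult.commute)
    also have "\<dots> = v \<bullet> w" by (simp add: inner_vec_def sum_4)
    finally show ?thesis .
  qed
  ultimately show ?thesis unfolding orthogonal_transformation_def by blast
qed

lemma frame_expansion: "x = (x \<bullet> U1) *\<^sub>R U1 + (x \<bullet> U2) *\<^sub>R U2 + (x \<bullet> U3) *\<^sub>R U3 + (x \<bullet> U4) *\<^sub>R U4"
proof -
  obtain v where "x = frame_map v" using orthogonal_transformation_surj[OF frame_map_orthogonal] by blast
  then show ?thesis by (simp add: frame_map_def[symmetric])
qed

lemma frame_eqI:
  assumes "x \<bullet> U1 = y \<bullet> U1" "x \<bullet> U2 = y \<bullet> U2" "x \<bullet> U3 = y \<bullet> U3" "x \<bullet> U4 = y \<bullet> U4"
  shows "x = y"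
  using frame_expansion[of x] frame_expansion[of y] assms by simp

lemma frame_norm: "(norm x)\<^sup>2 = (x \<bullet> U1)\<^sup>2 + (x \<bullet> U2)\<^sup>2 + (x \<bullet> U3)\<^sup>2 + (x \<bullet> U4)\<^sup>2"
proof -
  have "x \<bullet> x = x \<bullet> ((x \<bullet> U1) *\<^sub>R U1 + (x \<bullet> U2) *\<^sub>R U2 + (x \<bullet> U3) *\<^sub>R U3 + (x \<bullet> U4) *\<^sub>R U4)"
    using frame_expansion[of x] by simp
  then show ?thesis unfolding power2_norm_eq_inner by (simp add: inner_add_right power2_eq_square)
qed

definition frame_coords :: "real \<times> real \<times> real \<times> real \<Rightarrow> real ^ 4" where
  "frame_coords r = frame_map (to_vec r)"

lemma frame_coords_image:
  "frame_coords ` A = {x. (x \<bullet> U4, x \<bullet> U3, x \<bullet> U1, x \<bullet> U2) \<in> A}"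
proof (intro set_eqI iffI)
  fix x assume "x \<in> frame_coords ` A"
  then obtain p q y z where "(p, q, y, z) \<in> A" "x = frame_map (to_vec (p, q, y, z))"
    unfolding frame_coords_def by auto
  then show "x \<in> {x. (x \<bullet> U4, x \<bullet> U3, x \<bullet> U1, x \<bullet> U2) \<in> A}" by simp
next
  fix x assume "x \<in> {x. (x \<bullet> U4, x \<bullet> U3, x \<bullet> U1, x \<bullet> U2) \<in> A}"
  moreover have "x = frame_coords (x \<bullet> U4, x \<bullet> U3, x \<bullet> U1, x \<bullet> U2)"
    unfolding frame_coords_def by (rule frame_eqI) simp_all
  ultimately show "x \<in> frame_coords ` A" by blast
qed

lemma frame_coords_measure:
  assumes A: "A \<in> sets borel" and fin: "emeasure lborel A < \<infinity>"
  shows "frame_coords ` A \<in> lmeasurable" "measure lebesgue (frame_coords ` A) = measure lborel A"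
proof -
  note 1 = emeasure_to_vec_image[OF A]
  have "to_vec ` A \<in> lmeasurable" using 1 fin by (simp add: fmeasurable_def)
  moreover have "measure lebesgue (to_vec ` A) = measure lborel A" using 1 by (simp add: measure_def)
  moreover have "frame_coords ` A = frame_map ` to_vec ` A" unfolding frame_coords_def by (simp add: image_image)
  ultimately show "frame_coords ` A \<in> lmeasurable" "measure lebesgue (frame_coords ` A) = measure lborel A"
    using measure_orthogonal_image4[OF frame_map_orthogonal] by auto
qed

end

section \<open>Decomposition of the cone over an antiprism\<close>

text \<open>The normal form of an antiprism, reached in \<open>antiprism_frame_exists\<close>:
  \<open>Q\<close> and \<open>T\<close> span the plane of the axis, \<open>T\<close> is its pole,
  and \<open>E1\<close> points from that plane towards the vertex with index 0.\<close>

locale antiprism_frame = orthonormal_frame E1 E2 Q T for E1 E2 Q T :: "real ^ 4" +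
  fixes n :: nat and r h w :: real
  assumes n: "2 \<le> n" and r: "0 < r" and h: "0 < h" and w: "0 < w"
    and unit: "r\<^sup>2 + h\<^sup>2 + w\<^sup>2 = 1"
begin

definition al where "al = pi / real n"
definition C where "C = cos al"
definition S where "S = sin al"
definition sg :: "int \<Rightarrow> real" where "sg k = (if even k then 1 else -1)"
text \<open>The minus sign puts \<open>v 0\<close> at height -1, where the model sector has its
  vertex.\<close>

definition v :: "int \<Rightarrow> real ^ 4" where
  "v k = (r * cos (of_int k * al)) *\<^sub>R E1 + (r * sin (of_int k * al)) *\<^sub>R E2 - (sg k * h) *\<^sub>R Q + w *\<^sub>R T"

text \<open>
  In the coordinates \<open>(xi k, eta k, mu k, nu k)\<close> the vertex \<open>v k\<close> is \<open>(1, 0, 1, 0)\<close> and its neighbours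
  \<open>v (k \<plusminus> 1)\<close> are \<open>(C, \<plusminus>S, 0, 1)\<close>; the lateral face opposite to the axis in the sector of \<open>v k\<close>
  lies on \<open>xi k = dd k\<close>.  Indices are integers so that \<open>k - 1\<close> makes sense.
\<close>

definition xi where "xi k x = (x \<bullet> E1 * cos (of_int k * al) + x \<bullet> E2 * sin (of_int k * al)) / r"
definition eta where "eta k x = (x \<bullet> E2 * cos (of_int k * al) - x \<bullet> E1 * sin (of_int k * al)) / r"
definition mu where "mu k x = (x \<bullet> T / w - sg k * (x \<bullet> Q) / h) / 2"
definition nu where "nu k x = (x \<bullet> T / w + sg k * (x \<bullet> Q) / h) / 2"
definition dd where "dd k x = mu k x + C * nu k x"

lemma al_bounds: "0 < al" "al \<le> pi / 2" "al < pi" and n_al: "real n * al = pi"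
  unfolding al_def using n by (auto simp: field_simps)

lemma C_bounds: "0 \<le> C" "C < 1" and S_pos: "0 < S" and S_sq: "S\<^sup>2 = 1 - C\<^sup>2"
proof -
  show "0 \<le> C" unfolding C_def using al_bounds by (intro cos_ge_zero) auto
  show "C < 1" unfolding C_def using cos_monotone_0_pi[of 0 al] al_bounds by simp
  show "0 < S" unfolding S_def using al_bounds by (intro sin_gt_zero) auto
  show "S\<^sup>2 = 1 - C\<^sup>2" unfolding S_def C_def by (simp add: sin_squared_eq)
qed

lemma sg_simps: "sg (k + 1) = - sg k" "sg (k - 1) = - sg k" "sg k * sg k = 1" "sg (k + 2 * j) = sg k"
  unfolding sg_def by auto

lemmas functional_defs = xi_def eta_def mu_def nu_def dd_def

lemma functional_add:
  "xi k (x + y) = xi k x + xi k y" "eta k (x + y) = eta k x + eta k y" "mu k (x + y) = mu k x + mu k y"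
  "nu k (x + y) = nu k x + nu k y" "dd k (x + y) = dd k x + dd k y"
  unfolding functional_defs by (simp_all add: inner_add_left add_divide_distrib diff_divide_distrib algebra_simps)

lemma functional_scale:
  "xi k (t *\<^sub>R x) = t * xi k x" "eta k (t *\<^sub>R x) = t * eta k x" "mu k (t *\<^sub>R x) = t * mu k x"
  "nu k (t *\<^sub>R x) = t * nu k x" "dd k (t *\<^sub>R x) = t * dd k x"
  unfolding functional_defs by (simp_all add: algebra_simps)

lemma functional_zero: "xi k 0 = 0" "eta k 0 = 0" "mu k 0 = 0" "nu k 0 = 0" "dd k 0 = 0"
  unfolding functional_defs by simp_all

lemma functional_sum: "xi k (sum g I) = (\<Sum>i\<in>I. xi k (g i))" "eta k (sum g I) = (\<Sum>i\<in>I. eta k (g i))"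
  "mu k (sum g I) = (\<Sum>i\<in>I. mu k (g i))" "nu k (sum g I) = (\<Sum>i\<in>I. nu k (g i))"
  by (induction I rule: infinite_finite_induct) (simp_all add: functional_add functional_zero)

lemma v_inner: "v k \<bullet> E1 = r * cos (of_int k * al)" "v k \<bullet> E2 = r * sin (of_int k * al)" "v k \<bullet> Q = - (sg k * h)" "v k \<bullet> T = w"
  unfolding v_def by (simp_all add: inner_add_left inner_diff_left orthonormal orthonormal_sym)

lemma functional_v: "xi k (v i) = cos (of_int (i - k) * al)" "eta k (v i) = sin (of_int (i - k) * al)"
  "mu k (v i) = (1 + sg k * sg i) / 2" "nu k (v i) = (1 - sg k * sg i) / 2"
proof -
  show "xi k (v i) = cos (of_int (i - k) * al)"
    unfolding xi_def v_inner using r by (simp add: left_diff_distrib cos_diff field_simps)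
  show "eta k (v i) = sin (of_int (i - k) * al)"
    unfolding eta_def v_inner using r by (simp add: left_diff_distrib sin_diff field_simps)
  show "mu k (v i) = (1 + sg k * sg i) / 2" "nu k (v i) = (1 - sg k * sg i) / 2"
    unfolding mu_def nu_def v_inner using h w by (simp_all add: field_simps)
qed

lemma dd_v: "dd k (v i) = (if even (i - k) then 1 else C)"
  unfolding dd_def functional_v sg_def by auto

lemma xi_eta_1:
  "xi (k + 1) x = C * xi k x + S * eta k x" "xi (k - 1) x = C * xi k x - S * eta k x"
proof -
  have 1: "of_int (k + 1) * al = of_int k * al + al" "of_int (k - 1) * al = of_int k * al - al" by (simp_all add: algebra_simps)
  show "xi (k + 1) x = C * xi k x + S * eta k x" "xi (k - 1) x = C * xi k x - S * eta k x"
    unfolding xi_def eta_def 1 cos_add sin_add cos_diff sin_diff C_def S_def using r by (simp_all add: field_simps)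
qed

lemma dd_1: "dd (k + 1) x = nu k x + C * mu k x" "dd (k - 1) x = nu k x + C * mu k x"
  unfolding dd_def mu_def nu_def sg_simps by simp_all

lemma cos_sin_period: "cos (of_int (k + 2 * int n * j) * al) = cos (of_int k * al)" "sin (of_int (k + 2 * int n * j) * al) = sin (of_int k * al)"
proof -
  have 1: "of_int (k + 2 * int n * j) * al = of_int k * al + 2 * pi * of_int j"
    using n_al by (simp add: algebra_simps)
  show "cos (of_int (k + 2 * int n * j) * al) = cos (of_int k * al)" "sin (of_int (k + 2 * int n * j) * al) = sin (of_int k * al)"
    unfolding 1 cos_add sin_add by (simp_all add: cos_int_2pin sin_int_2pin)
qed

lemma period_mod: "xi (k mod (2 * int n)) x = xi k x" "dd (k mod (2 * int n)) x = dd k x" "v (k mod (2 * int n)) = v k"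
proof -
  have k: "k = k mod (2 * int n) + 2 * int n * (k div (2 * int n))" by simp
  have s: "sg (k mod (2 * int n)) = sg k" unfolding sg_def by (metis dvd_mod_iff dvd_triv_left)
  have cs: "cos (of_int (k mod (2 * int n)) * al) = cos (of_int k * al)" "sin (of_int (k mod (2 * int n)) * al) = sin (of_int k * al)"
    using cos_sin_period[of "k mod (2 * int n)" "k div (2 * int n)"] by (simp_all flip: k)
  show "xi (k mod (2 * int n)) x = xi k x" "dd (k mod (2 * int n)) x = dd k x" "v (k mod (2 * int n)) = v k"
    unfolding functional_defs v_def s cs by simp_all
qed

text \<open>Among the odd multiples of \<open>al\<close> on the circle, \<open>al\<close> and its
  negative are nearest to 0. Reduction modulo \<open>2 * n\<close> and reflection at
  \<open>pi\<close> bring the argument to the range where the cosine decreases.\<close>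

lemma cos_odd_le: assumes "odd i" shows "cos (of_int i * al) \<le> C"
proof -
  define m where "m = i mod (2 * int n)"
  have m: "0 \<le> m" "m < 2 * int n" "odd m" unfolding m_def using n assms by (auto simp: dvd_mod_iff)
  have "i = m + 2 * int n * (i div (2 * int n))" unfolding m_def by simp
  then have c: "cos (of_int i * al) = cos (of_int m * al)" using cos_sin_period(1) by metis
  have m1: "1 \<le> m" "m \<le> 2 * int n - 1" using m by (auto simp: order_le_less)
  have le: "cos (of_int j * al) \<le> C" if "1 \<le> j" "j \<le> int n" for j :: int
  proof -
    have "al \<le> of_int j * al" using that al_bounds by simp
    moreover have "of_int j * al \<le> pi" using that al_bounds n_al by (metis mult_right_mono less_imp_le of_int_le_iff of_int_of_nat_eq)
    ultimately show ?thesis unfolding C_def using al_bounds by (intro cos_monotone_0_pi_le) auto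
  qed
  show ?thesis
  proof (cases "m \<le> int n")
    case True then show ?thesis using le m1 c by simp
  next
    case False
    have "of_int m * al = 2 * pi - of_int (2 * int n - m) * al" using n_al by (simp add: algebra_simps)
    then have "cos (of_int m * al) = cos (of_int (2 * int n - m) * al)" by (simp add: cos_diff)
    also have "\<dots> \<le> C" using False m1 by (intro le) auto
    finally show ?thesis using c by simp
  qed
qed

lemma cos_eq_1: assumes "cos (of_int i * al) = 1" shows "2 * int n dvd i"
proof -
  obtain t :: int where "of_int i * al = of_int t * 2 * pi" using assms cos_one_2pi_int by blast
  then have "of_int i * al = (of_int t * 2 * real n) * al" using n_al by simp
  then have "(of_int i :: real) = of_int (t * 2 * int n)" using al_bounds by simp
  then have "i = 2 * int n * t" by (metis mult.assoc mult.commute of_int_eq_iff)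
  then show ?thesis by simp
qed

text \<open>The hyperplane \<open>xi k = dd k\<close> through \<open>v (k - 1)\<close>,
  \<open>v k\<close>, \<open>v (k + 1)\<close> supports the cone. This is where the convex position
  of the vertices enters.\<close>

lemma xi_v_le: "xi k (v i) \<le> dd k (v i)"
  unfolding functional_v dd_v using cos_odd_le[of "i - k"] by auto

definition K where "K = convex_cone hull (range v)"

lemma K_halfspaces:
  assumes "x \<in> K"
  shows "xi k x \<le> dd k x" "0 \<le> mu k x" "0 \<le> nu k x"
proof -
  have "convex_cone {x. xi k x \<le> dd k x \<and> 0 \<le> mu k x \<and> 0 \<le> nu k x}" (is "convex_cone ?H")
    unfolding convex_cone_iff by (auto simp: functional_add functional_scale functional_zero mult_left_mono)
  moreover have "range v \<subseteq> ?H" using xi_v_le by (auto simp: functional_v sg_def)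
  ultimately have "K \<subseteq> ?H" unfolding K_def by (intro hull_minimal)
  then show "xi k x \<le> dd k x" "0 \<le> mu k x" "0 \<le> nu k x" using assms by auto
qed

lemma v_in_K: "v k \<in> K" unfolding K_def by (intro hull_inc) simp
lemma K_add: "x \<in> K \<Longrightarrow> y \<in> K \<Longrightarrow> x + y \<in> K" unfolding K_def by (rule convex_cone_hull_add)
lemma K_scale: "x \<in> K \<Longrightarrow> 0 \<le> t \<Longrightarrow> t *\<^sub>R x \<in> K" unfolding K_def by (rule convex_cone_hull_mul)

lemma functional_eqI:
  assumes "xi k x = xi k y" "eta k x = eta k y" "mu k x = mu k y" "nu k x = nu k y"
  shows "x = y"
proof (rule frame_eqI)
  have rot: "r * ((A * c + B * s) / r * c - (B * c - A * s) / r * s) = A * (c\<^sup>2 + s\<^sup>2)"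
    "r * ((A * c + B * s) / r * s + (B * c - A * s) / r * c) = B * (c\<^sup>2 + s\<^sup>2)" for A B c s :: real
    using r by (simp_all add: field_simps power2_eq_square)
  have e1: "z \<bullet> E1 = r * (xi k z * cos (of_int k * al) - eta k z * sin (of_int k * al))" for z
    unfolding xi_def eta_def rot by simp
  have e2: "z \<bullet> E2 = r * (xi k z * sin (of_int k * al) + eta k z * cos (of_int k * al))" for z
    unfolding xi_def eta_def rot by simp
  have q: "z \<bullet> Q = h * sg k * (nu k z - mu k z)" for z
    unfolding mu_def nu_def using h by (simp add: field_simps sg_simps)
  have t: "z \<bullet> T = w * (mu k z + nu k z)" for z
    unfolding mu_def nu_def using w by (simp add: field_simps)
  show "x \<bullet> E1 = y \<bullet> E1" "x \<bullet> E2 = y \<bullet> E2" "x \<bullet> Q = y \<bullet> Q" "x \<bullet> T = y \<bullet> T"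
    unfolding e1 e2 q t assms by simp_all
qed

text \<open>The centre of the base containing \<open>v k\<close>, or the midpoint of the edge if
  \<open>n = 2\<close>. The two centres span the axis side of every sector.\<close>

definition axis_pt where "axis_pt k = (1 / real n) *\<^sub>R (\<Sum>j<n. v (k + 2 * int j))"

lemma axis_pt_in_K: "axis_pt k \<in> K"
proof -
  have "(\<Sum>j<m. v (k + 2 * int j)) \<in> K" for m
  proof (induction m)
    case 0 then show ?case unfolding K_def by (simp add: convex_cone_hull_contains_0)
  next
    case (Suc m) then show ?case by (simp add: K_add v_in_K)
  qed
  then show ?thesis unfolding axis_pt_def by (intro K_scale) auto
qed

lemma functional_axis_pt:
  "xi i (axis_pt k) = 0" "eta i (axis_pt k) = 0" "mu i (axis_pt k) = (1 + sg i * sg k) / 2" "nu i (axis_pt k) = (1 - sg i * sg k) / 2"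
proof -
  define b where "b = of_int (k - i) * al"
  have arg: "of_int (k + 2 * int j - i) * al = b + 2 * real j * al" for j unfolding b_def by (simp add: algebra_simps)
  have last_arg: "b + (2 * real n - 1) * al = b - al + 2 * pi"
    using n_al by (simp add: left_diff_distrib mult.assoc)
  \<comment> \<open>Multiplication by \<open>2 * sin al\<close> makes the sum telescope; after
    \<open>n\<close> steps of \<open>2 * al\<close> the argument has made a full turn.\<close>
  have "2 * S * (\<Sum>j<m. cos (b + 2 * real j * al)) = sin (b + (2 * real m - 1) * al) - sin (b - al)" for m
  proof (induction m)
    case (Suc m)
    have "2 * S * cos (b + 2 * real m * al) = sin (b + (2 * real m + 1) * al) - sin (b + (2 * real m - 1) * al)"
    proof -
      have "b + (2 * real m + 1) * al = (b + 2 * real m * al) + al" "b + (2 * real m - 1) * al = (b + 2 * real m * al) - al"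
        by (simp_all add: algebra_simps)
      then show ?thesis
        by (simp only: sin_add[of "b + 2 * real m * al" al] sin_diff[of "b + 2 * real m * al" al] S_def) simp
    qed
    then show ?case using Suc by (simp add: algebra_simps)
  qed simp
  from this[of n] have "2 * S * (\<Sum>j<n. cos (b + 2 * real j * al)) = sin (b - al + 2 * pi) - sin (b - al)"
    unfolding last_arg .
  then have c0: "(\<Sum>j<n. cos (b + 2 * real j * al)) = 0" using S_pos by simp
  have "2 * S * (\<Sum>j<m. sin (b + 2 * real j * al)) = cos (b - al) - cos (b + (2 * real m - 1) * al)" for m
  proof (induction m)
    case (Suc m)
    have "2 * S * sin (b + 2 * real m * al) = cos (b + (2 * real m - 1) * al) - cos (b + (2 * real m + 1) * al)"
    proof -
      have "b + (2 * real m + 1) * al = (b + 2 * real m * al) + al" "b + (2 * real m - 1) * al = (b + 2 * real m * al) - al"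
        by (simp_all add: algebra_simps)
      then show ?thesis
        by (simp only: cos_add[of "b + 2 * real m * al" al] cos_diff[of "b + 2 * real m * al" al] S_def) simp
    qed
    then show ?case using Suc by (simp add: algebra_simps)
  qed simp
  from this[of n] have "2 * S * (\<Sum>j<n. sin (b + 2 * real j * al)) = cos (b - al) - cos (b - al + 2 * pi)"
    unfolding last_arg .
  then have s0: "(\<Sum>j<n. sin (b + 2 * real j * al)) = 0" using S_pos by simp
  show "xi i (axis_pt k) = 0" unfolding axis_pt_def functional_scale functional_sum functional_v arg c0 by simp
  show "eta i (axis_pt k) = 0" unfolding axis_pt_def functional_scale functional_sum functional_v arg s0 by simp
  show "mu i (axis_pt k) = (1 + sg i * sg k) / 2" "nu i (axis_pt k) = (1 - sg i * sg k) / 2"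
    unfolding axis_pt_def functional_scale functional_sum functional_v sg_simps using n by simp_all
qed

text \<open>In each slice a triangle with apex on the axis, altitude \<open>dd k\<close> and half
  base \<open>S * nu k\<close>. The outer face is included, but the walls are excluded to make the
  sectors disjoint.\<close>

definition open_sector :: "int \<Rightarrow> (real ^ 4) set" where
  "open_sector k = {x. 0 < mu k x \<and> 0 < nu k x \<and> xi k x \<le> dd k x \<and> \<bar>eta k x\<bar> * dd k x < xi k x * (S * nu k x)}"

lemma dd_pos: "0 < mu k x \<Longrightarrow> 0 < nu k x \<Longrightarrow> 0 < dd k x"
  unfolding dd_def using C_bounds by (intro add_pos_nonneg) auto

text \<open>Projecting \<open>x\<close> from the axis, within its slice, onto the lateral face gives
  a positive combination of three vertices; \<open>t\<close> is the fraction of the way from the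
  axis to that face. Strictness on the walls makes all three coefficients positive.\<close>

lemma open_sector_representation:
  assumes x: "x \<in> open_sector k"
  obtains t a b c where "0 < t" "t \<le> 1" "t = xi k x / dd k x" "0 < a" "0 < b" "0 < c"
    "a = mu k x" "b + c = nu k x"
    "x = t *\<^sub>R (a *\<^sub>R v k + b *\<^sub>R v (k + 1) + c *\<^sub>R v (k - 1)) + (1 - t) *\<^sub>R (mu k x *\<^sub>R axis_pt k + nu k x *\<^sub>R axis_pt (k + 1))"
proof -
  have m: "0 < mu k x" and n': "0 < nu k x" and le: "xi k x \<le> dd k x" and lt: "\<bar>eta k x\<bar> * dd k x < xi k x * (S * nu k x)"
    using x unfolding open_sector_def by auto
  have d: "0 < dd k x" using dd_pos m n' by blast
  have "0 \<le> \<bar>eta k x\<bar> * dd k x" using d by simp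
  then have "0 < xi k x * (S * nu k x)" using lt by linarith
  then have X: "0 < xi k x" by (rule zero_less_mult_pos2) (use S_pos n' in simp)
  define t where "t = xi k x / dd k x"
  have t: "0 < t" "t \<le> 1" "xi k x = t * dd k x" unfolding t_def using X d le by auto
  \<comment> \<open>The difference of the coefficients of \<open>v (k + 1)\<close> and
    \<open>v (k - 1)\<close>, forced by \<open>eta k\<close>; their sum is forced by
    \<open>nu k\<close>.\<close>
  define e where "e = eta k x / (t * S)"
  have e: "eta k x = t * S * e" unfolding e_def using t S_pos by simp
  have "\<bar>e\<bar> < nu k x"
  proof -
    have "t * S * dd k x * \<bar>e\<bar> < t * S * dd k x * nu k x"
      using lt unfolding e t(3) using t S_pos by (simp add: abs_mult mult_ac)
    moreover have "0 < t * S * dd k x" using t(1) S_pos d by simp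
    ultimately show ?thesis by (rule mult_less_cancel_left_pos[THEN iffD1, rotated])
  qed
  then have bc: "0 < (nu k x + e) / 2" "0 < (nu k x - e) / 2" by auto
  have sk: "of_int (k - 1 - k) * al = - al" "of_int (k + 1 - k) * al = al" "of_int (k - k) * al = 0" by simp_all
  have "x = t *\<^sub>R (mu k x *\<^sub>R v k + ((nu k x + e) / 2) *\<^sub>R v (k + 1) + ((nu k x - e) / 2) *\<^sub>R v (k - 1))
    + (1 - t) *\<^sub>R (mu k x *\<^sub>R axis_pt k + nu k x *\<^sub>R axis_pt (k + 1))" (is "x = ?y")
  proof (rule functional_eqI[of k])
    show "xi k x = xi k ?y" unfolding functional_add functional_scale functional_v functional_axis_pt sk t(3)
      unfolding cos_minus C_def[symmetric] dd_def by (simp add: field_simps)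
    show "eta k x = eta k ?y" unfolding functional_add functional_scale functional_v functional_axis_pt sk e
      unfolding sin_minus S_def[symmetric] by (simp add: field_simps)
    show "mu k x = mu k ?y" "nu k x = nu k ?y" unfolding functional_add functional_scale functional_v functional_axis_pt sg_simps
      by (simp_all add: sg_simps field_simps)
  qed
  with that[of t "mu k x" "(nu k x + e) / 2" "(nu k x - e) / 2"] t bc m show thesis unfolding t_def by (simp add: field_simps)
qed

lemma open_sector_subset_K: "open_sector k \<subseteq> K"
proof
  fix x assume x: "x \<in> open_sector k"
  then have "0 < mu k x" "0 < nu k x" unfolding open_sector_def by auto
  moreover from x obtain t a b c where "0 < t" "t \<le> 1" "0 < a" "0 < b" "0 < c"
    "x = t *\<^sub>R (a *\<^sub>R v k + b *\<^sub>R v (k + 1) + c *\<^sub>R v (k - 1)) + (1 - t) *\<^sub>R (mu k x *\<^sub>R axis_pt k + nu k x *\<^sub>R axis_pt (k + 1))"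
    by (rule open_sector_representation)
  ultimately show "x \<in> K"
    by (metis K_add K_scale v_in_K axis_pt_in_K diff_ge_0_iff_ge less_imp_le)
qed

text \<open>
  Thus \<open>open_sector k\<close> is contained in the region where \<open>xi k / dd k\<close> is the gauge of the horizontal
  slice; equality for two indices would force the generators of one lateral face onto another one.
\<close>

lemma open_sector_ratio:
  assumes x: "x \<in> open_sector k" and j: "0 < mu j x" "0 < nu j x"
  shows "xi j x / dd j x \<le> xi k x / dd k x"
    "xi j x / dd j x = xi k x / dd k x \<Longrightarrow> 2 * int n dvd j - k"
proof -
  from x obtain t a b c where t: "0 < t" "t \<le> 1" "t = xi k x / dd k x" and abc: "0 < a" "0 < b" "0 < c" "a = mu k x" "b + c = nu k x"
    and eq: "x = t *\<^sub>R (a *\<^sub>R v k + b *\<^sub>R v (k + 1) + c *\<^sub>R v (k - 1)) + (1 - t) *\<^sub>R (mu k x *\<^sub>R axis_pt k + nu k x *\<^sub>R axis_pt (k + 1))" (is "x = t *\<^sub>R ?y + _")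
    by (rule open_sector_representation)
  have d: "0 < dd j x" using dd_pos j by blast
  have "mu j ?y = mu j x" "nu j ?y = nu j x"
  proof -
    have "mu j ?y = mu k x * ((1 + sg j * sg k) / 2) + nu k x * ((1 - sg j * sg k) / 2)"
      unfolding functional_add functional_scale functional_v sg_simps using abc(4,5) by (simp add: field_simps flip: abc(5))
    also have "\<dots> = mu j x" unfolding mu_def nu_def by (simp add: field_simps sg_def)
    finally show "mu j ?y = mu j x" .
    have "nu j ?y = mu k x * ((1 - sg j * sg k) / 2) + nu k x * ((1 + sg j * sg k) / 2)"
      unfolding functional_add functional_scale functional_v sg_simps using abc(4,5) by (simp add: field_simps flip: abc(5))
    also have "\<dots> = nu j x" unfolding mu_def nu_def by (simp add: field_simps sg_def)
    finally show "nu j ?y = nu j x" .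
  qed
  then have dy: "dd j ?y = dd j x" unfolding dd_def by simp
  have xy: "xi j x = t * xi j ?y"
    by (subst eq) (simp only: functional_add functional_scale functional_axis_pt, simp)
  \<comment> \<open>The slack of a vertex in the inequality of face \<open>j\<close>. As
    \<open>?y\<close> is a positive combination, equality for \<open>?y\<close> forces equality at
    all three vertices.\<close>
  define g where "g i = dd j (v i) - xi j (v i)" for i
  have g: "0 \<le> g i" for i unfolding g_def using xi_v_le by simp
  have gy: "dd j ?y - xi j ?y = a * g k + b * g (k + 1) + c * g (k - 1)"
    unfolding g_def functional_add functional_scale by (simp add: algebra_simps)
  have "0 \<le> dd j ?y - xi j ?y" unfolding gy using abc g by (intro add_nonneg_nonneg mult_nonneg_nonneg) auto
  then have "xi j x \<le> t * dd j x" unfolding xy dy[symmetric] using t(1) by (intro mult_left_mono) auto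
  then show "xi j x / dd j x \<le> xi k x / dd k x" using d t(3) by (simp add: divide_le_eq)
  assume "xi j x / dd j x = xi k x / dd k x"
  then have "xi j x = t * dd j x" using d t(3) by (simp add: field_simps)
  then have "dd j ?y - xi j ?y = 0" unfolding xy dy[symmetric] using t(1) by simp
  then have "a * g k + b * g (k + 1) + c * g (k - 1) = 0" using gy by simp
  moreover have "0 \<le> a * g k" "0 \<le> b * g (k + 1)" "0 \<le> c * g (k - 1)" using abc g by auto
  ultimately have "a * g k = 0" "b * g (k + 1) = 0" "c * g (k - 1) = 0" by linarith+
  then have g0: "g k = 0" "g (k + 1) = 0" "g (k - 1) = 0" using abc by auto
  show "2 * int n dvd j - k"
  proof (cases "even (k - j)")
    case True
    then have "cos (of_int (k - j) * al) = 1" using g0(1) unfolding g_def dd_v functional_v by simp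
    then have "2 * int n dvd k - j" by (rule cos_eq_1)
    then show ?thesis by (metis dvd_minus_iff minus_diff_eq)
  next
    \<comment> \<open>Now \<open>v (k + 1)\<close> and \<open>v (k - 1)\<close> have the parity of
      \<open>j\<close>, so zero slack would identify both with \<open>v j\<close>; distinct residues
      modulo \<open>2 * n\<close> exclude this.\<close>
    case False
    then have "even (k + 1 - j)" "even (k - 1 - j)" by auto
    then have "cos (of_int (k + 1 - j) * al) = 1" "cos (of_int (k - 1 - j) * al) = 1"
      using g0(2,3) unfolding g_def dd_v functional_v by (simp_all del: of_int_diff of_int_add)
    then have "2 * int n dvd k + 1 - j" "2 * int n dvd k - 1 - j" using cos_eq_1 by blast+
    then have "2 * int n dvd (k + 1 - j) - (k - 1 - j)" by (rule dvd_diff)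
    then have "2 * int n dvd 2" by simp
    then have "2 * int n \<le> 2" by (rule zdvd_imp_le) simp
    then show ?thesis using n by simp
  qed
qed

lemma mu_nu_pos_transfer: assumes "0 < mu k x" "0 < nu k x" shows "0 < mu j x" "0 < nu j x"
  using assms unfolding mu_def nu_def sg_def by (auto split: if_splits)

text \<open>For a common point, comparing the ratios in both directions gives equality, which makes
  the two indices congruent modulo \<open>2 * n\<close>.\<close>

lemma open_sector_disjoint:
  assumes "k \<in> {0..<2 * int n}" "j \<in> {0..<2 * int n}" "k \<noteq> j"
  shows "open_sector k \<inter> open_sector j = {}"
proof (rule ccontr)
  assume "open_sector k \<inter> open_sector j \<noteq> {}"
  then obtain x where x: "x \<in> open_sector k" "x \<in> open_sector j" by auto
  then have p: "0 < mu k x" "0 < nu k x" "0 < mu j x" "0 < nu j x" unfolding open_sector_def by auto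
  have "xi j x / dd j x = xi k x / dd k x"
    using open_sector_ratio(1)[OF x(1) p(3,4)] open_sector_ratio(1)[OF x(2) p(1,2)] by simp
  then have dv: "2 * int n dvd j - k" by (rule open_sector_ratio(2)[OF x(1) p(3,4)])
  have "\<bar>j - k\<bar> < 2 * int n" using assms by auto
  then show False using dv assms(3) by (metis dvd_imp_le_int eq_iff_diff_eq_0 abs_of_nonneg not_less mult_nonneg_nonneg of_nat_0_le_iff zero_le_numeral)
qed

text \<open>The index is chosen to maximise \<open>xi k x / dd k x\<close>, the gauge of the slice.
  Comparison with the two neighbours alone gives the two wall inequalities of its sector.\<close>

lemma K_cover:
  assumes x: "x \<in> K" and pos: "0 < mu 0 x" "0 < nu 0 x"
  obtains k where "k \<in> {0..<2 * int n}" "x \<in> open_sector k \<or> (0 < dd k x \<and> \<bar>eta k x\<bar> * dd k x = xi k x * (S * nu k x))"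
proof -
  note p = mu_nu_pos_transfer[OF pos]
  have d: "0 < dd k x" for k using dd_pos p by blast
  define f where "f k = xi k x / dd k x" for k
  have fin: "finite (f ` {0..<2 * int n})" "f ` {0..<2 * int n} \<noteq> {}" using n by auto
  from Max_in[OF this] obtain k where k: "k \<in> {0..<2 * int n}" "f k = Max (f ` {0..<2 * int n})" by auto
  have fk: "f j \<le> f k" for j
  proof -
    have "f j = f (j mod (2 * int n))" unfolding f_def period_mod ..
    also have "\<dots> \<le> f k" unfolding k(2) using n by (intro Max_ge fin) auto
    finally show ?thesis .
  qed
  have m: "0 < nu k x + C * mu k x" using d[of "k + 1"] unfolding dd_1 .
  have S2: "S * S = 1 - C * C" using S_sq by (simp add: power2_eq_square)
  \<comment> \<open>After cross-multiplication the terms with \<open>mu k x\<close> cancel, and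
    \<open>1 - C * C = S * S\<close> leaves a common factor \<open>S\<close>. With \<open>e\<close>
    equal to \<open>eta k x\<close> or its negative this handles both neighbours.\<close>
  have key: "e * dd k x \<le> xi k x * (S * nu k x)" if "(C * xi k x + S * e) / (nu k x + C * mu k x) \<le> xi k x / dd k x" for e
  proof -
    have "(C * xi k x + S * e) * dd k x \<le> xi k x * (nu k x + C * mu k x)"
      using that m d[of k] by (simp add: divide_simps mult_ac)
    then have "S * (e * dd k x) \<le> xi k x * (nu k x + C * mu k x) - C * xi k x * dd k x" by (simp add: algebra_simps)
    also have "\<dots> = xi k x * nu k x * (1 - C * C)" unfolding dd_def by (simp add: algebra_simps)
    also have "\<dots> = S * (xi k x * (S * nu k x))" unfolding S2[symmetric] by (simp add: algebra_simps)
    finally show ?thesis using S_pos by simp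
  qed
  have "eta k x * dd k x \<le> xi k x * (S * nu k x)"
    using fk[of "k + 1"] unfolding f_def xi_eta_1 dd_1 by (rule key)
  moreover have "- eta k x * dd k x \<le> xi k x * (S * nu k x)"
    using fk[of "k - 1"] unfolding f_def xi_eta_1 dd_1 by (intro key) simp
  ultimately have "\<bar>eta k x\<bar> * dd k x \<le> xi k x * (S * nu k x)" by (auto simp: abs_if)
  then have "x \<in> open_sector k \<or> (0 < dd k x \<and> \<bar>eta k x\<bar> * dd k x = xi k x * (S * nu k x))"
    unfolding open_sector_def using p d K_halfspaces[OF x] by auto
  then show thesis using that k by blast
qed


text \<open>At \<open>z = (nu - mu) / (nu + mu)\<close> the altitude \<open>dd / (mu + nu)\<close>
  equals \<open>(1 - z) / 2 + C * (1 + z) / 2\<close>. This is \<open>d z\<close> for the first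
  parameter \<open>(1 + C) / 2\<close>.\<close>

sublocale profile: antiprism_profile "(1 + C) / 2" S r "sqrt (h\<^sup>2 + w\<^sup>2)"
proof
  show "1 / 2 \<le> (1 + C) / 2" "(1 + C) / 2 < 1" "0 < S" "0 < r" using C_bounds S_pos r by auto
  show "S\<^sup>2 = 4 * ((1 + C) / 2) * (1 - (1 + C) / 2)" unfolding S_sq by (simp add: power2_eq_square field_simps)
  have "0 < h\<^sup>2 + w\<^sup>2" using h by (intro add_pos_nonneg) auto
  then show "0 < sqrt (h\<^sup>2 + w\<^sup>2)" "r\<^sup>2 + (sqrt (h\<^sup>2 + w\<^sup>2))\<^sup>2 = 1" using unit by auto
qed

definition tilt where "tilt = arctan (h / w)"

lemma tilt_bounds: "0 < tilt" "tilt < pi / 2"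
  unfolding tilt_def using h w arctan_ubound by (auto simp: zero_less_arctan_iff)

lemma profile_tilt: "profile.h tilt = h" "profile.w tilt = w"
proof -
  have p: "0 < h\<^sup>2 + w\<^sup>2" using h by (intro add_pos_nonneg) auto
  have "1 + (h / w)\<^sup>2 = (h\<^sup>2 + w\<^sup>2) / w\<^sup>2" using w by (simp add: field_simps)
  then have s: "sqrt (1 + (h / w)\<^sup>2) = sqrt (h\<^sup>2 + w\<^sup>2) / w" using w by (simp add: real_sqrt_divide)
  show "profile.h tilt = h" "profile.w tilt = w"
    unfolding profile.h_def profile.w_def tilt_def sin_arctan cos_arctan s using p w by simp_all
qed

definition V where "V = profile.V tilt"

lemma emeasure_profile_sector: "emeasure lborel (profile.sector tilt) = ennreal (V / 4)"
  unfolding V_def using tilt_bounds by (intro profile.emeasure_sector) (simp_all add: profile_tilt h w)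

lemma V_nonneg: "0 \<le> V"
proof -
  have "0 \<le> profile.J tilt z" if "z \<in> {-1..1}" for z
    using that h w by (intro profile.J_nonneg) (auto simp: profile_tilt)
  then show ?thesis unfolding V_def profile.V_def by (intro integral_nonneg) (auto intro!: integrable_continuous_interval profile.J_continuous tilt_bounds less_imp_le)
qed

text \<open>The frame adapted to vertex \<open>k\<close>, turned by \<open>k * al\<close> and
  reflected for odd \<open>k\<close>. In it every sector has the same coordinate description, hence
  the same measure.\<close>

lemma rotated_frame:
  "orthonormal_frame (cos (of_int k * al) *\<^sub>R E1 + sin (of_int k * al) *\<^sub>R E2)
     (- sin (of_int k * al) *\<^sub>R E1 + cos (of_int k * al) *\<^sub>R E2) (sg k *\<^sub>R Q) T"
proof -
  have "sin (of_int k * al) * sin (of_int k * al) + cos (of_int k * al) * cos (of_int k * al) = 1"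
    using sin_cos_squared_add[of "of_int k * al"] by (simp add: power2_eq_square)
  then show ?thesis
    by unfold_locales (auto simp: inner_add_left inner_add_right orthonormal orthonormal_sym sg_def algebra_simps)
qed

lemma rotated_coords:
  "x \<bullet> (cos (of_int k * al) *\<^sub>R E1 + sin (of_int k * al) *\<^sub>R E2) = r * xi k x"
  "x \<bullet> (- sin (of_int k * al) *\<^sub>R E1 + cos (of_int k * al) *\<^sub>R E2) = r * eta k x"
  "x \<bullet> (sg k *\<^sub>R Q) = h * (nu k x - mu k x)" "x \<bullet> T = w * (mu k x + nu k x)"
  using r h w unfolding functional_defs by (simp_all add: inner_add_right inner_diff_right field_simps)

lemma open_sector_measure:
  "open_sector k \<inter> cball 0 1 \<in> lmeasurable" "measure lebesgue (open_sector k \<inter> cball 0 1) = V / 4"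
proof -
  interpret fk: orthonormal_frame "cos (of_int k * al) *\<^sub>R E1 + sin (of_int k * al) *\<^sub>R E2"
     "- sin (of_int k * al) *\<^sub>R E1 + cos (of_int k * al) *\<^sub>R E2" "sg k *\<^sub>R Q" T
    by (rule rotated_frame)
  have "(w * (mu k x + nu k x), h * (nu k x - mu k x), r * xi k x, r * eta k x) \<in> profile.sector tilt
     \<longleftrightarrow> x \<in> open_sector k \<inter> cball 0 1" for x
  proof -
    have nrm: "(w * (mu k x + nu k x))\<^sup>2 + (h * (nu k x - mu k x))\<^sup>2 + (r * xi k x)\<^sup>2 + (r * eta k x)\<^sup>2 \<le> 1 \<longleftrightarrow> x \<in> cball 0 1"
    proof -
      have "(w * (mu k x + nu k x))\<^sup>2 + (h * (nu k x - mu k x))\<^sup>2 + (r * xi k x)\<^sup>2 + (r * eta k x)\<^sup>2 = (norm x)\<^sup>2"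
        unfolding fk.frame_norm rotated_coords[of x k] by simp
      then show ?thesis by (simp add: power_le_one_iff abs_square_le_1)
    qed
    have 1: "(1 + C) / 2 * (w * (mu k x + nu k x) / w) + ((1 + C) / 2 - 1) * (h * (nu k x - mu k x) / h) = dd k x"
      unfolding dd_def using h w by (simp add: field_simps)
    have 2: "S * (w * (mu k x + nu k x) / w + h * (nu k x - mu k x) / h) / 2 = S * nu k x" using h w by (simp add: field_simps)
    have 3: "\<bar>h * (nu k x - mu k x)\<bar> / h < w * (mu k x + nu k x) / w \<longleftrightarrow> 0 < mu k x \<and> 0 < nu k x"
    proof -
      have "\<bar>h * (nu k x - mu k x)\<bar> / h = \<bar>nu k x - mu k x\<bar>" using h by (simp add: abs_mult)
      moreover have "w * (mu k x + nu k x) / w = mu k x + nu k x" using w by simp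
      ultimately show ?thesis by (simp only:) arith
    qed
    have 4: "\<bar>r * eta k x\<bar> * dd k x < r * xi k x * (S * nu k x) \<longleftrightarrow> \<bar>eta k x\<bar> * dd k x < xi k x * (S * nu k x)"
    proof -
      have e: "\<bar>r * eta k x\<bar> = r * \<bar>eta k x\<bar>" using r by (simp add: abs_mult)
      show ?thesis unfolding e using r by (simp add: mult.assoc)
    qed
    have 5: "0 < w * (mu k x + nu k x)" if "0 < mu k x" "0 < nu k x" using that w by simp
    have 6: "0 < r * xi k x" if "0 < mu k x" "0 < nu k x" "\<bar>eta k x\<bar> * dd k x < xi k x * (S * nu k x)"
    proof -
      have "0 \<le> \<bar>eta k x\<bar> * dd k x" using dd_pos that by (simp add: less_imp_le)
      then have "0 < xi k x * (S * nu k x)" using that by linarith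
      then have "0 < xi k x" by (rule zero_less_mult_pos2) (use S_pos that in simp)
      then show ?thesis using r by simp
    qed
    show ?thesis
      unfolding profile.sector_def mem_Collect_eq prod.case profile_tilt 1 2 3 4 nrm open_sector_def
      using 5 6 r by auto
  qed
  then have im: "open_sector k \<inter> cball 0 1 = fk.frame_coords ` profile.sector tilt"
    unfolding fk.frame_coords_image rotated_coords(1-3) rotated_coords(4)[of _ k] by blast
  have fin: "emeasure lborel (profile.sector tilt) < \<infinity>" unfolding emeasure_profile_sector by simp
  note fk.frame_coords_measure[OF profile.sector_measurable fin, folded im]
  moreover have "measure lborel (profile.sector tilt) = V / 4"
    unfolding measure_def emeasure_profile_sector using V_nonneg by simp
  ultimately show "open_sector k \<inter> cball 0 1 \<in> lmeasurable" "measure lebesgue (open_sector k \<inter> cball 0 1) = V / 4"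
    by simp_all
qed

lemma sector_wall_negligible:
  "negligible {x. 0 < dd k x \<and> \<bar>eta k x\<bar> * dd k x = xi k x * (S * nu k x)}" (is "negligible ?Z")
proof -
  interpret fk: orthonormal_frame "cos (of_int k * al) *\<^sub>R E1 + sin (of_int k * al) *\<^sub>R E2"
     "- sin (of_int k * al) *\<^sub>R E1 + cos (of_int k * al) *\<^sub>R E2" "sg k *\<^sub>R Q" T
    by (rule rotated_frame)
  have "(w * (mu k x + nu k x), h * (nu k x - mu k x), r * xi k x, r * eta k x) \<in> profile.sector_wall tilt \<longleftrightarrow> x \<in> ?Z" for x
  proof -
    have 1: "(1 + C) / 2 * (w * (mu k x + nu k x) / w) + ((1 + C) / 2 - 1) * (h * (nu k x - mu k x) / h) = dd k x"
      unfolding dd_def using h w by (simp add: field_simps)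
    have 2: "S * (w * (mu k x + nu k x) / w + h * (nu k x - mu k x) / h) / 2 = S * nu k x" using h w by (simp add: field_simps)
    have 4: "\<bar>r * eta k x\<bar> * dd k x = r * xi k x * (S * nu k x) \<longleftrightarrow> \<bar>eta k x\<bar> * dd k x = xi k x * (S * nu k x)"
    proof -
      have e: "\<bar>r * eta k x\<bar> = r * \<bar>eta k x\<bar>" using r by (simp add: abs_mult)
      show ?thesis unfolding e using r by (simp add: mult.assoc)
    qed
    show ?thesis unfolding profile.sector_wall_def mem_Collect_eq prod.case profile_tilt 1 2 4 by simp
  qed
  then have im: "?Z = fk.frame_coords ` profile.sector_wall tilt"
    unfolding fk.frame_coords_image rotated_coords(1-3) rotated_coords(4)[of _ k] by blast
  have fin: "emeasure lborel (profile.sector_wall tilt) < \<infinity>" unfolding profile.sector_wall_null by simp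
  note fk.frame_coords_measure[OF profile.sector_wall_measurable fin, folded im]
  moreover have "measure lborel (profile.sector_wall tilt) = 0" unfolding measure_def profile.sector_wall_null by simp
  ultimately show ?thesis by (simp add: negligible_iff_measure)
qed

lemma measure_K_ball:
  "measure lebesgue (K \<inter> cball 0 1) = 2 * real n * (V / 4)"
proof -
  let ?I = "{0..<2 * int n}" and ?W = "\<lambda>k. open_sector k \<inter> cball 0 1"
  let ?Z = "\<lambda>k. {x. 0 < dd k x \<and> \<bar>eta k x\<bar> * dd k x = xi k x * (S * nu k x)}"
  \<comment> \<open>Besides the walls, the exceptional set consists of the hyperplanes
    \<open>mu 0 = 0\<close> and \<open>nu 0 = 0\<close>, which carry the two bases.\<close>
  define N where "N = (\<Union>k\<in>?I. ?Z k) \<union> {x. ((1 / w) *\<^sub>R T - (1 / h) *\<^sub>R Q) \<bullet> x = 0} \<union> {x. ((1 / w) *\<^sub>R T + (1 / h) *\<^sub>R Q) \<bullet> x = 0}"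
  have nz: "(1 / w) *\<^sub>R T - (1 / h) *\<^sub>R Q \<noteq> 0" "(1 / w) *\<^sub>R T + (1 / h) *\<^sub>R Q \<noteq> 0"
  proof -
    have "((1 / w) *\<^sub>R T - (1 / h) *\<^sub>R Q) \<bullet> T = 1 / w" "((1 / w) *\<^sub>R T + (1 / h) *\<^sub>R Q) \<bullet> T = 1 / w"
      by (simp_all add: inner_diff_left inner_add_left orthonormal)
    then show "(1 / w) *\<^sub>R T - (1 / h) *\<^sub>R Q \<noteq> 0" "(1 / w) *\<^sub>R T + (1 / h) *\<^sub>R Q \<noteq> 0"
      using w by (metis inner_zero_left divide_eq_0_iff less_irrefl one_neq_zero)+
  qed
  have "negligible N" unfolding N_def
    using sector_wall_negligible nz by (intro negligible_Un negligible_Union negligible_hyperplane) auto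
  have sub: "(\<Union>k\<in>?I. ?W k) \<subseteq> K \<inter> cball 0 1" using open_sector_subset_K by auto
  have diff: "(K \<inter> cball 0 1) - (\<Union>k\<in>?I. ?W k) \<subseteq> N"
  proof
    fix x assume x: "x \<in> (K \<inter> cball 0 1) - (\<Union>k\<in>?I. ?W k)"
    then have xK: "x \<in> K" by simp
    show "x \<in> N"
    proof (cases "0 < mu 0 x \<and> 0 < nu 0 x")
      case True
      with K_cover[OF xK] obtain k where k: "k \<in> ?I" "x \<in> open_sector k \<or> x \<in> ?Z k" by blast
      with x have "x \<in> ?Z k" by blast
      with k(1) show ?thesis unfolding N_def by blast
    next
      case False
      then have "mu 0 x = 0 \<or> nu 0 x = 0" using K_halfspaces[OF xK] by (meson antisym_conv2 not_less)
      moreover have "((1 / w) *\<^sub>R T - (1 / h) *\<^sub>R Q) \<bullet> x = 2 * mu 0 x" "((1 / w) *\<^sub>R T + (1 / h) *\<^sub>R Q) \<bullet> x = 2 * nu 0 x"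
        unfolding mu_def nu_def sg_def
        by (simp_all add: inner_diff_left inner_add_left inner_commute[of x] field_simps)
      ultimately show ?thesis unfolding N_def by auto
    qed
  qed
  have W: "(\<Union>k\<in>?I. ?W k) \<in> lmeasurable"
    using open_sector_measure by (intro fmeasurable.finite_UN) auto
  have "measure lebesgue (K \<inter> cball 0 1) = measure lebesgue (\<Union>k\<in>?I. ?W k)"
  proof (rule measure_negligible_symdiff)
    show "(\<Union>k\<in>?I. ?W k) \<in> lmeasurable" by (rule W)
    show "negligible ((\<Union>k\<in>?I. ?W k) - K \<inter> cball 0 1 \<union> (K \<inter> cball 0 1 - (\<Union>k\<in>?I. ?W k)))"
      using sub diff \<open>negligible N\<close> by (intro negligible_subset[OF \<open>negligible N\<close>]) blast
  qed
  also have "\<dots> = (\<Sum>k\<in>?I. measure lebesgue (?W k))"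
  proof (rule measure_finite_Union)
    show "disjoint_family_on ?W ?I" unfolding disjoint_family_on_def using open_sector_disjoint by blast
    show "?W ` ?I \<subseteq> sets lebesgue" using open_sector_measure(1) by (auto intro: fmeasurableD)
    show "emeasure lebesgue (?W k) \<noteq> \<infinity>" if "k \<in> ?I" for k
      using open_sector_measure(1)[of k] by (auto simp: fmeasurable_def)
  qed simp
  also have "\<dots> = 2 * real n * (V / 4)" unfolding open_sector_measure(2) by simp
  finally show ?thesis .
qed

end


section \<open>Recovering the vertex coordinates\<close>

text \<open>If the ray never left \<open>K\<close>, its points divided by the parameter would stay
  in \<open>K\<close> and tend to \<open>d\<close>, contradicting closedness.\<close>

lemma frontier_exit:
  fixes K :: "'a::euclidean_space set"
  assumes K: "closed K" "conic K" and x: "x \<in> K" and d: "d \<notin> K"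
  obtains t where "0 \<le> t" "x + t *\<^sub>R d \<in> frontier K"
proof -
  have "\<exists>s\<ge>0. x + s *\<^sub>R d \<notin> K"
  proof (rule ccontr)
    assume "\<not> ?thesis"
    then have all: "x + s *\<^sub>R d \<in> K" if "0 \<le> s" for s using that by blast
    have mem: "inverse (real (Suc i)) *\<^sub>R x + d \<in> K" for i
    proof -
      have "inverse (real (Suc i)) *\<^sub>R (x + real (Suc i) *\<^sub>R d) \<in> K"
        by (rule conicD[OF K(2) all]) auto
      then show ?thesis by (simp add: scaleR_add_right del: of_nat_Suc)
    qed
    have lim: "(\<lambda>i. inverse (real (Suc i)) *\<^sub>R x + d) \<longlonglongrightarrow> 0 *\<^sub>R x + d"
      by (intro tendsto_intros LIMSEQ_inverse_real_of_nat)
    from closed_sequentially[OF K(1) mem lim] show False using d by simp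
  qed
  then obtain s where s: "0 \<le> s" "x + s *\<^sub>R d \<notin> K" by blast
  have "closed_segment x (x + s *\<^sub>R d) \<inter> frontier K \<noteq> {}"
    using x s by (intro connected_Int_frontier) auto
  then obtain y where y: "y \<in> closed_segment x (x + s *\<^sub>R d)" "y \<in> frontier K" by blast
  then obtain u where "0 \<le> u" "u \<le> 1" "y = (1 - u) *\<^sub>R x + u *\<^sub>R (x + s *\<^sub>R d)" by (auto simp: in_segment)
  then have "y = x + (u * s) *\<^sub>R d" by (simp add: algebra_simps)
  with that[of "u * s"] y s \<open>0 \<le> u\<close> show thesis by simp
qed

text \<open>A vertex spans an extreme ray. If \<open>u - p\<close> were in the cone,
  \<open>u\<close> would be the midpoint of \<open>2 *\<^sub>R p\<close> and
  \<open>2 *\<^sub>R (u - p)\<close>; then \<open>p\<close> would lie on the ray of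
  \<open>u\<close>, and equal norms would give \<open>p = u\<close>.\<close>

lemma vertex_diff_notin:
  assumes P: "P \<subseteq> sphere 0 1" and u: "u \<in> sph_vertices P" and p: "p \<in> P" and ne: "u \<noteq> p"
  shows "u - p \<notin> conic hull P"
proof
  assume "u - p \<in> conic hull P"
  then have d: "2 *\<^sub>R (u - p) \<in> conic hull P" using conicD[OF conic_conic_hull] by fastforce
  have q: "2 *\<^sub>R p \<in> conic hull P" using p conicD[OF conic_conic_hull hull_inc] by fastforce
  have nu: "norm u = 1" and np: "norm p = 1" using P u p unfolding sph_vertices_def by auto
  have face: "(conic hull {u}) face_of (conic hull P)" using u unfolding sph_vertices_def by simp
  have neq: "2 *\<^sub>R p \<noteq> 2 *\<^sub>R (u - p)"
  proof
    assume "2 *\<^sub>R p = 2 *\<^sub>R (u - p)"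
    then have "p = u - p" by simp
    then have "u = 2 *\<^sub>R p" by (simp add: scaleR_2 algebra_simps)
    then show False using nu np by simp
  qed
  have mid: "u = (1 - 1 / 2) *\<^sub>R (2 *\<^sub>R p) + (1 / 2) *\<^sub>R (2 *\<^sub>R (u - p))" by simp
  have "u \<in> open_segment (2 *\<^sub>R p) (2 *\<^sub>R (u - p))"
    unfolding in_segment by (intro conjI exI[of _ "1 / 2"]) (rule neq, simp, simp, rule mid)
  moreover have "u \<in> conic hull {u}" by (simp add: hull_inc)
  ultimately have "2 *\<^sub>R p \<in> conic hull {u}" using face_ofD[OF face _ q d] by metis
  then obtain t where t: "0 \<le> t" "2 *\<^sub>R p = t *\<^sub>R u" unfolding conic_hull_explicit by auto
  from arg_cong[OF t(2), of norm] have "t = 2" using nu np t(1) by simp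
  then show False using t ne by simp
qed

text \<open>
  A line parallel to the difference of two vertices leaves the cone on both sides, and it does so
  through facets.
\<close>

lemma conic_hull_eq_convex_cone_hull:
  assumes P: "convex_sph_polyhedron P" and U: "U \<subseteq> P"
    and facets: "\<And>X. X \<in> sph_facets P \<Longrightarrow> X \<subseteq> convex_cone hull U"
    and u: "u1 \<in> sph_vertices P" "u2 \<in> sph_vertices P" "u1 \<noteq> u2"
  shows "conic hull P = convex_cone hull U"
proof -
  let ?K = "conic hull P" and ?H = "convex_cone hull U"
  have sph: "P \<subseteq> sphere 0 1" and poly: "polyhedron ?K" and int: "interior ?K \<noteq> {}"
    using P unfolding convex_sph_polyhedron_def by auto
  have K: "closed ?K" "convex ?K" "conic ?K" using poly polyhedron_imp_closed polyhedron_imp_convex conic_conic_hull by auto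
  have uP: "u1 \<in> P" "u2 \<in> P" using u unfolding sph_vertices_def by auto
  have "convex_cone ?K" unfolding convex_cone_def using K uP hull_inc by fastforce
  then have sub: "?H \<subseteq> ?K" using U by (intro hull_minimal) (auto intro: hull_inc)
  have facet_sub: "F \<subseteq> ?H" if F: "F facet_of ?K" for F
  proof
    fix x assume x: "x \<in> F"
    have face: "F face_of ?K" using F by (rule facet_of_imp_face_of)
    have xK: "x \<in> ?K" using face x face_of_imp_subset by blast
    show "x \<in> ?H"
    proof (cases "x = 0")
      case True then show ?thesis by (simp add: convex_cone_hull_contains_0)
    next
      case False
      define s where "s = 1 / norm x"
      have s: "0 < s" unfolding s_def using False by simp
      have z: "(s + 2) *\<^sub>R x \<in> ?K" "0 \<in> ?K" using conicD[OF K(3) xK, of "s + 2"] conicD[OF K(3) xK, of 0] s by simp_all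
      \<comment> \<open>A facet is closed under scaling: \<open>x\<close> lies strictly between the
        origin and a far multiple of itself, so both are in \<open>F\<close>. The bound
        \<open>s + 2\<close> exceeds both 1 and \<open>s\<close>, so the segment also contains the
        unit vector along \<open>x\<close>.\<close>
      have "x = (1 - 1 / (s + 2)) *\<^sub>R 0 + (1 / (s + 2)) *\<^sub>R ((s + 2) *\<^sub>R x)" using s by simp
      then have "x \<in> open_segment 0 ((s + 2) *\<^sub>R x)"
        unfolding in_segment using s False by (intro conjI exI[of _ "1 / (s + 2)"]) auto
      then have zF: "0 \<in> F" "(s + 2) *\<^sub>R x \<in> F" using face_ofD[OF face _ z(2) z(1) x] by auto
      have "convex F" using face by (rule face_of_imp_convex)
      then have "(1 - s / (s + 2)) *\<^sub>R 0 + (s / (s + 2)) *\<^sub>R ((s + 2) *\<^sub>R x) \<in> F"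
        using zF s by (intro convexD) auto
      then have "s *\<^sub>R x \<in> F" using s by simp
      moreover have "s *\<^sub>R x \<in> sphere 0 1" unfolding s_def using False by simp
      ultimately have "s *\<^sub>R x \<in> sphere 0 1 \<inter> F" by blast
      moreover have "sphere 0 1 \<inter> F \<in> sph_facets P" unfolding sph_facets_def using F by blast
      ultimately have "s *\<^sub>R x \<in> ?H" using facets by blast
      then have "norm x *\<^sub>R (s *\<^sub>R x) \<in> ?H" by (rule convex_cone_hull_mul) simp
      then show ?thesis unfolding s_def using False by simp
    qed
  qed
  have front: "y \<in> ?H" if "y \<in> frontier ?K" for y
  proof -
    have "y \<in> ?K - rel_interior ?K"
      using that K(1) rel_interior_nonempty_interior[OF int] unfolding frontier_def by simp
    then show ?thesis using rel_boundary_of_polyhedron[OF poly] facet_sub by blast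
  qed
  have "?K \<subseteq> ?H"
  proof
    fix x assume x: "x \<in> ?K"
    have "u1 - u2 \<notin> ?K" "u2 - u1 \<notin> ?K" using vertex_diff_notin[OF sph] u uP by auto
    then obtain t1 t2 where t: "0 \<le> t1" "x + t1 *\<^sub>R (u1 - u2) \<in> frontier ?K" "0 \<le> t2" "x + t2 *\<^sub>R (u2 - u1) \<in> frontier ?K"
      using frontier_exit[OF K(1,3) x] by metis
    show "x \<in> ?H"
    proof (cases "t1 + t2 = 0")
      case True
      then have "t1 = 0" using t by linarith
      then show ?thesis using front[OF t(2)] by simp
    next
      case False
      then have s: "0 < t1 + t2" using t by simp
      \<comment> \<open>The weights are those for which the opposite displacements along the
        difference of the two vertices cancel, so the combination of the two exit points is
        \<open>x\<close>.\<close>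
      have "(t2 / (t1 + t2)) *\<^sub>R (x + t1 *\<^sub>R (u1 - u2)) + (t1 / (t1 + t2)) *\<^sub>R (x + t2 *\<^sub>R (u2 - u1)) \<in> ?H"
        using t s by (intro convex_cone_hull_add[OF convex_cone_hull_mul[OF front[OF t(2)]] convex_cone_hull_mul[OF front[OF t(4)]]]) auto
      also have "(t2 / (t1 + t2)) *\<^sub>R (x + t1 *\<^sub>R (u1 - u2)) + (t1 / (t1 + t2)) *\<^sub>R (x + t2 *\<^sub>R (u2 - u1))
        = (t2 / (t1 + t2) + t1 / (t1 + t2)) *\<^sub>R x" by (simp add: algebra_simps)
      also have "t2 / (t1 + t2) + t1 / (t1 + t2) = 1" using s by (simp add: add.commute flip: add_divide_distrib)
      finally show ?thesis by simp
    qed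
  qed
  with sub show ?thesis by blast
qed

lemma sph_volume_eq_measure_ball:
  assumes "P \<subseteq> sphere 0 1"
  shows "sph_volume P = 4 * measure lebesgue (conic hull P \<inter> cball 0 1)"
proof -
  have "{r *\<^sub>R x |r x. 0 \<le> r \<and> r \<le> 1 \<and> x \<in> P} = conic hull P \<inter> cball 0 1"
    unfolding conic_hull_explicit using assms by force
  then show ?thesis unfolding sph_volume_def by simp
qed

text \<open>The vertices are the orbit of \<open>v 0\<close> under the mirror rotation, so its four
  coordinates in the frame of the rotation determine them all. The facets are hulls of vertices,
  hence the cone is the hull of the orbit.\<close>

lemma antiprism_frame_exists:
  assumes n: "2 \<le> n" and anti: "spherical_antiprism n a c P"
  obtains E1 E2 Q T r h w where "antiprism_frame E1 E2 Q T n r h w"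
    "conic hull P = antiprism_frame.K E1 E2 Q T n r h w"
    "sph_dist (antiprism_frame.v E1 E2 Q T n r h w 0) (antiprism_frame.v E1 E2 Q T n r h w 2) = a"
    "sph_dist (antiprism_frame.v E1 E2 Q T n r h w 0) (antiprism_frame.v E1 E2 Q T n r h w 1) = c"
proof -
  have conv: "convex_sph_polyhedron P" using anti unfolding spherical_antiprism_def by (rule conjunct1)
  from anti[unfolded spherical_antiprism_def, THEN conjunct2] obtain v f where D: "mirror_rotation (pi / real n) f \<and> f ` P = P \<and>
        bij_betw v {..<2 * n} (sph_vertices P) \<and>
        (\<forall>k. f (v k) = v (k + 1)) \<and>
        sph_facets P =
          {sph_hull {v k, v (k + 1), v (k + 2)} | k. k < 2 * n} \<union>
          (if n \<ge> 3 then {sph_hull {v k | k. k < 2 * n \<and> even k},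
                           sph_hull {v k | k. k < 2 * n \<and> odd k}}
           else {}) \<and>
        (\<forall>k. sph_dist (v k) (v (k + 2)) = a) \<and>
        (\<forall>k. sph_dist (v k) (v (k + 1)) = c)"
    by (elim exE) (rule that)
  note mir = D[THEN conjunct1] and D2 = D[THEN conjunct2]
  note fP = D2[THEN conjunct1] and D3 = D2[THEN conjunct2]
  note bij = D3[THEN conjunct1] and D4 = D3[THEN conjunct2]
  note fv = D4[THEN conjunct1, THEN spec] and D5 = D4[THEN conjunct2]
  note fac = D5[THEN conjunct1] and D6 = D5[THEN conjunct2]
  note da = D6[THEN conjunct1, THEN spec] and dc = D6[THEN conjunct2, THEN spec]
  from mir obtain p q \<rho> where rot: "rotation_about p q (pi / real n) \<rho>" and f: "f = reflection q \<circ> \<rho>"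
    unfolding mirror_rotation_def by blast
  define \<theta> where "\<theta> = pi / real n"
  from rot obtain e1 e2 where lin: "linear \<rho>" and on: "norm p = 1" "norm q = 1" "norm e1 = 1" "norm e2 = 1"
        "p \<bullet> q = 0" "p \<bullet> e1 = 0" "p \<bullet> e2 = 0" "q \<bullet> e1 = 0" "q \<bullet> e2 = 0" "e1 \<bullet> e2 = 0"
    and rho: "\<rho> p = p" "\<rho> q = q" "\<rho> e1 = cos \<theta> *\<^sub>R e1 + sin \<theta> *\<^sub>R e2" "\<rho> e2 = - sin \<theta> *\<^sub>R e1 + cos \<theta> *\<^sub>R e2"
    unfolding rotation_about_def \<theta>_def by blast
  interpret fr: orthonormal_frame e1 e2 q p
    using on by unfold_locales (auto simp: inner_commute norm_eq_1)
  have sph: "P \<subseteq> sphere 0 1" and int: "interior (conic hull P) \<noteq> {}" using conv unfolding convex_sph_polyhedron_def by auto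
  have v0: "v 0 \<in> sph_vertices P" "v 1 \<in> sph_vertices P" "v 0 \<noteq> v 1"
  proof -
    have "0 \<in> {..<2 * n}" "1 \<in> {..<2 * n}" using n by auto
    then show "v 0 \<in> sph_vertices P" "v 1 \<in> sph_vertices P" "v 0 \<noteq> v 1"
      using bij unfolding bij_betw_def by (blast, blast, metis inj_onD zero_neq_one)
  qed
  have vP: "v k \<in> P" for k
  proof (induction k)
    case 0 then show ?case using v0 unfolding sph_vertices_def by simp
  next
    case (Suc k) then show ?case using fP fv[of k] by (metis Suc_eq_plus1 imageI)
  qed
  have fx: "f x = (x \<bullet> e1 * cos \<theta> - x \<bullet> e2 * sin \<theta>) *\<^sub>R e1 + (x \<bullet> e1 * sin \<theta> + x \<bullet> e2 * cos \<theta>) *\<^sub>R e2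
      - (x \<bullet> q) *\<^sub>R q + (x \<bullet> p) *\<^sub>R p" for x
  proof -
    have "\<rho> x = \<rho> ((x \<bullet> e1) *\<^sub>R e1 + (x \<bullet> e2) *\<^sub>R e2 + (x \<bullet> q) *\<^sub>R q + (x \<bullet> p) *\<^sub>R p)"
      using fr.frame_expansion[of x] by simp
    also have "\<dots> = (x \<bullet> e1) *\<^sub>R \<rho> e1 + (x \<bullet> e2) *\<^sub>R \<rho> e2 + (x \<bullet> q) *\<^sub>R \<rho> q + (x \<bullet> p) *\<^sub>R \<rho> p"
      using lin by (simp add: linear_add linear_scale)
    finally have rx: "\<rho> x = (x \<bullet> e1 * cos \<theta> - x \<bullet> e2 * sin \<theta>) *\<^sub>R e1 + (x \<bullet> e1 * sin \<theta> + x \<bullet> e2 * cos \<theta>) *\<^sub>R e2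
      + (x \<bullet> q) *\<^sub>R q + (x \<bullet> p) *\<^sub>R p" unfolding rho by (simp add: algebra_simps)
    then have e: "\<rho> x \<bullet> q = x \<bullet> q" by (simp add: inner_add_left fr.orthonormal fr.orthonormal_sym)
    have "(2 * (x \<bullet> q)) *\<^sub>R q = (x \<bullet> q) *\<^sub>R q + (x \<bullet> q) *\<^sub>R q" by (simp flip: scaleR_add_left)
    then show ?thesis unfolding f o_def reflection_def e unfolding rx by simp
  qed
  define a1 a2 b g where "a1 = v 0 \<bullet> e1" and "a2 = v 0 \<bullet> e2" and "b = v 0 \<bullet> q" and "g = v 0 \<bullet> p"
  have coords: "v k \<bullet> e1 = a1 * cos (real k * \<theta>) - a2 * sin (real k * \<theta>)" "v k \<bullet> e2 = a1 * sin (real k * \<theta>) + a2 * cos (real k * \<theta>)"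
     "v k \<bullet> q = (if even k then b else - b)" "v k \<bullet> p = g" for k
  proof (induction k)
    case 0
    show "v 0 \<bullet> e1 = a1 * cos (real 0 * \<theta>) - a2 * sin (real 0 * \<theta>)" "v 0 \<bullet> e2 = a1 * sin (real 0 * \<theta>) + a2 * cos (real 0 * \<theta>)"
      "v 0 \<bullet> q = (if even (0::nat) then b else - b)" "v 0 \<bullet> p = g"
      by (simp_all add: a1_def a2_def b_def g_def)
  next
    case (Suc k)
    have k1: "real (Suc k) * \<theta> = real k * \<theta> + \<theta>" by (simp add: algebra_simps)
    have vk: "v (Suc k) = f (v k)" using fv[of k] by simp
    have e: "f y \<bullet> e1 = y \<bullet> e1 * cos \<theta> - y \<bullet> e2 * sin \<theta>" "f y \<bullet> e2 = y \<bullet> e1 * sin \<theta> + y \<bullet> e2 * cos \<theta>" "f y \<bullet> q = - (y \<bullet> q)" "f y \<bullet> p = y \<bullet> p" for y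
      unfolding fx by (simp_all add: inner_add_left inner_diff_left fr.orthonormal fr.orthonormal_sym)
    show "v (Suc k) \<bullet> e1 = a1 * cos (real (Suc k) * \<theta>) - a2 * sin (real (Suc k) * \<theta>)"
      "v (Suc k) \<bullet> e2 = a1 * sin (real (Suc k) * \<theta>) + a2 * cos (real (Suc k) * \<theta>)"
      "v (Suc k) \<bullet> q = (if even (Suc k) then b else - b)" "v (Suc k) \<bullet> p = g"
      unfolding vk e Suc k1 cos_add sin_add by (simp_all add: algebra_simps)
  qed
  have hull: "conic hull P = convex_cone hull (range v)"
  proof (rule conic_hull_eq_convex_cone_hull[OF conv _ _ v0])
    show "range v \<subseteq> P" using vP by auto
    fix X assume "X \<in> sph_facets P"
    then have "(\<exists>k. X = sph_hull {v k, v (k + 1), v (k + 2)}) \<or>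
        X = sph_hull {v k | k. k < 2 * n \<and> even k} \<or> X = sph_hull {v k | k. k < 2 * n \<and> odd k}"
      unfolding fac by (auto split: if_splits)
    moreover have sub: "sph_hull Y \<subseteq> convex_cone hull (range v)" if "Y \<subseteq> range v" for Y
      unfolding sph_hull_def using hull_mono[OF that, of convex_cone] by blast
    have "sph_hull {v k, v (k + 1), v (k + 2)} \<subseteq> convex_cone hull (range v)" for k
      by (rule sub) auto
    moreover have "sph_hull {v k | k. k < 2 * n \<and> even k} \<subseteq> convex_cone hull (range v)"
      by (rule sub) auto
    moreover have "sph_hull {v k | k. k < 2 * n \<and> odd k} \<subseteq> convex_cone hull (range v)"
      by (rule sub) auto
    ultimately show "X \<subseteq> convex_cone hull (range v)" by (elim disjE exE) metis+
  qed
  \<comment> \<open>A vector orthogonal to all vertices would confine the cone to a hyperplane and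
    leave it without interior. This excludes zero height, zero pole coordinate and zero distance
    from the axis plane.\<close>
  have span: "z = 0" if z: "\<And>k. z \<bullet> v k = 0" for z
  proof (rule ccontr)
    assume "z \<noteq> 0"
    have "convex_cone {x. z \<bullet> x = 0}" unfolding convex_cone_iff by (auto simp: inner_add_right)
    then have "convex_cone hull (range v) \<subseteq> {x. z \<bullet> x = 0}" using z by (intro hull_minimal) auto
    then have "interior (conic hull P) \<subseteq> interior {x. z \<bullet> x = 0}" unfolding hull by (rule interior_mono)
    then show False using int interior_hyperplane[OF \<open>z \<noteq> 0\<close>] by auto
  qed
  have "b \<noteq> 0" using span[of q] coords(3) on(2) by (auto simp: inner_commute)
  have "g \<noteq> 0" using span[of p] coords(4) on(1) by (auto simp: inner_commute)
  have "\<not> (a1 = 0 \<and> a2 = 0)" using span[of e1] coords(1) on(3) by (auto simp: inner_commute)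
  define r where "r = sqrt (a1\<^sup>2 + a2\<^sup>2)"
  have r2: "r\<^sup>2 = a1\<^sup>2 + a2\<^sup>2" unfolding r_def by simp
  have r: "0 < r" unfolding r_def using \<open>\<not> (a1 = 0 \<and> a2 = 0)\<close> by (simp add: sum_power2_gt_zero_iff)
  \<comment> \<open>The rotation plane is turned until \<open>v 0\<close> lies along
    \<open>E1\<close>; the signs of \<open>Q\<close> and \<open>T\<close> make its height negative
    and its pole coordinate positive.\<close>
  define E1 E2 Q T where "E1 = (a1 / r) *\<^sub>R e1 + (a2 / r) *\<^sub>R e2" and "E2 = (- a2 / r) *\<^sub>R e1 + (a1 / r) *\<^sub>R e2"
    and "Q = (- sgn b) *\<^sub>R q" and "T = sgn g *\<^sub>R p"
  have rr: "a1 / r * (a1 / r) + a2 / r * (a2 / r) = 1"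
  proof -
    have "a1 / r * (a1 / r) + a2 / r * (a2 / r) = (a1\<^sup>2 + a2\<^sup>2) / r\<^sup>2"
      by (simp add: power2_eq_square add_divide_distrib)
    also have "\<dots> = 1" unfolding r2[symmetric] using r by simp
    finally show ?thesis .
  qed
  have unit: "r\<^sup>2 + \<bar>b\<bar>\<^sup>2 + \<bar>g\<bar>\<^sup>2 = 1"
  proof -
    have "norm (v 0) = 1" using vP[of 0] sph by auto
    then show ?thesis using fr.frame_norm[of "v 0"] unfolding r2 a1_def a2_def b_def g_def by simp
  qed
  have fram: "antiprism_frame E1 E2 Q T n r \<bar>b\<bar> \<bar>g\<bar>"
  proof unfold_locales
    show "E1 \<bullet> E1 = 1" "E2 \<bullet> E2 = 1" unfolding E1_def E2_def using rr
      by (simp_all add: inner_add_left inner_add_right inner_diff_left inner_diff_right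
          fr.orthonormal fr.orthonormal_sym add.commute)
    show "Q \<bullet> Q = 1" "T \<bullet> T = 1" unfolding Q_def T_def using \<open>b \<noteq> 0\<close> \<open>g \<noteq> 0\<close>
      by (simp_all add: fr.orthonormal sgn_if)
    show "E1 \<bullet> E2 = 0" "E1 \<bullet> Q = 0" "E1 \<bullet> T = 0" "E2 \<bullet> Q = 0" "E2 \<bullet> T = 0" "Q \<bullet> T = 0"
      unfolding E1_def E2_def Q_def T_def
      by (simp_all add: inner_add_left inner_add_right inner_diff_left inner_diff_right fr.orthonormal fr.orthonormal_sym)
    show "2 \<le> n" "0 < r" "0 < \<bar>b\<bar>" "0 < \<bar>g\<bar>" "r\<^sup>2 + \<bar>b\<bar>\<^sup>2 + \<bar>g\<bar>\<^sup>2 = 1" using n r \<open>b \<noteq> 0\<close> \<open>g \<noteq> 0\<close> unit by auto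
  qed
  interpret af: antiprism_frame E1 E2 Q T n r "\<bar>b\<bar>" "\<bar>g\<bar>" by (rule fram)
  have av: "af.v (int k) = v k" for k
  proof (rule fr.frame_eqI)
    have al: "af.al = \<theta>" unfolding af.al_def \<theta>_def ..
    show "af.v (int k) \<bullet> e1 = v k \<bullet> e1" "af.v (int k) \<bullet> e2 = v k \<bullet> e2"
      unfolding coords af.v_def al unfolding E1_def E2_def Q_def T_def using r
      by (simp_all add: inner_add_left inner_diff_left fr.orthonormal fr.orthonormal_sym field_simps)
    show "af.v (int k) \<bullet> q = v k \<bullet> q" "af.v (int k) \<bullet> p = v k \<bullet> p"
      unfolding coords af.v_def al unfolding E1_def E2_def Q_def T_def af.sg_def
      by (simp_all add: inner_add_left inner_diff_left fr.orthonormal fr.orthonormal_sym abs_sgn)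
  qed
  have "range af.v = range v"
  proof
    show "range v \<subseteq> range af.v" using av by (metis image_subsetI rangeI)
    show "range af.v \<subseteq> range v"
    proof
      fix y assume "y \<in> range af.v"
      then obtain k where "y = af.v k" by blast
      also have "\<dots> = af.v (int (nat (k mod (2 * int n))))" using n by (simp add: af.period_mod)
      finally show "y \<in> range v" unfolding av by simp
    qed
  qed
  then have "conic hull P = af.K" unfolding hull af.K_def by simp
  moreover have "sph_dist (af.v 0) (af.v 2) = a" "sph_dist (af.v 0) (af.v 1) = c"
    using da[of 0] dc[of 0] av[of 0] av[of 1] av[of 2] by (simp_all add: numeral_2_eq_2)
  ultimately show thesis using that fram by blast
qed

theorem theorem6:
  fixes n :: nat and a c c0 :: real and P :: "(real ^ 4) set"
  assumes "n \<ge> 2"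
    and "spherical_antiprism n a c P"
    and "c0 \<in> {0..pi}"
    and "2 * cos c0 * (1 + cos (pi / n)) = 1 + cos a + 2 * cos (pi / n)"
  shows
    "let G = (\<lambda>t. - 2 * (cos t - cos (pi / n)) * sin a * sin t);
         H = (\<lambda>t. (1 - cos a) * (1 + cos a + 2 * (cos t)\<^sup>2 - 4 * cos t * cos (pi / n)));
         R = (\<lambda>t. (1 + cos a)\<^sup>2 - 4 * ((cos t)\<^sup>2 + (sin t)\<^sup>2 * (cos (pi / n))\<^sup>2
                    - (1 - cos a) * cos t * cos (pi / n)));
         f = (\<lambda>t. (a * G t + t * H t) / ((1 + cos a - 2 * (cos t)\<^sup>2) * sqrt (R t)))
     in interval_lebesgue_integrable lborel (ereal c0) (ereal c) f \<and>
        sph_volume P = n * (LBINT t=c0..c. f t)"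
proof -
  from antiprism_frame_exists[OF assms(1,2)] obtain E1 E2 Q T r h w where fram: "antiprism_frame E1 E2 Q T n r h w"
    and K: "conic hull P = antiprism_frame.K E1 E2 Q T n r h w"
    and da: "sph_dist (antiprism_frame.v E1 E2 Q T n r h w 0) (antiprism_frame.v E1 E2 Q T n r h w 2) = a"
    and dc: "sph_dist (antiprism_frame.v E1 E2 Q T n r h w 0) (antiprism_frame.v E1 E2 Q T n r h w 1) = c" .
  interpret af: antiprism_frame E1 E2 Q T n r h w by (rule fram)
  have sph: "P \<subseteq> sphere 0 1" using assms(2) unfolding spherical_antiprism_def convex_sph_polyhedron_def by simp
  have C: "cos (pi / n) = af.C" "af.profile.C = af.C"
  proof -
    show "cos (pi / n) = af.C" unfolding af.C_def af.al_def ..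
    show "af.profile.C = af.C" unfolding af.profile.C_def by (simp add: field_simps)
  qed
  have inner_v: "af.v 0 \<bullet> af.v k = r\<^sup>2 * cos (of_int k * af.al) + af.sg k * h\<^sup>2 + w\<^sup>2" for k
    unfolding af.v_def[of k] inner_add_right inner_diff_right inner_scaleR_right af.v_inner
    by (simp add: power2_eq_square af.sg_def)
  have "af.v 0 \<bullet> af.v 2 = af.profile.base_cos"
  proof -
    have "cos (2 * af.al) = 1 - 2 * af.S\<^sup>2" unfolding af.S_def by (rule cos_double_sin)
    then have "r\<^sup>2 * cos (2 * af.al) = r\<^sup>2 - 2 * r\<^sup>2 * af.S\<^sup>2" by (simp add: right_diff_distrib)
    then show ?thesis unfolding inner_v af.profile.base_cos_def using af.unit by (simp add: af.sg_def)
  qed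
  then have a: "a = af.profile.base_angle" using da unfolding sph_dist_def af.profile.base_angle_def by simp
  have base_cos: "cos a = af.profile.base_cos" unfolding a by (rule af.profile.base_angle_half(6))
  have "af.v 0 \<bullet> af.v 1 = af.profile.lat_cos af.tilt"
    unfolding inner_v af.profile.lat_cos_def C af.profile_tilt using af.unit
    by (simp add: af.sg_def af.C_def algebra_simps)
  then have c: "c = af.profile.lat_angle af.tilt" using dc unfolding sph_dist_def af.profile.lat_angle_def by simp
  have "cos c0 = af.profile.lat_cos 0"
  proof -
    \<comment> \<open>As \<open>S * S = (1 - C) * (1 + C)\<close>, the right side of the given
      equation has the factor \<open>1 + C\<close>. The cofactor is twice the cosine of the lateral
      edge of the flat antiprism with the same \<open>a\<close>.\<close>
    have "2 * cos c0 * (1 + af.C) = 2 * af.profile.lat_cos 0 * (1 + af.C)"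
      using assms(4) unfolding C base_cos af.profile.base_cos_def af.profile.lat_cos_def af.profile.h_def af.S_sq
      by (simp add: power2_eq_square algebra_simps)
    then show ?thesis using af.C_bounds by simp
  qed
  then have c0: "c0 = af.profile.lat_angle 0" unfolding af.profile.lat_angle_def using assms(3) arccos_cos by force
  note vol = af.profile.volume_integral[OF af.tilt_bounds]
  have integrand: "(\<lambda>t. (a * (- 2 * (cos t - cos (pi / n)) * sin a * sin t) + t * ((1 - cos a) * (1 + cos a + 2 * (cos t)\<^sup>2 - 4 * cos t * cos (pi / n))))
      / ((1 + cos a - 2 * (cos t)\<^sup>2) * sqrt ((1 + cos a)\<^sup>2 - 4 * ((cos t)\<^sup>2 + (sin t)\<^sup>2 * (cos (pi / n))\<^sup>2
                    - (1 - cos a) * cos t * cos (pi / n))))) = af.profile.integrand"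
    unfolding af.profile.integrand_def[abs_def] af.profile.integrand_num_def af.profile.radicand_def C a af.profile.base_angle_half(6) ..
  \<comment> \<open>There are \<open>2 * n\<close> sectors of measure \<open>V / 4\<close>, and
    spherical volume is four times the measure of the solid cone.\<close>
  have "sph_volume P = real n * (2 * af.profile.V af.tilt)"
    unfolding sph_volume_eq_measure_ball[OF sph] K af.measure_K_ball af.V_def by simp
  then show ?thesis
    unfolding Let_def integrand interval_lebesgue_integrable_def c0 c vol(2) using vol(1,3) by simp
qed

end
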